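(* For every connected bipartite graph $H$ on at most $5$ vertices and every positive integer $a$, the graph $H^{+a}$ is common. In particular, $K_{2,2,a}$ and $K_{2,3,a}$ are common for every $a\ge 1$.
   Context: For a graph $H$ and a graphon $W$ (a measurable symmetric function $W:[0,1]^2\to[0,1]$), let $t_H(W)=\int_{[0,1]^{V(H)}}\prod_{uv\in E(H)}W(x_u,x_v)\,dx$ and $m_H(W)=t_H(W)+t_H(1-W)$. A graph $H$ is common if $m_H(W)\ge 2^{1-e(H)}$ for every graphon $W$. For a graph $H$ and a positive integer $a$, $H^{+a}$ is the graph obtained from $H$ by adding $a$ new vertices, pairwise non-adjacent, each adjacent to every vertex of $H$. *)

theory Defs
  imports "HOL-Analysis.Analysis"
begin

text \<open>A finite simple graph with vertex set {0..<n}; each edge is stored once as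
  an ordered pair (u,v) with u < v < n.\<close>
type_synonym graph = "nat \<times> (nat \<times> nat) set"

definition wf_graph :: "graph \<Rightarrow> bool" where
  "wf_graph H \<longleftrightarrow> snd H \<subseteq> {(u, v). u < v \<and> v < fst H}"

definition num_edges :: "graph \<Rightarrow> nat" where
  "num_edges H = card (snd H)"

definition connected_graph :: "graph \<Rightarrow> bool" where
  "connected_graph H \<longleftrightarrow> fst H \<ge> 1 \<and>
     (\<forall>u < fst H. \<forall>v < fst H. (u, v) \<in> (snd H \<union> (snd H)\<inverse>)\<^sup>*)"

definition bipartite_graph :: "graph \<Rightarrow> bool" where
  "bipartite_graph H \<longleftrightarrow> (\<exists>c :: nat \<Rightarrow> bool. \<forall>(u, v) \<in> snd H. c u \<noteq> c v)"

text \<open>H^{+a}: add a new pairwise non-adjacent vertices n,...,n+a-1, each joined to all of H.\<close>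
definition plus_graph :: "graph \<Rightarrow> nat \<Rightarrow> graph" where
  "plus_graph H a = (fst H + a, snd H \<union> {(u, fst H + i) | u i. u < fst H \<and> i < a})"

text \<open>Complete tripartite graph K_{p,q,r} on parts {0..<p}, {p..<p+q}, {p+q..<p+q+r}.\<close>
definition part_of :: "nat \<Rightarrow> nat \<Rightarrow> nat \<Rightarrow> nat" where
  "part_of p q x = (if x < p then 0 else if x < p + q then 1 else 2)"

definition complete_tripartite :: "nat \<Rightarrow> nat \<Rightarrow> nat \<Rightarrow> graph" where
  "complete_tripartite p q r =
     (p + q + r, {(u, v). u < v \<and> v < p + q + r \<and> part_of p q u \<noteq> part_of p q v})"

text \<open>Lebesgue measure on [0,1].\<close>
definition unit_interval :: "real measure" where
  "unit_interval = restrict_space lborel {0..1}"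

definition graphon :: "(real \<Rightarrow> real \<Rightarrow> real) \<Rightarrow> bool" where
  "graphon W \<longleftrightarrow>
     (\<lambda>(x, y). W x y) \<in> borel_measurable (unit_interval \<Otimes>\<^sub>M unit_interval) \<and>
     (\<forall>x \<in> {0..1}. \<forall>y \<in> {0..1}. W x y = W y x \<and> 0 \<le> W x y \<and> W x y \<le> 1)"

definition hom_density :: "graph \<Rightarrow> (real \<Rightarrow> real \<Rightarrow> real) \<Rightarrow> real" where
  "hom_density H W =
     integral\<^sup>L (Pi\<^sub>M {..<fst H} (\<lambda>_. unit_interval))
       (\<lambda>x. \<Prod>(u, v) \<in> snd H. W (x u) (x v))"

definition m_density :: "graph \<Rightarrow> (real \<Rightarrow> real \<Rightarrow> real) \<Rightarrow> real" where
  "m_density H W = hom_density H W + hom_density H (\<lambda>x y. 1 - W x y)"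

definition common :: "graph \<Rightarrow> bool" where
  "common H \<longleftrightarrow> (\<forall>W. graphon W \<longrightarrow> m_density H W \<ge> 2 powr (1 - real (num_edges H)))"

end

theory Submission
  imports Defs "HOL-Probability.Probability"
begin

text \<open>
  Write \<open>U = 2 W - 1\<close> and, for a colour \<open>s = \<plusminus>1\<close>, \<open>K\<^sub>s = 1 + s U\<close>.  The claim says that the sum over both
  colours of \<open>E (f D\<^sup>a)\<close> is at least 2, where \<open>f\<close> is the product of \<open>K\<^sub>s\<close> over the edges of a random
  copy of \<open>H\<close> and \<open>D\<close> is the normalised codegree of that copy.  Since
  \<open>D\<^sup>a \<ge> D + (a - 1) (w D - ((w + 1) / 2)\<^sup>2)\<close> for every real \<open>w\<close>, it suffices to bound \<open>E (f D)\<close> and,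
  for a suitable weight \<open>w\<close> on copies of \<open>H\<close>, \<open>E (f w D)\<close>.

  A connected bipartite graph on at most five vertices is a star or has a colour class \<open>{b, b'}\<close>.  In the second
  case let \<open>i\<close>, \<open>l\<close>, \<open>k\<close> be the numbers of vertices adjacent only to \<open>b\<close>, only to \<open>b'\<close>, to both.  Fixing the apex
  \<open>y\<close>, integrating out the other class and applying \<open>(\<integral>\<phi>)\<^sup>2 \<ge> 2 \<theta> \<integral>\<phi> - \<theta>\<^sup>2\<close> for each choice of the \<open>k\<close> common
  neighbours gives a lower bound involving only pairs \<open>(b, y)\<close>.  This bound depends on \<open>U(x,y)\<close>, the degrees and the
  codegree of \<open>x, y\<close>, and after adding multiples of three functions of pairs with mean zero it is pointwise nonnegative;
  that leaves elementary inequalities in at most four real variables, linear in \<open>U(x,y)\<close>.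
\<close>

subsection \<open>Polynomials given by coefficient lists, and Bernstein certificates\<close>

text \<open>The linearisation in \<open>w\<close> avoids a second apex: \<open>E (f D^2)\<close>
  counts copies of \<open>H\<close> with two apexes, whereas its linear lower bound has one apex or
  none. The price is the apex-free cost \<open>E (f ((w + 1) / 2)^2)\<close>, which the weighted
  term must outweigh. Equality at \<open>W = 1/2\<close> shapes every estimate. There
  \<open>U = 0\<close>, \<open>D = 1\<close> and \<open>w = \<theta> = 1\<close>, and the inequality
  for pairs is an equality whenever both degrees and the codegree vanish, whatever
  \<open>U(x,y)\<close> is. So approximations must be exact to first order at that point, and the
  multiples of the first two mean-zero functions are forced: they are the ones that cancel the
  linear terms in the codegree and in the degree sum. The weights are products of one factor for
  each centre; for the exponential ones the product depends only on the sum of the two degrees, so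
  the hard cases come down to the degree sum and the codegree.\<close>

fun peval :: "real list \<Rightarrow> real \<Rightarrow> real" where
  "peval [] x = 0"
| "peval (c # cs) x = c + x * peval cs x"

fun padd :: "real list \<Rightarrow> real list \<Rightarrow> real list" where
  "padd [] ys = ys"
| "padd xs [] = xs"
| "padd (x # xs) (y # ys) = (x + y) # padd xs ys"

fun pscale :: "real \<Rightarrow> real list \<Rightarrow> real list" where
  "pscale c [] = []"
| "pscale c (x # xs) = c * x # pscale c xs"

fun pmul :: "real list \<Rightarrow> real list \<Rightarrow> real list" where
  "pmul [] ys = []"
| "pmul (x # xs) ys = padd (pscale x ys) (0 # pmul xs ys)"

lemma peval_padd [simp]: "peval (padd xs ys) x = peval xs x + peval ys x"
  by (induction xs ys rule: padd.induct) (auto simp: algebra_simps)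

lemma peval_pscale [simp]: "peval (pscale c xs) x = c * peval xs x"
  by (induction xs) (auto simp: algebra_simps)

lemma peval_pmul [simp]: "peval (pmul xs ys) x = peval xs x * peval ys x"
  by (induction xs) (auto simp: algebra_simps)

fun binomial_row :: "nat \<Rightarrow> real list" where
  "binomial_row 0 = [1]"
| "binomial_row (Suc n) = padd (0 # binomial_row n) (binomial_row n)"

text \<open>Unnormalised Bernstein coefficients on the interval from 0 to \<open>b\<close>: with n =
  \<open>length cs - 1\<close> they are the q_i for which b^n p(x) is the sum of q_i x^i (b - x)^(n
  - i). Polynomials are explicit lists, constant term first, so a certificate is checked by
  rewriting alone.\<close>

fun bernstein :: "real \<Rightarrow> real list \<Rightarrow> real list" where
  "bernstein b [] = []"
| "bernstein b (c # cs) = padd (pscale c (binomial_row (length cs))) (0 # pscale b (bernstein b cs))"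

text \<open>The homogenisation Y ^ n * p (X / Y) of a polynomial p of degree at most n.\<close>
fun heval :: "nat \<Rightarrow> real list \<Rightarrow> real \<Rightarrow> real \<Rightarrow> real" where
  "heval n [] X Y = 0"
| "heval n (c # cs) X Y = c * Y ^ n + X * heval (n - 1) cs X Y"

lemma heval_padd: "heval n (padd xs ys) X Y = heval n xs X Y + heval n ys X Y"
  by (induction xs ys arbitrary: n rule: padd.induct) (auto simp: algebra_simps)

lemma heval_pscale: "heval n (pscale c xs) X Y = c * heval n xs X Y"
  by (induction xs arbitrary: n) (auto simp: algebra_simps)

lemma heval_Suc: "length xs \<le> Suc n \<Longrightarrow> heval (Suc n) xs X Y = Y * heval n xs X Y"
proof (induction xs arbitrary: n)
  case (Cons x xs)
  then show ?case by (cases n) (auto simp: algebra_simps)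
qed auto

lemma length_padd [simp]: "length (padd xs ys) = max (length xs) (length ys)"
  by (induction xs ys rule: padd.induct) auto

lemma length_binomial_row [simp]: "length (binomial_row n) = Suc n"
  by (induction n) auto

lemma heval_binomial_row: "heval n (binomial_row n) X Y = (X + Y) ^ n"
  by (induction n) (auto simp: heval_padd heval_Suc algebra_simps)

text \<open>The extra factor \<open>X + Y\<close> on both sides makes the exponent on the right
  \<open>length cs\<close>, so that the induction step needs no case split on an empty tail.\<close>

lemma heval_bernstein:
  "(X + Y) * heval (length cs - 1) (bernstein (X + Y) cs) X Y = (X + Y) ^ length cs * peval cs X"
proof (induction cs)
  case (Cons c cs)
  have "(X + Y) * (X * ((X + Y) * heval (length cs - 1) (bernstein (X + Y) cs) X Y))
      = (X + Y) * X * ((X + Y) ^ length cs * peval cs X)"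
    by (subst Cons.IH) (simp add: mult_ac)
  then show ?case
    by (simp add: heval_padd heval_pscale heval_binomial_row algebra_simps)
qed auto

lemma heval_nonneg: "list_all (\<lambda>c. 0 \<le> c) cs \<Longrightarrow> 0 \<le> X \<Longrightarrow> 0 \<le> Y \<Longrightarrow> 0 \<le> heval n cs X Y"
  by (induction cs arbitrary: n) auto

lemma peval_nonneg:
  assumes "list_all (\<lambda>c. 0 \<le> c) (bernstein b cs)" "0 < b" "0 \<le> x" "x \<le> b"
  shows "0 \<le> peval cs x"
proof -
  have "0 \<le> b * heval (length cs - 1) (bernstein b cs) x (b - x)"
    using assms by (intro mult_nonneg_nonneg heval_nonneg) auto
  then have "0 \<le> b ^ length cs * peval cs x"
    using heval_bernstein[of x "b - x" cs] by simp
  then show ?thesis using zero_less_power[OF assms(2), of "length cs"] by (simp add: zero_le_mult_iff)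
qed

text \<open>The last four bounds are the Bernstein coefficients in \<open>v\<close> over the
  interval from 0 to \<open>R\<close>, freed of powers of \<open>R\<close>. The length
  \<open>R\<close> stays symbolic because it will be a polynomial in a second variable.\<close>

lemma cubic_nonneg:
  fixes v R c0 c1 c2 c3 :: real
  assumes "0 \<le> v" "v \<le> R" "0 \<le> c0" "0 \<le> 3 * c0 + c1 * R" "0 \<le> 3 * c0 + 2 * c1 * R + c2 * R^2"
    "0 \<le> c0 + c1 * R + c2 * R^2 + c3 * R^3"
  shows "0 \<le> c0 + c1 * v + c2 * v^2 + c3 * v^3"
proof (cases "R = 0")
  case False
  have nn: "0 \<le> c0 * (R - v)^3" "0 \<le> (3 * c0 + c1 * R) * (v * (R - v)^2)"
    "0 \<le> (3 * c0 + 2 * c1 * R + c2 * R^2) * (v^2 * (R - v))" "0 \<le> (c0 + c1 * R + c2 * R^2 + c3 * R^3) * v^3"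
    using assms by (auto intro!: mult_nonneg_nonneg)
  have "R^3 * (c0 + c1 * v + c2 * v^2 + c3 * v^3) = c0 * (R - v)^3 + (3 * c0 + c1 * R) * (v * (R - v)^2)
      + (3 * c0 + 2 * c1 * R + c2 * R^2) * (v^2 * (R - v)) + (c0 + c1 * R + c2 * R^2 + c3 * R^3) * v^3"
    by algebra
  then have "0 \<le> R^3 * (c0 + c1 * v + c2 * v^2 + c3 * v^3)" using nn by linarith
  moreover have "0 < R^3" using False assms by simp
  ultimately show ?thesis by (simp add: zero_le_mult_iff)
qed (use assms in auto)

definition bernstein_nonneg :: "real \<Rightarrow> real list \<Rightarrow> bool" where
  "bernstein_nonneg b cs = list_all (\<lambda>c. 0 \<le> c) (bernstein b cs)"

text \<open>Bernstein form twice: in \<open>v\<close> over a range of length R(x), then in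
  \<open>x\<close> for each of the four resulting coefficients. An inequality in two variables
  becomes a list of signs of rational numbers.\<close>

lemma cubic_family_nonneg:
  assumes x: "0 < b" "0 \<le> x" "x \<le> b" and v: "0 \<le> v" "v \<le> peval R x"
    and c: "bernstein_nonneg b f0" "bernstein_nonneg b (padd (pscale 3 f0) (pmul f1 R))"
      "bernstein_nonneg b (padd (pscale 3 f0) (padd (pscale 2 (pmul f1 R)) (pmul f2 (pmul R R))))"
      "bernstein_nonneg b (padd f0 (padd (pmul f1 R) (padd (pmul f2 (pmul R R)) (pmul f3 (pmul R (pmul R R))))))"
  shows "0 \<le> peval f0 x + peval f1 x * v + peval f2 x * v^2 + peval f3 x * v^3"
  using c[unfolded bernstein_nonneg_def, THEN peval_nonneg, OF x]
  by (intro cubic_nonneg[OF v]) (auto simp: algebra_simps power2_eq_square power3_eq_cube)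

subsection \<open>The real inequality behind the complete bipartite graph K(2,3)\<close>

text \<open>Here D is the sum of the two degrees and K the codegree of a pair x, y with U(x,y) = 1; the coefficients A
  and B arise from the weight exp (- 6/5 s d), with a factor for each of the two degrees d.\<close>
definition k23fun :: "real \<Rightarrow> real \<Rightarrow> real \<Rightarrow> real \<Rightarrow> real" where
  "k23fun A B D K = A * (1 + D + K)^3 - B * (1 - D + K)^3 - 3 * K - 1 + 53/20 * D^2 - 18/5 * D + K * D^2 / 4 - D^3 / 8"

text \<open>\<open>f0\<close> to \<open>f3\<close> are the coefficients of the powers of
  \<open>v\<close> when the codegree is \<open>K + e * v\<close>; \<open>p\<close> and
  \<open>r\<close> are the two cubed bases at \<open>v = 0\<close>. Since \<open>e^2 = 1\<close>,
  the sign survives only in the odd coefficients.\<close>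

lemma k23fun_region:
  fixes A B D K R :: "real list" and e :: real
  defines "p \<equiv> padd [1] (padd D K)" and "r \<equiv> padd [1] (padd (pscale (-1) D) K)"
  defines "f0 \<equiv> padd (pmul A (pmul p (pmul p p))) (padd (pscale (-1) (pmul B (pmul r (pmul r r))))
      (padd (pscale (-3) K) (padd [-1] (padd (pscale (53/20) (pmul D D)) (padd (pscale (-18/5) D)
      (padd (pscale (1/4) (pmul K (pmul D D))) (pscale (-1/8) (pmul D (pmul D D)))))))))"
    and "f1 \<equiv> pscale e (padd (pscale 3 (pmul A (pmul p p))) (padd (pscale (-3) (pmul B (pmul r r)))
      (padd [-3] (pscale (1/4) (pmul D D)))))"
    and "f2 \<equiv> pscale 3 (padd (pmul A p) (pscale (-1) (pmul B r)))"
    and "f3 \<equiv> pscale e (padd A (pscale (-1) B))"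
  assumes x: "0 < b" "0 \<le> x" "x \<le> b" and v: "0 \<le> v" "v \<le> peval R x" and e: "e = 1 \<or> e = -1"
    and c: "bernstein_nonneg b f0" "bernstein_nonneg b (padd (pscale 3 f0) (pmul f1 R))"
      "bernstein_nonneg b (padd (pscale 3 f0) (padd (pscale 2 (pmul f1 R)) (pmul f2 (pmul R R))))"
      "bernstein_nonneg b (padd f0 (padd (pmul f1 R) (padd (pmul f2 (pmul R R)) (pmul f3 (pmul R (pmul R R))))))"
  shows "0 \<le> k23fun (peval A x) (peval B x) (peval D x) (peval K x + e * v)"
proof -
  have "k23fun (peval A x) (peval B x) (peval D x) (peval K x + e * v)
     = peval f0 x + peval f1 x * v + peval f2 x * v^2 + peval f3 x * v^3"
    using e unfolding k23fun_def f0_def f1_def f2_def f3_def p_def r_def peval_padd peval_pmul peval_pscale peval.simps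
    by (elim disjE) (simp_all add: field_simps power2_eq_square power3_eq_cube)
  with cubic_family_nonneg[OF x v c] show ?thesis by simp
qed

lemma k23fun_mono:
  assumes "A0 \<le> A" "B \<le> B0" "0 \<le> 1 + D + K" "0 \<le> 1 - D + K"
  shows "k23fun A0 B0 D K \<le> k23fun A B D K"
proof -
  have "A0 * (1 + D + K)^3 \<le> A * (1 + D + K)^3" "B * (1 - D + K)^3 \<le> B0 * (1 - D + K)^3"
    using assms by (auto intro!: mult_right_mono)
  then show ?thesis unfolding k23fun_def by linarith
qed

text \<open>After multiplication by the reciprocal exponential, the derivative of the Taylor
  polynomial collapses to a single term, whose sign gives monotonicity. The exponential bounds that
  follow use the same device.\<close>

lemma exp_ge_cubic: "1 + y + y^2/2 + y^3/6 \<le> exp y" if "0 \<le> y" for y :: real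
proof -
  have "(\<lambda>z. - ((1 + z + z^2/2 + z^3/6) * exp (- z))) 0 \<le> (\<lambda>z. - ((1 + z + z^2/2 + z^3/6) * exp (- z))) y"
  proof (rule DERIV_nonneg_imp_nondecreasing[OF that])
    fix z :: real assume z: "0 \<le> z" "z \<le> y"
    have "((\<lambda>z. - ((1 + z + z^2/2 + z^3/6) * exp (- z))) has_real_derivative z^3/6 * exp (- z)) (at z)"
      by (auto intro!: derivative_eq_intros simp: field_simps power2_eq_square power3_eq_cube)
    then show "\<exists>y. ((\<lambda>z. - ((1 + z + z^2/2 + z^3/6) * exp (- z))) has_real_derivative y) (at z) \<and> 0 \<le> y"
      using z by (intro exI[of _ "z^3/6 * exp (- z)"]) auto
  qed
  then show ?thesis by (simp add: exp_minus field_simps)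
qed

lemma exp_minus_ge_cubic: "1 - y + y^2/2 - y^3/6 \<le> exp (- y)" if "0 \<le> y" for y :: real
proof -
  have "(\<lambda>z. - ((1 - z + z^2/2 - z^3/6) * exp z)) 0 \<le> (\<lambda>z. - ((1 - z + z^2/2 - z^3/6) * exp z)) y"
  proof (rule DERIV_nonneg_imp_nondecreasing[OF that])
    fix z :: real assume z: "0 \<le> z" "z \<le> y"
    have "((\<lambda>z. - ((1 - z + z^2/2 - z^3/6) * exp z)) has_real_derivative z^3/6 * exp z) (at z)"
      by (auto intro!: derivative_eq_intros simp: field_simps power2_eq_square power3_eq_cube)
    then show "\<exists>y. ((\<lambda>z. - ((1 - z + z^2/2 - z^3/6) * exp z)) has_real_derivative y) (at z) \<and> 0 \<le> y"
      using z by (intro exI[of _ "z^3/6 * exp z"]) auto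
  qed
  then show ?thesis by (simp add: exp_minus field_simps)
qed

lemma exp_minus_le_quadratic: "exp (- y) \<le> 1 - y + y^2/2" if "0 \<le> y" for y :: real
proof -
  have "(\<lambda>z. (1 - z + z^2/2) * exp z) 0 \<le> (\<lambda>z. (1 - z + z^2/2) * exp z) y"
  proof (rule DERIV_nonneg_imp_nondecreasing[OF that])
    fix z :: real assume z: "0 \<le> z" "z \<le> y"
    have "((\<lambda>z. (1 - z + z^2/2) * exp z) has_real_derivative z^2/2 * exp z) (at z)"
      by (auto intro!: derivative_eq_intros simp: field_simps power2_eq_square power3_eq_cube)
    then show "\<exists>y. ((\<lambda>z. (1 - z + z^2/2) * exp z) has_real_derivative y) (at z) \<and> 0 \<le> y"
      using z by (intro exI[of _ "z^2/2 * exp z"]) auto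
  qed
  then show ?thesis by (simp add: exp_minus field_simps)
qed

text \<open>Raising the Taylor coefficient 1/6 to 1/4 turns the derivative into a positive multiple
  of z^2 (1 - z), nonnegative up to 1. The coefficient 1/8 in the upper bound for
  \<open>exp (- y)\<close> has the same origin.\<close>

lemma exp_le_cubic: "exp y \<le> 1 + y + y^2/2 + y^3/4" if "0 \<le> y" "y \<le> 1" for y :: real
proof -
  have "(\<lambda>z. (1 + z + z^2/2 + z^3/4) * exp (- z)) 0 \<le> (\<lambda>z. (1 + z + z^2/2 + z^3/4) * exp (- z)) y"
  proof (rule DERIV_nonneg_imp_nondecreasing[OF that(1)])
    fix z :: real assume z: "0 \<le> z" "z \<le> y"
    have "((\<lambda>z. (1 + z + z^2/2 + z^3/4) * exp (- z)) has_real_derivative z^2 * (1 - z) / 4 * exp (- z)) (at z)"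
      by (auto intro!: derivative_eq_intros simp: field_simps power2_eq_square power3_eq_cube)
    then show "\<exists>y. ((\<lambda>z. (1 + z + z^2/2 + z^3/4) * exp (- z)) has_real_derivative y) (at z) \<and> 0 \<le> y"
      using z that by (intro exI[of _ "z^2 * (1 - z) / 4 * exp (- z)"]) auto
  qed
  then show ?thesis by (simp add: exp_minus field_simps)
qed

lemma exp_minus_le_cubic: "exp (- y) \<le> 1 - y + y^2/2 - y^3/8" if "0 \<le> y" "y \<le> 1" for y :: real
proof -
  have "(\<lambda>z. (1 - z + z^2/2 - z^3/8) * exp z) 0 \<le> (\<lambda>z. (1 - z + z^2/2 - z^3/8) * exp z) y"
  proof (rule DERIV_nonneg_imp_nondecreasing[OF that(1)])
    fix z :: real assume z: "0 \<le> z" "z \<le> y"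
    have "((\<lambda>z. (1 - z + z^2/2 - z^3/8) * exp z) has_real_derivative z^2 * (1 - z) / 8 * exp z) (at z)"
      by (auto intro!: derivative_eq_intros simp: field_simps power2_eq_square power3_eq_cube)
    then show "\<exists>y. ((\<lambda>z. (1 - z + z^2/2 - z^3/8) * exp z) has_real_derivative y) (at z) \<and> 0 \<le> y"
      using z that by (intro exI[of _ "z^2 * (1 - z) / 8 * exp z"]) auto
  qed
  then show ?thesis by (simp add: exp_minus field_simps)
qed

text \<open>The exponents needed later are 10, 12, 22, 26 and 40 times 3/50, so one enclosure of
  \<open>exp (3/50)\<close> serves for all of them.\<close>

lemma exp_multiple_bounds:
  "(106183/100000) ^ n \<le> exp (3 / 50 * real n)" "exp (3 / 50 * real n) \<le> (53093/50000) ^ n"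
proof -
  have "106183/100000 \<le> exp (3/50::real)" "exp (3/50::real) \<le> 53093/50000"
    using exp_ge_cubic[of "3/50"] exp_le_cubic[of "3/50"] by (auto simp: power2_eq_square power3_eq_cube)
  then show "(106183/100000) ^ n \<le> exp (3 / 50 * real n)" "exp (3 / 50 * real n) \<le> (53093/50000) ^ n"
    unfolding exp_of_nat2_mult by (auto intro!: power_mono)
qed

text \<open>The exponents are, up to sign, 6/5 times 1/2, 3/5, 11/10, 13/10 and 2, the moduli of cut
  points and ends of the range of the degree sum.\<close>

lemma exp_constants:
  "91/50 \<le> exp (3/5 :: real)" "exp (- (3/5)) \<le> (549/1000 :: real)" "exp (- (33/25)) \<le> (2673/10000 :: real)"
  "exp (18/25) \<le> (411/200 :: real)" "2433/5000 \<le> exp (- (18/25) :: real)"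
  "exp (39/25) \<le> (477/100 :: real)" "131/625 \<le> exp (- (39/25) :: real)"
  "73/25 \<le> exp (33/25 :: real)" "exp (12/5) \<le> (1108/100 :: real)"
proof -
  show 1: "91/50 \<le> exp (3/5 :: real)" using exp_multiple_bounds(1)[of 10] by (simp add: power_divide)
  have 2: "3742/1000 \<le> exp (33/25 :: real)" using exp_multiple_bounds(1)[of 22] by (simp add: power_divide)
  show 3: "exp (18/25) \<le> (411/200 :: real)" using exp_multiple_bounds(2)[of 12] by (simp add: power_divide)
  show 4: "exp (39/25) \<le> (477/100 :: real)" using exp_multiple_bounds(2)[of 26] by (simp add: power_divide)
  show "exp (12/5) \<le> (1108/100 :: real)" using exp_multiple_bounds(2)[of 40] by (simp add: power_divide)
  show "73/25 \<le> exp (33/25 :: real)" using 2 by simp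
  have inv: "exp (- a) \<le> 1 / c" if "0 < c" "c \<le> exp a" for a c :: real
    using that by (simp add: exp_minus inverse_eq_divide frac_le)
  have inv2: "1 / c \<le> exp (- a)" if "exp a \<le> c" for a c :: real
    using that by (simp add: exp_minus inverse_eq_divide frac_le)
  show "exp (- (3/5)) \<le> (549/1000 :: real)" using inv[of "911/500" "3/5"] exp_multiple_bounds(1)[of 10] by (simp add: power_divide)
  show "exp (- (33/25)) \<le> (2673/10000 :: real)" using inv[OF _ 2] by simp
  show "2433/5000 \<le> exp (- (18/25) :: real)" using inv2[OF 3] by simp
  show "131/625 \<le> exp (- (39/25) :: real)" using inv2[OF 4] by simp
qed

text \<open>This equals \<open>2 * t - ((t + 1) / 2)^2 / 2\<close>: the hub term of the one colour
  present when U(x,y) is a sign, less half the apex-free cost of that colour. \<open>k23B\<close> is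
  half the cost of the other colour.\<close>

definition k23A :: "real \<Rightarrow> real" where "k23A t = (14 * t - t^2 - 1) / 8"
definition k23B :: "real \<Rightarrow> real" where "k23B u = (1 + u)^2 / 8"

text \<open>The parabola has its vertex at 7, so two ordered points are compared correctly as long
  as their sum is at most 14.\<close>

lemma k23A_mono: "t0 \<le> t \<Longrightarrow> t0 + t \<le> 14 \<Longrightarrow> k23A t0 \<le> k23A t"
proof -
  assume "t0 \<le> t" "t0 + t \<le> 14"
  then have "0 \<le> (t - t0) * (14 - t0 - t)" by simp
  then show ?thesis unfolding k23A_def by (simp add: field_simps power2_eq_square)
qed

lemma k23B_mono: "0 \<le> u \<Longrightarrow> u \<le> u0 \<Longrightarrow> k23B u \<le> k23B u0"
  unfolding k23B_def by (auto intro!: divide_right_mono power_mono)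

lemma peval_le:
  assumes "bernstein_nonneg b (padd ys (pscale (-1) xs))" "0 < b" "0 \<le> x" "x \<le> b"
  shows "peval xs x \<le> peval ys x"
  using peval_nonneg[OF assms(1)[unfolded bernstein_nonneg_def] assms(2-4)] by simp

definition k23A_list :: "real list \<Rightarrow> real list" where
  "k23A_list t = pscale (1/8) (padd (pscale 14 t) (padd (pscale (-1) (pmul t t)) [-1]))"
definition k23B_list :: "real list \<Rightarrow> real list" where
  "k23B_list u = pscale (1/8) (pmul (padd [1] u) (padd [1] u))"

lemma peval_k23A_list: "peval (k23A_list t) x = k23A (peval t x)"
  by (simp add: k23A_list_def k23A_def power2_eq_square)
lemma peval_k23B_list: "peval (k23B_list u) x = k23B (peval u x)"
  by (simp add: k23B_list_def k23B_def power2_eq_square)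

text \<open>One certificate for one piece of the range. \<open>tlo\<close> and \<open>uhi\<close>
  enclose the exponentials; \<open>A\<close> and \<open>B\<close> are rounded polynomials of low
  degree below \<open>k23A\<close> of \<open>tlo\<close> and above \<open>k23B\<close> of
  \<open>uhi\<close>. The codegree is measured from the line \<open>K0\<close> in direction
  \<open>e\<close> over the length \<open>R\<close>.\<close>

lemma k23_case:
  fixes e K v :: real and A B Dl K0 R tlo uhi :: "real list"
  defines "p \<equiv> padd [1] (padd Dl K0)" and "r \<equiv> padd [1] (padd (pscale (-1) Dl) K0)"
  defines "f0 \<equiv> padd (pmul A (pmul p (pmul p p))) (padd (pscale (-1) (pmul B (pmul r (pmul r r))))
      (padd (pscale (-3) K0) (padd [-1] (padd (pscale (53/20) (pmul Dl Dl)) (padd (pscale (-18/5) Dl)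
      (padd (pscale (1/4) (pmul K0 (pmul Dl Dl))) (pscale (-1/8) (pmul Dl (pmul Dl Dl)))))))))"
    and "f1 \<equiv> pscale e (padd (pscale 3 (pmul A (pmul p p))) (padd (pscale (-3) (pmul B (pmul r r)))
      (padd [-3] (pscale (1/4) (pmul Dl Dl)))))"
    and "f2 \<equiv> pscale 3 (padd (pmul A p) (pscale (-1) (pmul B r)))"
    and "f3 \<equiv> pscale e (padd A (pscale (-1) B))"
  assumes t: "peval tlo x \<le> t" "peval tlo x + t \<le> 14" and u: "0 \<le> u" "u \<le> peval uhi x"
    and pr: "0 \<le> 1 + D + K" "0 \<le> 1 - D + K" and x: "0 \<le> x" "x \<le> b"
    and DK: "D = peval Dl x" "K = peval K0 x + e * v" and v: "0 \<le> v" "v \<le> peval R x"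
    and b: "0 < b" and e: "e = 1 \<or> e = -1"
    and A: "bernstein_nonneg b (padd (k23A_list tlo) (pscale (-1) A))"
    and B: "bernstein_nonneg b (padd B (pscale (-1) (k23B_list uhi)))"
    and c: "bernstein_nonneg b f0" "bernstein_nonneg b (padd (pscale 3 f0) (pmul f1 R))"
      "bernstein_nonneg b (padd (pscale 3 f0) (padd (pscale 2 (pmul f1 R)) (pmul f2 (pmul R R))))"
      "bernstein_nonneg b (padd f0 (padd (pmul f1 R) (padd (pmul f2 (pmul R R)) (pmul f3 (pmul R (pmul R R))))))"
  shows "0 \<le> k23fun (k23A t) (k23B u) D K"
proof -
  have "peval A x \<le> k23A t" "k23B u \<le> peval B x"
    using peval_le[OF A b x] peval_le[OF B b x] k23A_mono[OF t] k23B_mono[OF u]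
    by (auto simp: peval_k23A_list peval_k23B_list)
  from k23fun_mono[OF this pr] show ?thesis
    using k23fun_region[OF b x v e c[unfolded f0_def f1_def f2_def f3_def p_def r_def]] unfolding DK by linarith
qed

text \<open>Here \<open>a\<close> belongs to the end of a piece nearest to 0 and \<open>c\<close> is
  the numerical bound there; only the increment \<open>y\<close> is expanded.\<close>

lemma k23_exp_scaled:
  fixes c :: real assumes "0 \<le> y" "0 \<le> c"
  shows "c \<le> exp (- a) \<Longrightarrow> c * (1 - y + y^2/2 - y^3/6) \<le> exp (- (a + y))"
    "exp a \<le> c \<Longrightarrow> y \<le> 1 \<Longrightarrow> exp (a + y) \<le> c * (1 + y + y^2/2 + y^3/4)"
    "c \<le> exp a \<Longrightarrow> c * (1 + y + y^2/2) \<le> exp (a + y)"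
    "exp (- a) \<le> c \<Longrightarrow> y \<le> 1 \<Longrightarrow> exp (- (a + y)) \<le> c * (1 - y + y^2/2 - y^3/8)"
    "exp (- a) \<le> c \<Longrightarrow> exp (- (a + y)) \<le> c * (1 - y + y^2/2)"
proof -
  show "c * (1 - y + y^2/2 - y^3/6) \<le> exp (- (a + y))" if "c \<le> exp (- a)"
  proof -
    have "c * (1 - y + y^2/2 - y^3/6) \<le> c * exp (- y)" using exp_minus_ge_cubic assms by (intro mult_left_mono) auto
    also have "\<dots> \<le> exp (- a) * exp (- y)" using that by (intro mult_right_mono) auto
    finally show ?thesis by (simp add: exp_add[symmetric])
  qed
  show "exp (a + y) \<le> c * (1 + y + y^2/2 + y^3/4)" if "exp a \<le> c" "y \<le> 1"
    unfolding exp_add using that assms exp_le_cubic[of y] by (intro mult_mono) auto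
  show "c * (1 + y + y^2/2) \<le> exp (a + y)" if "c \<le> exp a"
    unfolding exp_add using that assms exp_lower_Taylor_quadratic[of y] by (intro mult_mono) auto
  show "exp (- (a + y)) \<le> c * (1 - y + y^2/2 - y^3/8)" if "exp (- a) \<le> c" "y \<le> 1"
  proof -
    have "exp (- (a + y)) = exp (- a) * exp (- y)" by (simp add: exp_add[symmetric])
    also have "\<dots> \<le> c * (1 - y + y^2/2 - y^3/8)" using that assms exp_minus_le_cubic[of y] by (intro mult_mono) auto
    finally show ?thesis .
  qed
  show "exp (- (a + y)) \<le> c * (1 - y + y^2/2)" if "exp (- a) \<le> c"
  proof -
    have "exp (- (a + y)) = exp (- a) * exp (- y)" by (simp add: exp_add[symmetric])
    also have "\<dots> \<le> c * (1 - y + y^2/2)" using that assms exp_minus_le_quadratic[of y] by (intro mult_mono) auto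
    finally show ?thesis .
  qed
qed

lemmas list_poly_simps = bernstein_nonneg_def k23A_list_def k23B_list_def numeral_eq_Suc

text \<open>On each piece of the range of D the exponentials are enclosed by polynomials, and the cubic in K is expanded
  around a line close to its minimum; the nonnegativity of its Bernstein coefficients is a polynomial inequality in
  D alone.\<close>
lemma k23fun_nonneg:
  fixes D K :: real
  assumes pr: "0 \<le> 1 + D + K" "0 \<le> 1 - D + K" and K: "K \<le> 1"
  shows "0 \<le> k23fun (k23A (exp (- (6/5 * D)))) (k23B (exp (6/5 * D))) D K"
proof -
  have D2: "D \<le> 2" "- 2 \<le> D" using pr K by linarith+
  note sq = power2_eq_square power3_eq_cube
  have le1: "exp (- (6/5 * D)) \<le> 1" if "0 \<le> D" using that by simp
  \<comment> \<open>The function vanishes at \<open>D = K = 0\<close>, so the two pieces that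
    contain \<open>D = 0\<close> need enclosures exact to first order there. Farther out there is
    room for rounding.\<close>
  consider "0 \<le> D" "D \<le> 9/20" | "9/20 \<le> D" "D \<le> 3/5" | "3/5 \<le> D" "D \<le> 13/10" | "13/10 \<le> D"
    | "D \<le> 0" "-1/2 \<le> D" | "D \<le> - 1/2" "- 11/10 \<le> D" | "D \<le> - 11/10" by linarith
  then show ?thesis
  proof cases
    case 1
    have t: "peval [1, -6/5, 18/25, -36/125] D \<le> exp (- (6/5 * D))" "exp (6/5 * D) \<le> peval [1, 6/5, 18/25, 54/125] D"
      using k23_exp_scaled(1,2)[of "6/5 * D" 1 0] 1 by (auto simp: sq algebra_simps)
    have t2: "peval [1, -6/5, 18/25, -36/125] D + exp (- (6/5 * D)) \<le> 14" using t le1 1 by linarith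
    show ?thesis
    \<comment> \<open>At the origin the part of degree two is 3 K^2 + 24/5 D K plus a multiple of
      D^2; for fixed \<open>D\<close> it is least on this line. The two lengths \<open>R\<close> are
      the distances from the line to \<open>K = 1\<close> and to \<open>K = D - 1\<close>.\<close>
    proof (cases "- 4/5 * D \<le> K")
      case True
      show ?thesis
        by (rule k23_case[OF t(1) t2 _ t(2) pr 1, of "[0,1]" "[0,-4/5]" 1 "K + 4/5*D" "[1,4/5]" "[3/2,-9/5,9/10,-8/25]" "[1/2,3/5,27/50,3/5]"])
          (use True K in \<open>simp_all add: list_poly_simps\<close>)
    next
      case False
      show ?thesis
        by (rule k23_case[OF t(1) t2 _ t(2) pr 1, of "[0,1]" "[0,-4/5]" "-1" "- K - 4/5*D" "[1,-9/5]" "[3/2,-9/5,9/10,-8/25]" "[1/2,3/5,27/50,3/5]"])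
          (use False pr in \<open>simp_all add: list_poly_simps\<close>)
    qed
  next
    case 2
    define x where "x = D - 9/20"
    have x: "0 \<le> x" "x \<le> 3/20" using 2 by (auto simp: x_def)
    define c where "c = (\<lambda>a0 a1 a2 a3 :: real. padd [a0] (padd (pscale a1 [9/20,1])
      (padd (pscale a2 (pmul [9/20,1] [9/20,1])) (pscale a3 (pmul [9/20,1] (pmul [9/20,1] [9/20,1]))))))"
    have c: "peval (c a0 a1 a2 a3) x = a0 + a1 * D + a2 * D^2 + a3 * D^3" for a0 a1 a2 a3
      by (simp add: c_def x_def sq field_simps)
    have t: "peval (c 1 (-6/5) (18/25) (-36/125)) x \<le> exp (- (6/5 * D))" "exp (6/5 * D) \<le> peval (c 1 (6/5) (18/25) (54/125)) x"
      unfolding c using k23_exp_scaled(1,2)[of "6/5 * D" 1 0] 2 by (auto simp: sq algebra_simps)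
    have t2: "peval (c 1 (-6/5) (18/25) (-36/125)) x + exp (- (6/5 * D)) \<le> 14" using t le1 2 by linarith
    show ?thesis
    proof (cases "- 33/100 \<le> K")
      case True
      show ?thesis
        by (rule k23_case[OF t(1) t2 _ t(2) pr x, of "[9/20,1]" "[-33/100]" 1 "K + 33/100" "[133/100]" "c (3/2) (-9/5) (9/10) (-8/25)" "c (1/2) (3/5) (27/50) (3/5)"])
          (use True K in \<open>simp_all add: list_poly_simps c_def x_def\<close>)
    next
      case False
      show ?thesis
        by (rule k23_case[OF t(1) t2 _ t(2) pr x, of "[9/20,1]" "[-33/100]" "-1" "- K - 33/100" "[11/50,-1]" "c (3/2) (-9/5) (9/10) (-8/25)" "c (1/2) (3/5) (27/50) (3/5)"])
          (use False pr in \<open>simp_all add: list_poly_simps c_def x_def\<close>)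
    qed
  next
    case 3
    define x where "x = D - 3/5"
    have x: "0 \<le> x" "x \<le> 7/10" using 3 by (auto simp: x_def)
    have D: "- (6/5 * D) = - (18/25 + 6/5 * x)" "6/5 * D = 18/25 + 6/5 * x" by (simp_all add: x_def field_simps)
    have t: "peval (pscale (2433/5000) [1, -6/5, 18/25, -36/125]) x \<le> exp (- (6/5 * D))"
      "exp (6/5 * D) \<le> peval (pscale (411/200) [1, 6/5, 18/25, 54/125]) x"
      unfolding D using k23_exp_scaled(1)[of "6/5 * x" "2433/5000" "18/25"] k23_exp_scaled(2)[of "6/5 * x" "411/200" "18/25"] exp_constants x
      by (auto simp: sq algebra_simps)
    have t2: "peval (pscale (2433/5000) [1, -6/5, 18/25, -36/125]) x + exp (- (6/5 * D)) \<le> 14" using t le1 3 by linarith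
    \<comment> \<open>The base line is now the boundary \<open>K = D - 1\<close> of the admissible
      region, so a single direction suffices.\<close>
    show ?thesis
      by (rule k23_case[OF t(1) t2 _ t(2) pr x, of "[3/5,1]" "[-2/5,1]" 1 "1 - D + K" "[7/5,-1]" "[69/100,-93/100,37/100]" "[117/100,2,3/2,14/5]"])
        (use K pr in \<open>simp_all add: list_poly_simps x_def\<close>)
  next
    case 4
    define x where "x = D - 13/10"
    have x: "0 \<le> x" "x \<le> 7/10" using 4 D2 by (auto simp: x_def)
    have D: "- (6/5 * D) = - (39/25 + 6/5 * x)" "6/5 * D = 39/25 + 6/5 * x" by (simp_all add: x_def field_simps)
    have t: "peval (pscale (131/625) [1, -6/5, 18/25, -36/125]) x \<le> exp (- (6/5 * D))"
      "exp (6/5 * D) \<le> peval (pscale (477/100) [1, 6/5, 18/25, 54/125]) x"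
      unfolding D using k23_exp_scaled(1)[of "6/5 * x" "131/625" "39/25"] k23_exp_scaled(2)[of "6/5 * x" "477/100" "39/25"] exp_constants x
      by (auto simp: sq algebra_simps)
    have t2: "peval (pscale (131/625) [1, -6/5, 18/25, -36/125]) x + exp (- (6/5 * D)) \<le> 14" using t le1 4 by linarith
    show ?thesis
      by (rule k23_case[OF t(1) t2 _ t(2) pr x, of "[13/10,1]" "[3/10,1]" 1 "1 - D + K" "[7/10,-1]" "[117/500,-41/100,31/200]" "[417/100,9,6,15]"])
        (use K pr in \<open>simp_all add: list_poly_simps x_def\<close>)
  next
    case 5
    define x where "x = - D"
    have x: "0 \<le> x" "x \<le> 1/2" using 5 by (auto simp: x_def)
    have D: "- (6/5 * D) = 0 + 6/5 * x" "6/5 * D = - (0 + 6/5 * x)" by (simp_all add: x_def field_simps)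
    have t: "peval [1, 6/5, 18/25] x \<le> exp (- (6/5 * D))" "exp (6/5 * D) \<le> peval [1, -6/5, 18/25, -27/125] x"
      unfolding D using k23_exp_scaled(3,4)[of "6/5 * x" 1 0] x by (auto simp: sq algebra_simps)
    have "exp (- (6/5 * D)) \<le> exp (39/25)" using 5 by simp
    then have t2: "peval [1, 6/5, 18/25] x + exp (- (6/5 * D)) \<le> 14" using exp_constants(6) t(1) by linarith
    show ?thesis
    proof (cases "4/5 * x \<le> K")
      case True
      show ?thesis
        by (rule k23_case[OF t(1) t2 _ t(2) pr x, of "[0,-1]" "[0,4/5]" 1 "K - 4/5*x" "[1,-4/5]" "[3/2,9/5,9/10,-1/4]" "[1/2,-3/5,27/50,-13/50]"])
          (use True K in \<open>simp_all add: list_poly_simps x_def\<close>)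
    next
      case False
      show ?thesis
        by (rule k23_case[OF t(1) t2 _ t(2) pr x, of "[0,-1]" "[0,4/5]" "-1" "4/5*x - K" "[1,-1/5]" "[3/2,9/5,9/10,-1/4]" "[1/2,-3/5,27/50,-13/50]"])
          (use False pr in \<open>simp_all add: list_poly_simps x_def\<close>)
    qed
  next
    case 6
    define x where "x = - D - 1/2"
    have x: "0 \<le> x" "x \<le> 3/5" using 6 by (auto simp: x_def)
    have D: "- (6/5 * D) = 3/5 + 6/5 * x" "6/5 * D = - (3/5 + 6/5 * x)" by (simp_all add: x_def field_simps)
    have t: "peval (pscale (91/50) [1, 6/5, 18/25]) x \<le> exp (- (6/5 * D))"
      "exp (6/5 * D) \<le> peval (pscale (549/1000) [1, -6/5, 18/25, -27/125]) x"
      unfolding D using k23_exp_scaled(3)[of "6/5 * x" "91/50" "3/5"] k23_exp_scaled(4)[of "6/5 * x" "549/1000" "3/5"] exp_constants x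
      by (auto simp: sq algebra_simps)
    have "exp (- (6/5 * D)) \<le> exp (39/25)" using 6 by simp
    then have t2: "peval (pscale (91/50) [1, 6/5, 18/25]) x + exp (- (6/5 * D)) \<le> 14" using exp_constants(6) t(1) by linarith
    show ?thesis
    proof (cases "x + 8/25 \<le> K")
      case True
      show ?thesis
        by (rule k23_case[OF t(1) t2 _ t(2) pr x, of "[-1/2,-1]" "[8/25,1]" 1 "K - x - 8/25" "[17/25,-1]" "[66/25,14/5,1/2]" "[3/10,-6/25,27/200]"])
          (use True K in \<open>simp_all add: list_poly_simps x_def\<close>)
    next
      case False
      show ?thesis
        by (rule k23_case[OF t(1) t2 _ t(2) pr x, of "[-1/2,-1]" "[8/25,1]" "-1" "x + 8/25 - K" "[41/50]" "[66/25,14/5,1/2]" "[3/10,-6/25,27/200]"])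
          (use False pr in \<open>simp_all add: list_poly_simps x_def\<close>)
    qed
  next
    case 7
    define x where "x = - D - 11/10"
    have x: "0 \<le> x" "x \<le> 9/10" using 7 D2 by (auto simp: x_def)
    have D: "6/5 * D = - (33/25 + 6/5 * x)" by (simp_all add: x_def field_simps)
    have u: "exp (6/5 * D) \<le> peval (pscale (2673/10000) [1, -6/5, 18/25]) x"
      unfolding D using k23_exp_scaled(5)[of "6/5 * x" "2673/10000" "33/25"] exp_constants x
      by (auto simp: sq algebra_simps)
    have "exp (33/25) \<le> exp (- (6/5 * D))" "exp (- (6/5 * D)) \<le> exp (12/5)" using 7 D2 by auto
    \<comment> \<open>The sum condition of \<open>k23A_mono\<close> is used up here: 73/25 +
      1108/100 = 14. This dictates the lower bound 73/25, although \<open>exp (33/25)\<close> is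
      larger than 37/10.\<close>
    then have t: "peval [73/25] x \<le> exp (- (6/5 * D))" "peval [73/25] x + exp (- (6/5 * D)) \<le> 14"
      using exp_constants(8,9) unfolding peval.simps by linarith+
    show ?thesis
      by (rule k23_case[OF t _ u pr x, of "[-11/10,-1]" "[1/10,1]" 1 "1 + D + K" "[9/10,-1]" "[39/10]" "[201/1000,-2/25,1/25]"])
        (use K pr in \<open>simp_all add: list_poly_simps x_def\<close>)
  qed
qed

subsection \<open>The real inequality behind the four-cycle with a pendant edge\<close>

text \<open>With the weight used for K(2,3), this bounds the squared weight times the cubed degree
  factor. The linear parts cancel between the colours and leave \<open>- 4/5 * x^2\<close>, a gain
  spent in \<open>k23_pointwise\<close>. One factor \<open>1 + x\<close> is split off, and the rest
  is compared with \<open>1 - 2/5 * x\<close>.\<close>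

lemma exp_cubed_bound:
  fixes x :: real assumes "-1 \<le> x" "x \<le> 1"
  shows "exp (- (12/5 * x)) * (1 + x)^3 \<le> 1 + 3/5 * x - 2/5 * x^2"
proof -
  have key: "exp (- (12/5 * x)) * (1 + x)^2 \<le> 1 - 2/5 * x"
  proof (cases "0 \<le> x")
    case True
    have "(1 + x)^2 \<le> (1 - 2/5 * x) * (1 + 12/5*x + (12/5*x)^2/2 + (12/5*x)^3/6)"
    proof -
      have "0 \<le> x^2 * (23/25 + 144/125 * x * (1 - x) + 144/625 * x^2)"
        using True assms by (intro mult_nonneg_nonneg add_nonneg_nonneg) auto
      then show ?thesis by (simp add: field_simps power2_eq_square power3_eq_cube)
    qed
    also have "\<dots> \<le> (1 - 2/5 * x) * exp (12/5 * x)"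
      using exp_ge_cubic[of "12/5 * x"] True assms by (intro mult_left_mono) auto
    finally show ?thesis by (simp add: exp_minus field_simps)
  next
    case False
    define y where "y = - x"
    have y: "0 \<le> y" "y \<le> 1" using False assms by (auto simp: y_def)
    have "0 \<le> y^3 * (1/12 + (1 - y)/4 + y^2/12)" using y by simp
    then have "1 - y \<le> (1 - y^2/2) * (1 - y + y^2/2 - y^3/6)"
      by (simp add: field_simps power2_eq_square power3_eq_cube)
    also have "\<dots> \<le> (1 - y^2/2) * exp (- y)"
      using exp_minus_ge_cubic[OF y(1)] power_le_one[OF y, of 2] by (intro mult_left_mono) auto
    finally have a: "(1 - y) * exp y \<le> 1 - y^2/2" by (simp add: exp_minus field_simps)
    have "(2/5*y)^3/4 \<le> (2/5 * y)^2/2" using y power_decreasing[of 2 3 "2/5*y"] zero_le_power2[of "2/5*y"] by linarith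
    then have b: "exp (2/5*y) \<le> 1 + 2/5 * y + (2/5 * y)^2" using exp_le_cubic[of "2/5 * y"] y by simp
    \<comment> \<open>The exponent is split as 12/5 = 2 + 2/5, which pairs each factor
      \<open>1 - y\<close> with one \<open>exp y\<close>.\<close>
    have "exp (- (12/5 * x)) * (1 + x)^2 = ((1 - y) * exp y)^2 * exp (2/5 * y)"
      by (simp add: y_def power_mult_distrib exp_add[symmetric] exp_of_nat_mult[symmetric] mult_ac)
    also have "\<dots> \<le> (1 - y^2/2)^2 * (1 + 2/5 * y + (2/5 * y)^2)"
      using a b y by (intro mult_mono power_mono) auto
    also have "\<dots> \<le> 1 + 2/5 * y"
    proof -
      have "y^2 * (y^2 * (9/100 + 1/10 * y + y^2/25)) \<le> y^2 * (21/25)"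
      proof (rule mult_left_mono)
        have "y^2 * (9/100 + 1/10 * y + y^2/25) \<le> 1 * (9/100 + 1/10 * 1 + 1/25)"
          using y power_le_one[OF y, of 2] by (intro mult_mono add_mono) auto
        then show "y^2 * (9/100 + 1/10 * y + y^2/25) \<le> 21/25" by simp
      qed simp
      moreover have "0 \<le> 2/5 * y^3" using y by simp
      ultimately show ?thesis by (simp add: field_simps power2_eq_square power3_eq_cube)
    qed
    finally show ?thesis by (simp add: y_def)
  qed
  have "exp (- (12/5 * x)) * (1 + x)^3 = (1 + x) * (exp (- (12/5 * x)) * (1 + x)^2)"
    by (simp add: power2_eq_square power3_eq_cube)
  also have "\<dots> \<le> (1 + x) * (1 - 2/5 * x)" using key assms by (intro mult_left_mono) auto
  finally show ?thesis by (simp add: field_simps power2_eq_square)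
qed

text \<open>For the weight \<open>exp (- s x / 2)\<close> this bounds the squared weight times the
  squared degree factor; the linear parts cancel between the colours.\<close>

lemma exp_squared_bound:
  fixes x :: real assumes "-1 \<le> x"
  shows "exp (- x) * (1 + x)^2 \<le> 1 + x"
proof -
  have "exp (- x) * (1 + x) \<le> 1" using exp_ge_add_one_self[of x] by (simp add: exp_minus field_simps)
  then have "(1 + x) * (exp (- x) * (1 + x)) \<le> (1 + x) * 1" using assms by (intro mult_left_mono) auto
  then show ?thesis by (simp add: power2_eq_square mult_ac)
qed

text \<open>A pendant edge brings half a power of the codegree. In \<open>s = sqrt M\<close> the
  difference is \<open>s^2/4 * (s - 1)^2 * (1 + s * (2 - s))\<close>, so the cubic agrees to first
  order at \<open>M = 1\<close> and stays below up to \<open>M = 4\<close>.\<close>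

lemma power_five_halves_lower:
  fixes M :: real assumes "0 \<le> M" "M \<le> 4"
  shows "M^3/4 + M^2 - M/4 \<le> sqrt M * M^2"
proof -
  define s where "s = sqrt M"
  have s: "0 \<le> s" "s \<le> 2" "M = s^2" using assms by (auto simp: s_def real_le_lsqrt)
  have "0 \<le> s^2/4 * (s - 1)^2 * (1 + s * (2 - s))" using s by (intro mult_nonneg_nonneg) auto
  then have "(s^2)^3/4 + (s^2)^2 - s^2/4 \<le> s * (s^2)^2"
    by (simp add: field_simps power2_eq_square power3_eq_cube)
  then show ?thesis by (simp only: s(3)[symmetric]) (simp only: s_def)
qed

text \<open>\<open>t\<close> and \<open>t'\<close> stand for a lower and an upper bound of the
  weight product of one colour, \<open>u\<close> for an upper bound in the other colour. Two bounds
  for one quantity occur because it enters the hub term and the cost with opposite signs.\<close>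

definition pendant_fun :: "real \<Rightarrow> real \<Rightarrow> real \<Rightarrow> real \<Rightarrow> real \<Rightarrow> real" where
  "pendant_fun t t' u D K = 2 * t * ((1 + D + K)^3/4 + (1 + D + K)^2 - (1 + D + K)/4)
     - (1 + t')^2 / 8 * ((1 + D + K)^2 * (1 + D/2)) - (1 + u)^2 / 8 * ((1 - D + K)^2 * (1 - D/2))
     - 3 * K - 1 + 11/4 * D^2 - 4 * D"

lemma pendant_fun_mono:
  assumes "0 \<le> t" "t \<le> T" "0 \<le> T" "T \<le> t'" "0 \<le> U" "U \<le> u" "\<bar>D\<bar> \<le> 2"
    "0 \<le> 1 + D + K" "1 + D + K \<le> 4"
  shows "pendant_fun t t' u D K \<le> 2 * T * (sqrt (1 + D + K) * (1 + D + K)^2)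
     - (1 + T)^2 / 8 * ((1 + D + K)^2 * (1 + D/2)) - (1 + U)^2 / 8 * ((1 - D + K)^2 * (1 - D/2))
     - 3 * K - 1 + 11/4 * D^2 - 4 * D"
proof -
  have "2 * t * ((1 + D + K)^3/4 + (1 + D + K)^2 - (1 + D + K)/4) \<le> 2 * t * (sqrt (1 + D + K) * (1 + D + K)^2)"
    using power_five_halves_lower[OF assms(8,9)] assms(1) by (intro mult_left_mono) auto
  also have "\<dots> \<le> 2 * T * (sqrt (1 + D + K) * (1 + D + K)^2)"
    using assms by (intro mult_right_mono) auto
  finally have 1: "2 * t * ((1 + D + K)^3/4 + (1 + D + K)^2 - (1 + D + K)/4) \<le> 2 * T * (sqrt (1 + D + K) * (1 + D + K)^2)" .
  have 2: "(1 + T)^2 / 8 * ((1 + D + K)^2 * (1 + D/2)) \<le> (1 + t')^2 / 8 * ((1 + D + K)^2 * (1 + D/2))"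
    "(1 + U)^2 / 8 * ((1 - D + K)^2 * (1 - D/2)) \<le> (1 + u)^2 / 8 * ((1 - D + K)^2 * (1 - D/2))"
    using assms by (auto intro!: mult_right_mono divide_right_mono power_mono)
  show ?thesis unfolding pendant_fun_def using 1 2 by linarith
qed

lemma pendant_region:
  fixes t T u Dl K0 R :: "real list" and e :: real
  defines "p \<equiv> padd [1] (padd Dl K0)" and "r \<equiv> padd [1] (padd (pscale (-1) Dl) K0)"
  defines "a2 \<equiv> padd (pscale 2 t) (pscale (-1/8) (pmul (padd [1] (pscale (1/2) Dl)) (pmul (padd [1] T) (padd [1] T))))"
    and "b2 \<equiv> pscale (1/8) (pmul (padd [1] (pscale (-1/2) Dl)) (pmul (padd [1] u) (padd [1] u)))"
  defines "f0 \<equiv> padd (pscale (1/2) (pmul t (pmul p (pmul p p)))) (padd (pmul a2 (pmul p p)) (padd (pscale (-1/2) (pmul t p))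
      (padd (pscale (-1) (pmul b2 (pmul r r))) (padd (pscale (-3) K0) (padd [-1] (padd (pscale (11/4) (pmul Dl Dl)) (pscale (-4) Dl)))))))"
    and "f1 \<equiv> pscale e (padd (pscale (3/2) (pmul t (pmul p p))) (padd (pscale 2 (pmul a2 p)) (padd (pscale (-1/2) t)
      (padd (pscale (-2) (pmul b2 r)) [-3]))))"
    and "f2 \<equiv> padd (pscale (3/2) (pmul t p)) (padd a2 (pscale (-1) b2))"
    and "f3 \<equiv> pscale (e/2) t"
  assumes x: "0 \<le> x" "x \<le> b" and v: "0 \<le> v" "v \<le> peval R x"
    and D: "D = peval Dl x" and K: "K = peval K0 x + e * v" and b: "0 < b" and e: "e = 1 \<or> e = -1"
    and c: "bernstein_nonneg b f0" "bernstein_nonneg b (padd (pscale 3 f0) (pmul f1 R))"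
      "bernstein_nonneg b (padd (pscale 3 f0) (padd (pscale 2 (pmul f1 R)) (pmul f2 (pmul R R))))"
      "bernstein_nonneg b (padd f0 (padd (pmul f1 R) (padd (pmul f2 (pmul R R)) (pmul f3 (pmul R (pmul R R))))))"
  shows "0 \<le> pendant_fun (peval t x) (peval T x) (peval u x) D K"
proof -
  have "pendant_fun (peval t x) (peval T x) (peval u x) D K
     = peval f0 x + peval f1 x * v + peval f2 x * v^2 + peval f3 x * v^3"
    using e unfolding D K pendant_fun_def f0_def f1_def f2_def f3_def a2_def b2_def p_def r_def peval_padd peval_pmul peval_pscale peval.simps
    by (elim disjE) (simp_all add: field_simps power2_eq_square power3_eq_cube)
  with cubic_family_nonneg[OF b x v c] show ?thesis by simp
qed

lemma pendant_nonneg: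
  fixes D K :: real
  assumes pr: "0 \<le> 1 + D + K" "0 \<le> 1 - D + K" and K: "K \<le> 1"
  defines "t \<equiv> exp (- (D/2))" and "u \<equiv> exp (D/2)"
  shows "0 \<le> 2 * t * (sqrt (1 + D + K) * (1 + D + K)^2)
     - (1 + t)^2 / 8 * ((1 + D + K)^2 * (1 + D/2)) - (1 + u)^2 / 8 * ((1 - D + K)^2 * (1 - D/2))
     - 3 * K - 1 + 11/4 * D^2 - 4 * D" (is ?goal)
proof -
  have D2: "\<bar>D\<bar> \<le> 2" "1 + D + K \<le> 4" using pr K by linarith+
  have nn: "0 \<le> t" "0 \<le> u" by (simp_all add: t_def u_def)
  note sq = power2_eq_square power3_eq_cube
  have mono: ?goal if "0 \<le> a" "a \<le> t" "t \<le> b" "u \<le> c" "0 \<le> pendant_fun a b c D K" for a b c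
    using pendant_fun_mono[OF that(1,2) nn(1) that(3) nn(2) that(4) D2(1) pr(1) D2(2)] that(5) by linarith
  show ?thesis
  proof (cases "0 \<le> D")
    case True
    define y where "y = D/2"
    have y: "0 \<le> y" "y \<le> 1" using True D2 by (auto simp: y_def)
    have t1: "1 - y + 3/10 * y^2 \<le> t"
    proof -
      have "0 \<le> y^2 * (1/30 + (1 - y)/6)" using y by simp
      then show ?thesis using exp_minus_ge_cubic[OF y(1)] by (simp add: t_def y_def field_simps sq)
    qed
    have t2: "t \<le> 1 - y + y^2/2" using exp_minus_le_quadratic[OF y(1)] by (simp add: t_def y_def)
    have "y^3 \<le> y^2" using y power_decreasing[of 2 3 y] by simp
    then have "1 + y + y^2/2 + y^3/4 \<le> 1 + y + y^2" using zero_le_power2[of y] by linarith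
    then have u: "u \<le> 1 + y + y^2" using exp_le_cubic[OF y] by (simp add: u_def y_def)
    have t0: "0 \<le> 1 - y + 3/10 * y^2" using y by simp
    show ?thesis
    proof (cases "D \<le> 1/2")
      case le: True
      have eqs: "1 - y + 3/10 * y^2 = peval [1, -1/2, 3/40] D" "1 - y + y^2/2 = peval [1, -1/2, 1/8] D"
        "1 + y + y^2 = peval [1, 1/2, 1/4] D" by (simp_all add: y_def sq field_simps)
      have "0 \<le> pendant_fun (peval [1, -1/2, 3/40] D) (peval [1, -1/2, 1/8] D) (peval [1, 1/2, 1/4] D) D K"
      \<comment> \<open>With these enclosures the part of degree two is 5/2 K^2 + 9/2 D K plus a
        multiple of D^2, least in \<open>K\<close> on this line.\<close>
      proof (cases "- 9/10 * D \<le> K")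
        case True
        show ?thesis
          by (rule pendant_region[OF \<open>0 \<le> D\<close> le, of "K + 9/10 * D" "[1,9/10]" _ "[0,1]" _ "[0,-9/10]" 1])
            (use True K in \<open>simp_all add: list_poly_simps\<close>)
      next
        case False
        show ?thesis
          by (rule pendant_region[OF \<open>0 \<le> D\<close> le, of "- K - 9/10 * D" "[1,-19/10]" _ "[0,1]" _ "[0,-9/10]" "-1"])
            (use False pr in \<open>simp_all add: list_poly_simps\<close>)
      qed
      then show ?thesis by (rule mono[OF t0 t1 t2 u, unfolded eqs])
    next
      case ge: False
      define x where "x = D - 1/2"
      have x: "0 \<le> x" "x \<le> 3/2" using ge D2 by (auto simp: x_def)
      have eqs: "1 - y + 3/10 * y^2 = peval [123/160, -17/40, 3/40] x" "1 - y + y^2/2 = peval [25/32, -3/8, 1/8] x"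
        "1 + y + y^2 = peval [21/16, 3/4, 1/4] x" by (simp_all add: x_def y_def sq field_simps)
      have "0 \<le> pendant_fun (peval [123/160, -17/40, 3/40] x) (peval [25/32, -3/8, 1/8] x) (peval [21/16, 3/4, 1/4] x) D K"
        by (rule pendant_region[OF x, of "1 - D + K" "[3/2,-1]" _ "[1/2,1]" _ "[-1/2,1]" 1])
            (use pr K in \<open>simp_all add: list_poly_simps x_def\<close>)
      then show ?thesis by (rule mono[OF t0 t1 t2 u, unfolded eqs])
    qed
  next
    case False
    define y where "y = - D/2"
    have y: "0 \<le> y" "y \<le> 1" using False D2 by (auto simp: y_def)
    have t1: "1 + y + y^2/2 \<le> t" using exp_lower_Taylor_quadratic[OF y(1)] by (simp add: t_def y_def)
    have u: "u \<le> 1 - y + y^2/2" using exp_minus_le_quadratic[OF y(1)] by (simp add: u_def y_def)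
    have "y^3 \<le> y^2" using y power_decreasing[of 2 3 y] by simp
    then have "1 + y + y^2/2 + y^3/4 \<le> 1 + y + y^2" using zero_le_power2[of y] by linarith
    then have t2: "t \<le> 1 + y + y^2" using exp_le_cubic[OF y] by (simp add: t_def y_def)
    have t0: "0 \<le> 1 + y + y^2/2" using y by simp
    show ?thesis
    proof (cases "- 1 \<le> D")
      case le: True
      define x where "x = - D"
      have x: "0 \<le> x" "x \<le> 1" using le False by (auto simp: x_def)
      have eqs: "1 + y + y^2/2 = peval [1, 1/2, 1/8] x" "1 - y + y^2/2 = peval [1, -1/2, 1/8] x"
        "1 + y + y^2 = peval [1, 1/2, 1/4] x" by (simp_all add: y_def x_def sq field_simps)
      have "0 \<le> pendant_fun (peval [1, 1/2, 1/8] x) (peval [1, 1/2, 1/4] x) (peval [1, -1/2, 1/8] x) D K"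
      proof (cases "9/10 * x \<le> K")
        case True
        show ?thesis
          by (rule pendant_region[OF x, of "K - 9/10 * x" "[1,-9/10]" _ "[0,-1]" _ "[0,9/10]" 1])
            (use True K in \<open>simp_all add: list_poly_simps x_def\<close>)
      next
        case False
        show ?thesis
          by (rule pendant_region[OF x, of "9/10 * x - K" "[1,-1/10]" _ "[0,-1]" _ "[0,9/10]" "-1"])
            (use False pr in \<open>simp_all add: list_poly_simps x_def\<close>)
      qed
      then show ?thesis by (rule mono[OF t0 t1 t2 u, unfolded eqs])
    next
      case ge: False
      define x where "x = - D - 1"
      have x: "0 \<le> x" "x \<le> 1" using ge D2 by (auto simp: x_def)
      have eqs: "1 + y + y^2/2 = peval [13/8, 3/4, 1/8] x" "1 - y + y^2/2 = peval [5/8, -1/4, 1/8] x"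
        "1 + y + y^2 = peval [7/4, 1, 1/4] x" by (simp_all add: x_def y_def sq field_simps)
      have "0 \<le> pendant_fun (peval [13/8, 3/4, 1/8] x) (peval [7/4, 1, 1/4] x) (peval [5/8, -1/4, 1/8] x) D K"
        by (rule pendant_region[OF x, of "1 + D + K" "[1,-1]" _ "[-1,-1]" _ "[0,1]" 1])
            (use pr K in \<open>simp_all add: list_poly_simps x_def\<close>)
      then show ?thesis by (rule mono[OF t0 t1 t2 u, unfolded eqs])
    qed
  qed
qed

subsection \<open>Inequalities for pairs of points\<close>

text \<open>This reduces U(x,y) to the values 1 and -1. At U(x,y) = s the factor
  \<open>1 - s * U\<close> of the colour -s is zero, so only one of the two hub terms is
  left.\<close>

lemma affine_nonneg_between:
  fixes a b U :: real
  assumes "\<bar>U\<bar> \<le> 1" "0 \<le> a + b" "0 \<le> a - b"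
  shows "0 \<le> a + b * U"
proof -
  have "0 \<le> (1 + U) * (a + b)" "0 \<le> (1 - U) * (a - b)"
    using assms by (auto intro: mult_nonneg_nonneg[OF _ assms(2)] mult_nonneg_nonneg[OF _ assms(3)])
  then show ?thesis by (simp add: algebra_simps)
qed

text \<open>The coefficients 3 and 18/5 cancel the terms linear in \<open>K\<close> and in
  \<open>d + e\<close> at the origin; the third, 1/2, is a cubic correction. The 53/20 of
  \<open>k23fun\<close> comes from 1/5 + 3/2 + 18/5 = 53/10, the total factor of
  \<open>d^2 + e^2\<close>, in which 1/5 is the gain from \<open>exp_cubed_bound\<close>; half of it
  falls to \<open>(d + e)^2\<close>.\<close>

lemma k23_pointwise:
  fixes d e K U :: real
  defines "w \<equiv> \<lambda>s x :: real. exp (- (6/5 * (s * x)))"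
  defines "M \<equiv> \<lambda>s. 1 + s * (d + e) + K"
  defines "F \<equiv> \<lambda>s. 2 * (w s d * w s e) * ((1 + s * U) * M s^3)
     - ((w s d)^2 * (1 + s * d)^3 + (w s e)^2 * (1 + s * e)^3) / 2 - ((w s d * w s e + 1)/2)^2 * M s^3"
  assumes U: "\<bar>U\<bar> \<le> 1" and b: "\<bar>d\<bar> \<le> 1" "\<bar>e\<bar> \<le> 1" "K \<le> 1" and pr: "0 \<le> M 1" "0 \<le> M (-1)"
  shows "0 \<le> (F 1 + F (-1)) / 2 + 3 * ((d^2 + e^2)/2 - K) + 18/5 * (d^2 + e^2 - U * (d + e))
     + (K * (d^2 + e^2) - U * d * e * (d + e)) / 2"
proof -
  define T where "T = (\<lambda>s. w s d * w s e)"
  define Q where "Q = (\<lambda>s. T s * M s^3)"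
  define H where "H = (\<lambda>s. ((T s + 1)/2)^2 * M s^3)"
  define G where "G = (\<lambda>s. (w s d)^2 * (1 + s * d)^3 + (w s e)^2 * (1 + s * e)^3)"
  have F: "F s = 2 * ((1 + s * U) * Q s) - G s / 2 - H s" for s
    by (simp add: F_def Q_def H_def G_def T_def mult_ac)
  have G1: "(w s x)^2 * (1 + s * x)^3 \<le> 1 + 3/5 * (s * x) - 2/5 * x^2" if "\<bar>x\<bar> \<le> 1" "s = 1 \<or> s = -1" for s x
  proof -
    have "(w s x)^2 = exp (- (12/5 * (s * x)))" by (simp add: w_def power2_eq_square exp_add[symmetric])
    then show ?thesis using exp_cubed_bound[of "s * x"] that by auto
  qed
  have G: "G 1 + G (-1) \<le> 4 - 4/5 * (d^2 + e^2)"
    using G1[OF b(1), of 1, simplified] G1[OF b(1), of "-1", simplified] G1[OF b(2), of 1, simplified]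
      G1[OF b(2), of "-1", simplified] by (simp add: G_def add_divide_distrib)
  have endpoint: "0 \<le> 2 * Q s - H s / 2 - H (- s) / 2 - 1 + (d^2 + e^2)/5
      + 3 * ((d^2 + e^2)/2 - K) + 18/5 * (d^2 + e^2 - s * (d + e)) + (K * (d^2 + e^2) - s * d * e * (d + e)) / 2"
    if s: "s = 1 \<or> s = -1" for s
  proof -
    have T: "exp (- (6/5 * (s * (d + e)))) = T s" "exp (6/5 * (s * (d + e))) = T (- s)"
      unfolding T_def w_def exp_add[symmetric] by (simp_all add: algebra_simps)
    have "0 \<le> k23fun (k23A (T s)) (k23B (T (- s))) (s * (d + e)) K"
      using k23fun_nonneg[of "s * (d + e)" K] pr b s unfolding T M_def by auto
    \<comment> \<open>For a given sum of degrees the worst case is \<open>d = e\<close>: once the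
      bound on \<open>G\<close> is inserted, the difference enters only through this nonnegative
      term.\<close>
    moreover have "0 \<le> (d - e)^2 * (53/20 + K/4 + s * (d + e)/8)"
    proof (intro mult_nonneg_nonneg)
      have "-1 \<le> K" using pr by (simp add: M_def)
      moreover have "-2 \<le> s * (d + e)" using b s by (auto simp: abs_le_iff)
      ultimately show "0 \<le> 53/20 + K/4 + s * (d + e)/8" by linarith
    qed simp
    moreover have "k23A (T s) * (1 + s * (d + e) + K)^3 = 2 * Q s - H s / 2"
      "k23B (T (- s)) * (1 - s * (d + e) + K)^3 = H (- s) / 2"
      by (simp_all add: k23A_def k23B_def Q_def H_def M_def field_simps power2_eq_square)
    moreover have "53/20 * (s * (d + e))^2 + K * (s * (d + e))^2 / 4 - (s * (d + e))^3 / 8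
        + (d - e)^2 * (53/20 + K/4 + s * (d + e)/8)
      = (d^2 + e^2) / 5 + 3 * ((d^2 + e^2)/2) + 18/5 * (d^2 + e^2) + (K * (d^2 + e^2) - s * d * e * (d + e)) / 2"
      using s by (elim disjE) (simp_all add: field_simps power2_eq_square power3_eq_cube)
    ultimately show ?thesis unfolding k23fun_def right_diff_distrib by linarith
  qed
  define a where "a = Q 1 + Q (-1) - H 1 / 2 - H (-1) / 2 - 1 + (d^2 + e^2)/5
      + 3 * ((d^2 + e^2)/2 - K) + 18/5 * (d^2 + e^2) + (K * (d^2 + e^2)) / 2"
  define c where "c = Q 1 - Q (-1) - 18/5 * (d + e) - d * e * (d + e) / 2"
  have "0 \<le> a + c * U"
    by (rule affine_nonneg_between[OF U])
      (use endpoint[of 1] endpoint[of "-1"] in \<open>simp_all add: a_def c_def field_simps\<close>)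
  also have "\<dots> \<le> (F 1 + F (-1)) / 2 + 3 * ((d^2 + e^2)/2 - K) + 18/5 * (d^2 + e^2 - U * (d + e))
     + (K * (d^2 + e^2) - U * d * e * (d + e)) / 2"
    unfolding a_def c_def F using G by (simp add: field_simps)
  finally show ?thesis .
qed

text \<open>The linear terms force the coefficients 3 and 4; together 3/2 + 4 = 11/2 multiplies
  \<open>d^2 + e^2\<close>, and half of that is the 11/4 of \<open>pendant_fun\<close>.\<close>

lemma pendant_pointwise:
  fixes d e K U :: real
  defines "w \<equiv> \<lambda>s x :: real. exp (- (s * x / 2))"
  defines "M \<equiv> \<lambda>s. 1 + s * (d + e) + K"
  defines "F \<equiv> \<lambda>s. 2 * (w s d * w s e) * ((1 + s * U) * (sqrt (M s) * M s^2))
     - ((w s d)^2 * (1 + s * d)^2 + (w s e)^2 * (1 + s * e)^2) / 2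
     - ((w s d * w s e + 1)/2)^2 * (M s^2 * (1 + s * (d + e)/2))"
  assumes U: "\<bar>U\<bar> \<le> 1" and b: "\<bar>d\<bar> \<le> 1" "\<bar>e\<bar> \<le> 1" "K \<le> 1" and pr: "0 \<le> M 1" "0 \<le> M (-1)"
  shows "0 \<le> (F 1 + F (-1)) / 2 + 3 * ((d^2 + e^2)/2 - K) + 4 * (d^2 + e^2 - U * (d + e))"
proof -
  define T where "T = (\<lambda>s. w s d * w s e)"
  define Q where "Q = (\<lambda>s. T s * (sqrt (M s) * M s^2))"
  define H where "H = (\<lambda>s. ((T s + 1)/2)^2 * (M s^2 * (1 + s * (d + e)/2)))"
  define G where "G = (\<lambda>s. (w s d)^2 * (1 + s * d)^2 + (w s e)^2 * (1 + s * e)^2)"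
  have F: "F s = 2 * ((1 + s * U) * Q s) - G s / 2 - H s" for s
    by (simp add: F_def Q_def H_def G_def T_def mult_ac)
  have G1: "(w s x)^2 * (1 + s * x)^2 \<le> 1 + s * x" if "\<bar>x\<bar> \<le> 1" "s = 1 \<or> s = -1" for s x
  proof -
    have "(w s x)^2 = exp (- (s * x))" by (simp add: w_def power2_eq_square exp_add[symmetric])
    then show ?thesis using exp_squared_bound[of "s * x"] that by auto
  qed
  have G: "G 1 + G (-1) \<le> 4"
    using G1[OF b(1), of 1, simplified] G1[OF b(1), of "-1", simplified] G1[OF b(2), of 1, simplified]
      G1[OF b(2), of "-1", simplified] by (simp add: G_def add_divide_distrib)
  have endpoint: "0 \<le> 2 * Q s - H s / 2 - H (- s) / 2 - 1
      + 3 * ((d^2 + e^2)/2 - K) + 4 * (d^2 + e^2 - s * (d + e))"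
    if s: "s = 1 \<or> s = -1" for s
  proof -
    have T: "exp (- (s * (d + e) / 2)) = T s" "exp (s * (d + e) / 2) = T (- s)"
      unfolding T_def w_def exp_add[symmetric] by (simp_all add: field_simps)
    have eqs: "2 * T s * (sqrt (M s) * M s^2) = 2 * Q s"
        "(1 + T s)^2 / 8 * (M s^2 * (1 + s * (d + e)/2)) = H s / 2"
        "(1 + T (- s))^2 / 8 * (M (- s)^2 * (1 - s * (d + e)/2)) = H (- s) / 2"
      by (simp_all add: Q_def H_def field_simps power2_eq_square)
    have "0 \<le> 2 * T s * (sqrt (M s) * M s^2) - (1 + T s)^2 / 8 * (M s^2 * (1 + s * (d + e)/2))
        - (1 + T (- s))^2 / 8 * (M (- s)^2 * (1 - s * (d + e)/2)) - 3 * K - 1 + 11/4 * (s * (d + e))^2 - 4 * (s * (d + e))"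
      using pendant_nonneg[of "s * (d + e)" K] pr b s unfolding T M_def by auto
    then have "0 \<le> 2 * Q s - H s / 2 - H (- s) / 2 - 3 * K - 1 + 11/4 * (s * (d + e))^2 - 4 * (s * (d + e))"
      unfolding eqs .
    moreover have "11/4 * (s * (d + e))^2 + 11/4 * (d - e)^2 = 11/2 * (d^2 + e^2)"
      using s by (elim disjE) (simp_all add: field_simps power2_eq_square)
    moreover have "0 \<le> (d - e)^2" by simp
    moreover have "4 * (d^2 + e^2 - s * (d + e)) = 4 * (d^2 + e^2) - 4 * (s * (d + e))" by (rule right_diff_distrib)
    ultimately show ?thesis by argo
  qed
  define a where "a = Q 1 + Q (-1) - H 1 / 2 - H (-1) / 2 - 1 + 3 * ((d^2 + e^2)/2 - K) + 4 * (d^2 + e^2)"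
  define c where "c = Q 1 - Q (-1) - 4 * (d + e)"
  have "0 \<le> a + c * U"
    by (rule affine_nonneg_between[OF U])
      (use endpoint[of 1] endpoint[of "-1"] in \<open>simp_all add: a_def c_def\<close>)
  also have "\<dots> \<le> (F 1 + F (-1)) / 2 + 3 * ((d^2 + e^2)/2 - K) + 4 * (d^2 + e^2 - U * (d + e))"
    unfolding a_def c_def F using G by (simp add: field_simps)
  finally show ?thesis .
qed

text \<open>A quadratic form in \<open>K\<close> and \<open>D\<close> with
  \<open>D\<close>-dependent coefficients. Its determinant expression \<open>4 * a * c - b^2\<close>
  is 1 - 26/27 D, so completing the square works for \<open>D \<le> 1\<close>. Beyond that,
  \<open>K \<ge> D - 1\<close> makes the mixed term nonnegative and crude bounds suffice.\<close>

lemma c4_quadratic_nonneg: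
  fixes D K :: real
  assumes pr: "0 \<le> 1 + D + K" "0 \<le> 1 - D + K" and K: "K \<le> 1"
  shows "0 \<le> 73/36 * D^2 + K^2 * (1 - 2/3 * D) + K * D * (8/3 - 4/3 * D) - 2/3 * D^3"
proof (cases "D \<le> 1")
  case True
  define a b c where "a = 1 - 2/3 * D" and "b = 8/3 - 4/3 * D" and "c = 73/36 - 2/3 * D"
  have "0 \<le> (2 * a * K + b * D)^2 + D^2 * (4 * a * c - b^2)"
  proof (intro add_nonneg_nonneg mult_nonneg_nonneg)
    show "0 \<le> 4 * a * c - b^2" unfolding a_def b_def c_def using True
      by (simp add: field_simps power2_eq_square)
  qed auto
  also have "\<dots> = 4 * a * (a * K^2 + b * K * D + c * D^2)" by (simp add: algebra_simps power2_eq_square)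
  finally have "0 \<le> a * K^2 + b * K * D + c * D^2" using True by (simp add: zero_le_mult_iff a_def)
  then show ?thesis by (simp add: a_def b_def c_def algebra_simps power2_eq_square power3_eq_cube)
next
  case False
  have D: "D \<le> 2" "0 \<le> K" using pr K False by linarith+
  have "0 \<le> K * D * (8/3 - 4/3 * D)" using False D by simp
  moreover have "K^2 \<le> 1" using D K by (simp add: power_le_one)
  then have "K^2 * (2/3 * D - 1) \<le> 1 * (1/3)" using mult_left_mono[of "2/3 * D - 1" "1/3" "K^2"] D by simp
  moreover have "1 * (1/3) \<le> D^2 * (73/36 - 2/3 * D)" using False D by (intro mult_mono) auto
  ultimately show ?thesis by (simp add: algebra_simps power2_eq_square power3_eq_cube)
qed

text \<open>Here \<open>w\<close> is the multiplier that linearises the square; the weight on pairs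
  is 1. A linear multiplier keeps everything polynomial, so the last step is an identity. The
  quartic terms in \<open>d\<close> and \<open>e\<close> are absorbed through
  \<open>x^2 * (1 - x^2)\<close>.\<close>

lemma c4_pointwise:
  fixes d e K U :: real
  defines "w \<equiv> \<lambda>s x :: real. 1 - 2/3 * (s * x)"
  defines "M \<equiv> \<lambda>s. 1 + s * (d + e) + K"
  defines "F \<equiv> \<lambda>s. (w s d + w s e) * ((1 + s * U) * M s^2)
     - ((w s d)^2 * (1 + s * d)^2 + (w s e)^2 * (1 + s * e)^2) / 2 - M s^2"
  assumes U: "\<bar>U\<bar> \<le> 1" and b: "\<bar>d\<bar> \<le> 1" "\<bar>e\<bar> \<le> 1" "K \<le> 1" and pr: "0 \<le> M 1" "0 \<le> M (-1)"
  shows "0 \<le> (F 1 + F (-1)) / 2 + 2 * ((d^2 + e^2)/2 - K) + 10/3 * (d^2 + e^2 - U * (d + e))"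
proof -
  define D where "D = d + e"
  have pr': "0 \<le> 1 + D + K" "0 \<le> 1 - D + K" using pr by (auto simp: M_def D_def)
  have x4: "0 \<le> x^2 * (1 - x^2)" if "\<bar>x\<bar> \<le> 1" for x :: real
    using that by (simp add: abs_square_le_1)
  define r where "r = 85/36 * (d - e)^2 + 2/9 * (d^2 * (1 - d^2)) + 2/9 * (e^2 * (1 - e^2))"
  have r: "0 \<le> r" using x4[OF b(1)] x4[OF b(2)] by (simp add: r_def)
  define a where "a = 73/36 * D^2 + K^2 - 4/3 * D^2 * K + r"
  define c where "c = D * K * 8/3 - 2/3 * K^2 * D - 2/3 * D^3"
  have "0 \<le> a + c * U"
  proof (rule affine_nonneg_between[OF U])
    show "0 \<le> a + c" using c4_quadratic_nonneg[OF pr' b(3)] r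
      by (simp add: a_def c_def algebra_simps power2_eq_square power3_eq_cube)
    show "0 \<le> a - c" using c4_quadratic_nonneg[of "-D" K] pr' b(3) r
      by (simp add: a_def c_def algebra_simps power2_eq_square power3_eq_cube)
  qed
  also have "a + c * U = (F 1 + F (-1)) / 2 + 2 * ((d^2 + e^2)/2 - K) + 10/3 * (d^2 + e^2 - U * (d + e))"
    unfolding a_def c_def F_def w_def M_def D_def r_def by (simp add: field_simps power2_eq_square power3_eq_cube)
  finally show ?thesis .
qed

lemma even_power_average_le:
  fixes x :: real assumes "\<bar>x\<bar> \<le> 1" "k \<le> 4"
  shows "((1 + x)^k + (1 - x)^k) / 2 \<le> 1 + (if k \<le> 1 then 0 else if k = 2 then 1 else if k = 3 then 3 else 7) * x^2"
proof -
  have "x^4 \<le> x^2" using assms power_decreasing[of 2 4 "\<bar>x\<bar>"] by simp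
  then have x4: "x * (x * (x * x)) \<le> x * x" by (simp add: power2_eq_square power4_eq_xxxx mult.assoc)
  consider "k = 0" | "k = 1" | "k = 2" | "k = 3" | "k = 4" using assms(2) by linarith
  then show ?thesis
    by cases (use x4 in \<open>simp_all add: field_simps power2_eq_square power3_eq_cube power4_eq_xxxx\<close>)
qed

text \<open>The tangent at \<open>M = 1\<close>; in terms of \<open>sqrt M\<close> the difference
  contains the square of \<open>sqrt M - 1\<close>. The exponent counts half powers: two for a
  common neighbour, one for a pendant vertex, hence at most 6.\<close>

lemma half_power_ge_tangent:
  fixes M :: real assumes "0 \<le> M" "2 \<le> n" "n \<le> 6"
  shows "1 + real n / 2 * (M - 1) \<le> sqrt M ^ n"
proof -
  define s where "s = sqrt M"
  have s: "0 \<le> s" "s^2 = M" using assms by (auto simp: s_def)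
  consider "n = 2" | "n = 3" | "n = 4" | "n = 5" | "n = 6" using assms by linarith
  then have "1 + real n / 2 * (s^2 - 1) \<le> s ^ n"
  proof cases
    case 2
    have "0 \<le> (s - 1)^2 * (s + 1/2)" using s by simp
    then show ?thesis using 2 by (simp add: field_simps power2_eq_square power3_eq_cube)
  next
    case 3
    have "0 \<le> (s^2 - 1)^2" by simp
    then show ?thesis using 3 by (simp add: field_simps power2_eq_square power4_eq_xxxx)
  next
    case 4
    have "0 \<le> (s - 1)^2 * (s^3 + 2 * s^2 + 3 * s + 3/2)" using s(1) by simp
    then show ?thesis using 4 by (simp add: field_simps eval_nat_numeral)
  next
    case 5
    have "0 \<le> (s^2 - 1)^2 * (s^2 + 2)" by simp
    then show ?thesis using 5 by (simp add: field_simps eval_nat_numeral)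
  qed auto
  then show ?thesis using s(2) by (simp add: s_def)
qed

text \<open>The inequality of arithmetic and geometric means. It replaces unequal powers at the two
  centres by equal half powers, at the cost of symmetrising.\<close>

lemma sqrt_power_mult_le:
  fixes a c :: real assumes "0 \<le> a" "0 \<le> c"
  shows "sqrt a ^ (i + l) * sqrt c ^ (i + l) \<le> (a ^ i * c ^ l + c ^ i * a ^ l) / 2"
proof -
  define p q where "p = sqrt a ^ i * sqrt c ^ l" and "q = sqrt c ^ i * sqrt a ^ l"
  have "0 \<le> (p - q)^2" by simp
  moreover have "p^2 = a ^ i * c ^ l" "q^2 = c ^ i * a ^ l"
    using assms by (simp_all add: p_def q_def power_mult_distrib power_mult[symmetric] mult.commute[of _ 2] power_mult)
  moreover have "p * q = sqrt a ^ (i + l) * sqrt c ^ (i + l)" by (simp add: p_def q_def power_add)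
  ultimately show ?thesis by (simp add: power2_eq_square algebra_simps)
qed

text \<open>Bounds the colour average of the apex-free cost for a single common neighbour. The
  factor 5/2 is generous: it only has to fit below 3 q - 1/2 with q = 1 + (i + l)/2.\<close>

lemma tree_term_le:
  fixes d e c :: real
  assumes "i + l \<le> 2" "\<bar>d\<bar> \<le> 1" "\<bar>e\<bar> \<le> 1" "\<bar>c\<bar> \<le> 1"
  shows "((1 + d) ^ i * (1 + e) ^ l * (1 + (d + e) + c) + (1 - d) ^ i * (1 - e) ^ l * (1 - (d + e) + c)) / 2
    \<le> 1 + c + 5/2 * real (i + l) * (d^2 + e^2)"
proof -
  have sq: "0 \<le> d^2" "0 \<le> e^2" "2 * (d * e) \<le> d^2 + e^2" "- (2 * (d * e)) \<le> d^2 + e^2"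
    using zero_le_power2[of "d - e"] zero_le_power2[of "d + e"] by (auto simp: power2_eq_square algebra_simps)
  have c2: "d^2 * c \<le> d^2 * 1" "e^2 * c \<le> e^2 * 1" using assms by (intro mult_left_mono; simp add: abs_le_iff)+
  have "\<bar>d * e * c\<bar> \<le> \<bar>d * e\<bar>" using assms by (simp add: abs_mult mult_left_le)
  then have c3: "2 * (d * e * c) \<le> d^2 + e^2" using sq by (simp add: abs_le_iff) linarith
  let ?L = "((1 + d) ^ i * (1 + e) ^ l * (1 + (d + e) + c) + (1 - d) ^ i * (1 - e) ^ l * (1 - (d + e) + c)) / 2"
  have "real (i + l) = 0 \<and> ?L = 1 + c \<or> real (i + l) = 1 \<and> ?L = 1 + c + d^2 + d * e
    \<or> real (i + l) = 1 \<and> ?L = 1 + c + e^2 + d * e \<or> real (i + l) = 2 \<and> ?L = 1 + c + 3 * (d * e) + d * e * c + d^2 + e^2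
    \<or> real (i + l) = 2 \<and> ?L = 1 + c + 3 * d^2 + d^2 * c + 2 * (d * e)
    \<or> real (i + l) = 2 \<and> ?L = 1 + c + 3 * e^2 + e^2 * c + 2 * (d * e)"
  proof -
    consider "i = 0" "l = 0" | "i = 1" "l = 0" | "i = 0" "l = 1" | "i = 1" "l = 1" | "i = 2" "l = 0" | "i = 0" "l = 2"
      using assms(1) by linarith
    then show ?thesis by cases (simp_all add: field_simps power2_eq_square)
  qed
  then show ?thesis by (elim disjE conjE; simp only:; use sq c2 c3 in argo)
qed

subsection \<open>Bounded measurable functions\<close>

text \<open>The bound is required at all points, not only on the space, so that closure under
  arithmetic, composition and partial integration carries no side conditions. On probability spaces
  it yields every integrability and Fubini hypothesis.\<close>

definition nice :: "'a measure \<Rightarrow> ('a \<Rightarrow> real) \<Rightarrow> bool" where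
  "nice N f \<longleftrightarrow> f \<in> borel_measurable N \<and> (\<exists>B. \<forall>x. \<bar>f x\<bar> \<le> B)"

lemma niceI: "f \<in> borel_measurable N \<Longrightarrow> (\<And>x. \<bar>f x\<bar> \<le> B) \<Longrightarrow> nice N f"
  by (auto simp: nice_def)

lemma nice_measurable: "nice N f \<Longrightarrow> f \<in> borel_measurable N"
  by (simp add: nice_def)

lemma nice_const: "nice N (\<lambda>x. c)"
  by (rule niceI[of _ _ "\<bar>c\<bar>"]) auto

lemma nice_add:
  assumes "nice N f" "nice N g" shows "nice N (\<lambda>x. f x + g x)"
proof -
  obtain B C where "\<And>x. \<bar>f x\<bar> \<le> B" "\<And>x. \<bar>g x\<bar> \<le> C" using assms by (auto simp: nice_def)
  then have "\<bar>f x + g x\<bar> \<le> B + C" for x by (intro order_trans[OF abs_triangle_ineq] add_mono)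
  then show ?thesis using assms by (intro niceI) (auto simp: nice_def)
qed

lemma nice_mult:
  assumes "nice N f" "nice N g" shows "nice N (\<lambda>x. f x * g x)"
proof -
  obtain B C where BC: "\<And>x. \<bar>f x\<bar> \<le> B" "\<And>x. \<bar>g x\<bar> \<le> C" using assms by (auto simp: nice_def)
  have "\<bar>f x * g x\<bar> \<le> B * C" for x unfolding abs_mult
    by (intro mult_mono BC order_trans[OF abs_ge_zero BC(1)]) auto
  then show ?thesis using assms by (intro niceI) (auto simp: nice_def)
qed

lemma nice_uminus: "nice N f \<Longrightarrow> nice N (\<lambda>x. - f x)"
  by (auto simp: nice_def)

lemma nice_diff: "nice N f \<Longrightarrow> nice N g \<Longrightarrow> nice N (\<lambda>x. f x - g x)"
  using nice_add[of N f "\<lambda>x. - g x"] nice_uminus by auto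

lemma nice_divide: "nice N f \<Longrightarrow> nice N (\<lambda>x. f x / c)"
  using nice_mult[of N f "\<lambda>x. inverse c"] nice_const by (auto simp: divide_inverse)

lemma nice_power: "nice N f \<Longrightarrow> nice N (\<lambda>x. f x ^ n)"
  by (induction n) (auto intro: nice_mult nice_const)

lemma nice_prod: "(\<And>i. i \<in> I \<Longrightarrow> nice N (f i)) \<Longrightarrow> nice N (\<lambda>x. \<Prod>i\<in>I. f i x)"
  by (induction I rule: infinite_finite_induct) (auto intro: nice_mult nice_const)

lemma nice_exp:
  assumes "nice N f" shows "nice N (\<lambda>x. exp (f x))"
proof -
  obtain B where "\<And>x. \<bar>f x\<bar> \<le> B" using assms by (auto simp: nice_def)
  then have "\<bar>exp (f x)\<bar> \<le> exp B" for x by (simp add: abs_le_iff)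
  then show ?thesis using assms by (intro niceI) (auto simp: nice_def)
qed

lemma nice_sqrt:
  assumes "nice N f" shows "nice N (\<lambda>x. sqrt (f x))"
proof -
  obtain B where "\<And>x. \<bar>f x\<bar> \<le> B" using assms by (auto simp: nice_def)
  then have "\<bar>sqrt (f x)\<bar> \<le> sqrt B" for x by (simp add: real_sqrt_abs'[symmetric])
  then show ?thesis using assms by (intro niceI) (auto simp: nice_def)
qed

lemma nice_compose:
  "nice N f \<Longrightarrow> g \<in> measurable L N \<Longrightarrow> nice L (\<lambda>x. f (g x))"
  by (auto simp: nice_def intro: measurable_compose)

lemma (in prob_space) integrable_nice: "nice M f \<Longrightarrow> integrable M f"
  using integrable_const_bound[of f] by (auto simp: nice_def)

lemma (in prob_space) integral_abs_le:
  fixes f :: "'a \<Rightarrow> real"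
  assumes "f \<in> borel_measurable M" "\<And>x. \<bar>f x\<bar> \<le> B"
  shows "\<bar>\<integral>x. f x \<partial>M\<bar> \<le> B"
proof -
  have i: "integrable M f" using assms by (intro integrable_nice niceI)
  have "\<bar>\<integral>x. f x \<partial>M\<bar> \<le> (\<integral>x. \<bar>f x\<bar> \<partial>M)" by (rule integral_abs_bound)
  also have "\<dots> \<le> (\<integral>x. B \<partial>M)" using i assms by (intro integral_mono) auto
  finally show ?thesis by (simp add: prob_space)
qed

lemma (in prob_space) nice_integral:
  assumes "nice (N \<Otimes>\<^sub>M M) (\<lambda>p. f (fst p) (snd p))"
  shows "nice N (\<lambda>x. \<integral>y. f x y \<partial>M)"
proof -
  obtain B where B: "\<And>p. \<bar>f (fst p) (snd p)\<bar> \<le> B" using assms by (auto simp: nice_def)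
  have m[measurable]: "case_prod f \<in> borel_measurable (N \<Otimes>\<^sub>M M)"
    using assms by (simp add: nice_def case_prod_beta')
  show ?thesis
  proof (rule niceI[of _ _ "max B 0"])
    show "(\<lambda>x. \<integral>y. f x y \<partial>M) \<in> borel_measurable N" by measurable
    show "\<bar>\<integral>y. f x y \<partial>M\<bar> \<le> max B 0" for x
    \<comment> \<open>Outside the space a section may fail to be integrable; its integral is then 0
      by convention, hence the bound \<open>max B 0\<close>.\<close>
    proof (cases "integrable M (f x)")
      case True
      then show ?thesis using B[of "(x, _)"] by (intro integral_abs_le) (auto simp: le_max_iff_disj)
    qed (simp add: not_integrable_integral_eq)
  qed
qed

lemma integral_swap_nice:
  assumes N: "prob_space N" and M: "prob_space M" and F: "nice (N \<Otimes>\<^sub>M M) (\<lambda>p. F (fst p) (snd p))"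
  shows "(\<integral>x. \<integral>y. F x y \<partial>M \<partial>N) = (\<integral>y. \<integral>x. F x y \<partial>N \<partial>M)"
proof -
  interpret N: prob_space N by fact
  interpret M: prob_space M by fact
  interpret P: pair_prob_space N M ..
  have "integrable (N \<Otimes>\<^sub>M M) (case_prod F)"
    using P.integrable_nice[OF F] by (simp add: case_prod_beta')
  then show ?thesis by (rule P.Fubini_integral[symmetric])
qed

lemmas nice_intros = nice_const nice_add nice_diff nice_mult nice_uminus nice_divide nice_power nice_prod nice_exp nice_sqrt

section \<open>Symmetric kernels with values between -1 and 1: degrees, codegrees and the weighted
  square bound\<close>

locale signed_kernel = prob_space M for M :: "'a measure" +
  fixes U :: "'a \<Rightarrow> 'a \<Rightarrow> real"
  assumes U_measurable: "(\<lambda>p. U (fst p) (snd p)) \<in> borel_measurable (M \<Otimes>\<^sub>M M)"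
    and U_sym: "U x y = U y x" and U_bound: "\<bar>U x y\<bar> \<le> 1"
begin

sublocale pair: pair_prob_space M M ..

lemma nice_U: "f \<in> measurable N M \<Longrightarrow> g \<in> measurable N M \<Longrightarrow> nice N (\<lambda>x. U (f x) (g x))"
  using nice_compose[OF niceI[OF U_measurable U_bound], of "\<lambda>x. (f x, g x)" N] by simp

abbreviation E2 :: "('a \<Rightarrow> 'a \<Rightarrow> real) \<Rightarrow> real" where
  "E2 F \<equiv> \<integral>x. \<integral>y. F x y \<partial>M \<partial>M"

abbreviation nice2 :: "('a \<Rightarrow> 'a \<Rightarrow> real) \<Rightarrow> bool" where
  "nice2 F \<equiv> nice (M \<Otimes>\<^sub>M M) (\<lambda>p. F (fst p) (snd p))"

lemma integrable_nice2: "nice2 F \<Longrightarrow> integrable (M \<Otimes>\<^sub>M M) (case_prod F)"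
  using pair.integrable_nice[of "\<lambda>p. F (fst p) (snd p)"] by (simp add: case_prod_beta')

lemma E2_eq: "nice2 F \<Longrightarrow> E2 F = (\<integral>p. F (fst p) (snd p) \<partial>(M \<Otimes>\<^sub>M M))"
  using pair.integral_fst'[OF integrable_nice2] by (simp add: case_prod_beta')

lemma E2_swap: "nice2 F \<Longrightarrow> E2 F = E2 (\<lambda>x y. F y x)"
  using pair.Fubini_integral[OF integrable_nice2] by simp

lemma nice2_swap: "nice2 F \<Longrightarrow> nice2 (\<lambda>x y. F y x)"
  by (rule nice_compose[of _ "\<lambda>p. F (fst p) (snd p)" "\<lambda>p. (snd p, fst p)", simplified]) auto

lemma E2_add: "nice2 F \<Longrightarrow> nice2 G \<Longrightarrow> E2 (\<lambda>x y. F x y + G x y) = E2 F + E2 G"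
  using Bochner_Integration.integral_add[OF pair.integrable_nice pair.integrable_nice, of "\<lambda>p. F (fst p) (snd p)" "\<lambda>p. G (fst p) (snd p)"]
  by (simp add: E2_eq nice_add)

lemma E2_diff: "nice2 F \<Longrightarrow> nice2 G \<Longrightarrow> E2 (\<lambda>x y. F x y - G x y) = E2 F - E2 G"
  using Bochner_Integration.integral_diff[OF pair.integrable_nice pair.integrable_nice, of "\<lambda>p. F (fst p) (snd p)" "\<lambda>p. G (fst p) (snd p)"]
  by (simp add: E2_eq nice_diff)

lemma E2_cmult: "E2 (\<lambda>x y. c * F x y) = c * E2 F"
  by simp

lemma E2_mono:
  assumes "nice2 F" "nice2 G" "\<And>x y. x \<in> space M \<Longrightarrow> y \<in> space M \<Longrightarrow> F x y \<le> G x y"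
  shows "E2 F \<le> E2 G"
  unfolding E2_eq[OF assms(1)] E2_eq[OF assms(2)]
  by (intro integral_mono pair.integrable_nice assms) (auto simp: space_pair_measure)

definition deg :: "'a \<Rightarrow> real" where "deg x = (\<integral>y. U x y \<partial>M)"
definition cod :: "'a \<Rightarrow> 'a \<Rightarrow> real" where "cod x y = (\<integral>z. U x z * U y z \<partial>M)"
definition K :: "real \<Rightarrow> 'a \<Rightarrow> 'a \<Rightarrow> real" where "K s x y = 1 + s * U x y"
definition dK :: "real \<Rightarrow> 'a \<Rightarrow> real" where "dK s x = 1 + s * deg x"
text \<open>For \<open>s = 1\<close> and \<open>s = -1\<close> this is the integral of
  \<open>K s x z * K s y z\<close> over \<open>z\<close>; as \<open>s^2 = 1\<close>, the codegree
  term is the same for both colours.\<close>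

definition cK :: "real \<Rightarrow> 'a \<Rightarrow> 'a \<Rightarrow> real" where "cK s x y = 1 + s * (deg x + deg y) + cod x y"
definition P :: real where "P = (\<integral>x. (deg x)^2 \<partial>M)"

lemma nice_K: "f \<in> measurable N M \<Longrightarrow> g \<in> measurable N M \<Longrightarrow> nice N (\<lambda>x. K s (f x) (g x))"
  unfolding K_def by (intro nice_intros nice_U)

lemma nice_deg: "f \<in> measurable N M \<Longrightarrow> nice N (\<lambda>x. deg (f x))"
  unfolding deg_def by (intro nice_integral nice_U) simp_all

lemma nice_cod: "f \<in> measurable N M \<Longrightarrow> g \<in> measurable N M \<Longrightarrow> nice N (\<lambda>x. cod (f x) (g x))"
  unfolding cod_def by (intro nice_integral nice_mult nice_U) simp_all

lemma nice_dK: "f \<in> measurable N M \<Longrightarrow> nice N (\<lambda>x. dK s (f x))"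
  unfolding dK_def by (intro nice_intros nice_deg)

lemma nice_cK: "f \<in> measurable N M \<Longrightarrow> g \<in> measurable N M \<Longrightarrow> nice N (\<lambda>x. cK s (f x) (g x))"
  unfolding cK_def by (intro nice_intros nice_deg nice_cod)

lemmas kernel_nice = nice_intros nice_U nice_K nice_deg nice_cod nice_dK nice_cK

lemma deg_bound:
  assumes "x \<in> space M" shows "\<bar>deg x\<bar> \<le> 1"
  unfolding deg_def using assms by (intro integral_abs_le nice_measurable U_bound kernel_nice) auto

lemma cod_bound:
  assumes "x \<in> space M" "y \<in> space M" shows "\<bar>cod x y\<bar> \<le> 1"
  unfolding cod_def using assms
  by (intro integral_abs_le nice_measurable kernel_nice) (auto simp: abs_mult U_bound intro!: mult_le_one)

lemma K_nonneg: "s = 1 \<or> s = -1 \<Longrightarrow> 0 \<le> K s x y"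
  using U_bound[of x y] by (auto simp: K_def abs_le_iff)

lemma K_sym: "K s x y = K s y x"
  by (simp add: K_def U_sym)

lemma integral_K: "x \<in> space M \<Longrightarrow> (\<integral>y. K s x y \<partial>M) = dK s x"
  unfolding K_def dK_def deg_def
  by (subst Bochner_Integration.integral_add) (auto intro!: integrable_nice kernel_nice simp: prob_space)

lemma integral_K_K:
  assumes "x \<in> space M" "y \<in> space M" "s = 1 \<or> s = -1"
  shows "(\<integral>z. K s x z * K s y z \<partial>M) = cK s x y"
proof -
  note i = integrable_nice kernel_nice measurable_const
  have "(\<integral>z. K s x z * K s y z \<partial>M) = (\<integral>z. 1 + (s * U x z + (s * U y z + U x z * U y z)) \<partial>M)"
    using assms(3) by (intro Bochner_Integration.integral_cong) (auto simp: K_def algebra_simps)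
  also have "\<dots> = 1 + (s * deg x + (s * deg y + cod x y))"
    unfolding deg_def cod_def using assms(1,2)
    by (simp add: Bochner_Integration.integral_add i prob_space)
  finally show ?thesis by (simp add: cK_def algebra_simps)
qed

lemma cK_sym: "cK s x y = cK s y x"
  by (simp add: cK_def cod_def add.commute mult.commute)

lemma cK_nonneg: "x \<in> space M \<Longrightarrow> y \<in> space M \<Longrightarrow> s = 1 \<or> s = -1 \<Longrightarrow> 0 \<le> cK s x y"
  by (subst integral_K_K[symmetric]) (auto intro!: integral_nonneg_AE mult_nonneg_nonneg K_nonneg)

lemma integral_square_nonneg_diff:
  fixes f :: "'a \<Rightarrow> real"
  shows "2 * \<theta> * (\<integral>x. f x \<partial>M) - \<theta>^2 \<le> (\<integral>x. f x \<partial>M)^2"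
  using zero_le_power2[of "(\<integral>x. f x \<partial>M) - \<theta>"] by (simp add: power2_eq_square algebra_simps)

text \<open>Degrees and codegrees in which every vertex carries the factor \<open>h\<close>. The
  choice \<open>h = 1\<close> describes copies without apex, \<open>h z = K s z y\<close> copies
  joined to a fixed apex \<open>y\<close>, so one computation serves for both.\<close>

definition dKw :: "real \<Rightarrow> ('a \<Rightarrow> real) \<Rightarrow> 'a \<Rightarrow> real" where
  "dKw s h b = (\<integral>z. K s b z * h z \<partial>M)"
definition cKw :: "real \<Rightarrow> ('a \<Rightarrow> real) \<Rightarrow> 'a \<Rightarrow> 'a \<Rightarrow> real" where
  "cKw s h b b' = (\<integral>z. K s b z * K s b' z * h z \<partial>M)"

lemma nice_dKw:
  assumes "nice M h" "f \<in> measurable N M" shows "nice N (\<lambda>x. dKw s h (f x))"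
  unfolding dKw_def using assms(2) by (intro nice_integral kernel_nice nice_compose[OF assms(1)]; simp)

lemma nice_cKw:
  assumes "nice M h" "f \<in> measurable N M" "g \<in> measurable N M" shows "nice N (\<lambda>x. cKw s h (f x) (g x))"
  unfolding cKw_def using assms(2,3) by (intro nice_integral kernel_nice nice_compose[OF assms(1)]; simp)

text \<open>In the induction step one common neighbour z is integrated last, and its factors are absorbed into f.\<close>
lemma hub_induct:
  assumes h: "nice M h" "\<And>x. x \<in> space M \<Longrightarrow> 0 \<le> h x" and f: "nice M f"
  shows "2 * \<theta> * (\<integral>b. f b * dKw s h b ^ k \<partial>M) - \<theta>^2 * (\<integral>z. h z \<partial>M) ^ k \<le> E2 (\<lambda>b b'. f b * f b' * cKw s h b b' ^ k)"
  using f
proof (induction k arbitrary: f)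
  case 0
  have "E2 (\<lambda>b b'. f b * f b') = (\<integral>x. f x \<partial>M)^2" by (simp add: power2_eq_square)
  then show ?case using integral_square_nonneg_diff[of \<theta> f] by simp
next
  case (Suc k)
  note nice = kernel_nice nice_dKw[OF h(1)] nice_cKw[OF h(1)] nice_compose[OF h(1)] nice_compose[OF Suc.prems] nice_integral
  let ?A = "\<lambda>z. E2 (\<lambda>b b'. (f b * K s b z) * (f b' * K s b' z) * cKw s h b b' ^ k)"
  let ?L = "\<lambda>z. 2 * \<theta> * (\<integral>b. (f b * K s b z) * dKw s h b ^ k \<partial>M) - \<theta>^2 * (\<integral>z. h z \<partial>M) ^ k"
  have L: "(\<integral>z. h z * ?L z \<partial>M) = 2 * \<theta> * (\<integral>b. f b * dKw s h b ^ Suc k \<partial>M) - \<theta>^2 * (\<integral>z. h z \<partial>M) ^ Suc k"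
  proof -
    have "(\<integral>z. h z * ?L z \<partial>M) = (\<integral>z. 2 * \<theta> * (\<integral>b. f b * dKw s h b ^ k * (K s b z * h z) \<partial>M)
        - \<theta>^2 * (\<integral>z. h z \<partial>M) ^ k * h z \<partial>M)"
    proof (intro Bochner_Integration.integral_cong refl)
      fix z
      have "(\<integral>b. f b * dKw s h b ^ k * (K s b z * h z) \<partial>M) = (\<integral>b. h z * ((f b * K s b z) * dKw s h b ^ k) \<partial>M)"
        by (simp only: mult_ac)
      then show "h z * ?L z = 2 * \<theta> * (\<integral>b. f b * dKw s h b ^ k * (K s b z * h z) \<partial>M) - \<theta>^2 * (\<integral>z. h z \<partial>M) ^ k * h z"
        by (simp add: right_diff_distrib)
    qed
    also have "\<dots> = 2 * \<theta> * (\<integral>z. \<integral>b. f b * dKw s h b ^ k * (K s b z * h z) \<partial>M \<partial>M) - \<theta>^2 * (\<integral>z. h z \<partial>M) ^ Suc k"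
    proof -
      have "integrable M (\<lambda>z. \<integral>b. f b * dKw s h b ^ k * (K s b z * h z) \<partial>M)" "integrable M h"
        using h by (intro integrable_nice nice; simp)+
      then show ?thesis
        by (subst Bochner_Integration.integral_diff) (auto simp only: integral_mult_right_zero integrable_mult_right power_Suc2 mult.assoc)
    qed
    also have "(\<integral>z. \<integral>b. f b * dKw s h b ^ k * (K s b z * h z) \<partial>M \<partial>M) = (\<integral>b. \<integral>z. f b * dKw s h b ^ k * (K s b z * h z) \<partial>M \<partial>M)"
      by (rule E2_swap) (intro nice; simp)
    also have "\<dots> = (\<integral>b. f b * dKw s h b ^ Suc k \<partial>M)"
      by (simp only: integral_mult_right_zero dKw_def[symmetric]) (simp only: power_Suc2 mult.assoc)
    finally show ?thesis .
  qed
  \<comment> \<open>Treating the two centres as one point of the product space lets a single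
    exchange of integrals move \<open>z\<close> to the outside.\<close>
  have "E2 (\<lambda>b b'. f b * f b' * cKw s h b b' ^ Suc k)
      = (\<integral>p. f (fst p) * f (snd p) * cKw s h (fst p) (snd p) ^ Suc k \<partial>(M \<Otimes>\<^sub>M M))"
    by (rule E2_eq) (intro nice; simp)
  also have "\<dots> = (\<integral>p. \<integral>z. f (fst p) * f (snd p) * cKw s h (fst p) (snd p) ^ k * (K s (fst p) z * K s (snd p) z * h z) \<partial>M \<partial>(M \<Otimes>\<^sub>M M))"
    by (simp only: integral_mult_right_zero cKw_def[symmetric]) (simp only: power_Suc2 mult.assoc)
  also have "\<dots> = (\<integral>z. \<integral>p. f (fst p) * f (snd p) * cKw s h (fst p) (snd p) ^ k * (K s (fst p) z * K s (snd p) z * h z) \<partial>(M \<Otimes>\<^sub>M M) \<partial>M)"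
    by (rule integral_swap_nice[OF pair.prob_space_axioms prob_space_axioms]) (intro nice; simp)
  also have "\<dots> = (\<integral>z. h z * ?A z \<partial>M)"
  proof (intro Bochner_Integration.integral_cong refl)
    fix z assume z: "z \<in> space M"
    have "?A z = (\<integral>p. (f (fst p) * K s (fst p) z) * (f (snd p) * K s (snd p) z) * cKw s h (fst p) (snd p) ^ k \<partial>(M \<Otimes>\<^sub>M M))"
      by (rule E2_eq) (intro nice; simp add: z)
    have "(\<integral>p. f (fst p) * f (snd p) * cKw s h (fst p) (snd p) ^ k * (K s (fst p) z * K s (snd p) z * h z) \<partial>(M \<Otimes>\<^sub>M M))
        = (\<integral>p. h z * ((f (fst p) * K s (fst p) z) * (f (snd p) * K s (snd p) z) * cKw s h (fst p) (snd p) ^ k) \<partial>(M \<Otimes>\<^sub>M M))"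
      by (simp only: mult_ac)
    also have "\<dots> = h z * ?A z" unfolding \<open>?A z = _\<close> by (rule integral_mult_right_zero)
    finally show "(\<integral>p. f (fst p) * f (snd p) * cKw s h (fst p) (snd p) ^ k * (K s (fst p) z * K s (snd p) z * h z) \<partial>(M \<Otimes>\<^sub>M M))
        = h z * ?A z" .
  qed
  finally have A: "E2 (\<lambda>b b'. f b * f b' * cKw s h b b' ^ Suc k) = (\<integral>z. h z * ?A z \<partial>M)" .
  \<comment> \<open>For each \<open>z\<close> the induction hypothesis is applied to
    \<open>f b * K s b z\<close>. The same \<theta> serves for all \<open>z\<close>, and averaging
    the subtracted term against \<open>h\<close> supplies the missing factor of the integral of
    \<open>h\<close>.\<close>
  have "(\<integral>z. h z * ?L z \<partial>M) \<le> (\<integral>z. h z * ?A z \<partial>M)"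
  proof (rule integral_mono)
    show "h z * ?L z \<le> h z * ?A z" if z: "z \<in> space M" for z
      using h(2)[OF z] by (intro mult_left_mono Suc.IH nice) (auto simp: z)
  qed (intro integrable_nice nice; simp)+
  then show ?case unfolding A L .
qed
end

subsection \<open>The hub inequality\<close>

context signed_kernel begin

lemma nice_compose2: "nice2 F \<Longrightarrow> f \<in> measurable N M \<Longrightarrow> g \<in> measurable N M \<Longrightarrow> nice N (\<lambda>x. F (f x) (g x))"
  using nice_compose[of "M \<Otimes>\<^sub>M M" "\<lambda>p. F (fst p) (snd p)" "\<lambda>x. (f x, g x)" N] by simp

text \<open>The density of copies with centres \<open>b\<close>, \<open>b'\<close>, with
  \<open>i\<close> and \<open>l\<close> vertices attached to one centre only and \<open>k\<close>
  attached to both; every vertex carries \<open>h\<close> and the pair of centres carries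
  \<Phi>.\<close>

definition pair_moment :: "real \<Rightarrow> ('a \<Rightarrow> real) \<Rightarrow> ('a \<Rightarrow> 'a \<Rightarrow> real) \<Rightarrow> nat \<Rightarrow> nat \<Rightarrow> nat \<Rightarrow> real" where
  "pair_moment s h \<Phi> i k l = E2 (\<lambda>b b'. \<Phi> b b' * (h b * h b') * (dKw s h b ^ i * dKw s h b' ^ l) * cKw s h b b' ^ k)"

lemma cKw_sym: "cKw s h b b' = cKw s h b' b"
  by (simp add: cKw_def mult.commute)

lemma dKw_nonneg: "s = 1 \<or> s = -1 \<Longrightarrow> (\<And>x. x \<in> space M \<Longrightarrow> 0 \<le> h x) \<Longrightarrow> 0 \<le> dKw s h b"
  unfolding dKw_def by (intro integral_nonneg_AE AE_I2 mult_nonneg_nonneg K_nonneg) auto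

lemma cKw_nonneg: "s = 1 \<or> s = -1 \<Longrightarrow> (\<And>x. x \<in> space M \<Longrightarrow> 0 \<le> h x) \<Longrightarrow> 0 \<le> cKw s h b b'"
  unfolding cKw_def by (intro integral_nonneg_AE AE_I2 mult_nonneg_nonneg K_nonneg) auto

text \<open>\<open>hub_induct\<close> wants the same function at both centres, but the pendant
  vertices give different powers. Averaging over the exchange of the centres and
  \<open>sqrt_power_mult_le\<close> produce equal half powers, which are absorbed into that
  function.\<close>

lemma hub:
  assumes s: "s = 1 \<or> s = -1" and h: "nice M h" "\<And>x. x \<in> space M \<Longrightarrow> 0 \<le> h x"
    and w: "nice M w" "\<And>x. x \<in> space M \<Longrightarrow> 0 \<le> w x"
  shows "2 * \<theta> * (\<integral>b. w b * h b * (sqrt (dKw s h b) ^ (i + l) * dKw s h b ^ k) \<partial>M) - \<theta>^2 * (\<integral>z. h z \<partial>M) ^ k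
    \<le> pair_moment s h (\<lambda>b b'. w b * w b') i k l"
proof -
  note nice = kernel_nice nice_dKw[OF h(1)] nice_cKw[OF h(1)] nice_compose[OF h(1)] nice_compose[OF w(1)] measurable_ident
  let ?f = "\<lambda>b. w b * h b * sqrt (dKw s h b) ^ (i + l)"
  let ?F = "\<lambda>b b'. w b * w b' * (h b * h b') * (dKw s h b ^ i * dKw s h b' ^ l) * cKw s h b b' ^ k"
  have nF: "nice2 ?F" by (intro nice; simp)
  have nf: "nice M ?f" by (intro nice; simp)
  have "2 * \<theta> * (\<integral>b. ?f b * dKw s h b ^ k \<partial>M) - \<theta>^2 * (\<integral>z. h z \<partial>M) ^ k
      \<le> E2 (\<lambda>b b'. ?f b * ?f b' * cKw s h b b' ^ k)"
    by (rule hub_induct[OF h nf])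
  also have "\<dots> \<le> E2 (\<lambda>b b'. (?F b b' + ?F b' b) / 2)"
  proof (rule E2_mono)
    show "nice2 (\<lambda>b b'. ?f b * ?f b' * cKw s h b b' ^ k)" "nice2 (\<lambda>b b'. (?F b b' + ?F b' b) / 2)"
      by (intro nice; simp)+
    fix b b' assume b: "b \<in> space M" "b' \<in> space M"
    let ?a = "dKw s h b" and ?c = "dKw s h b'"
    have "?f b * ?f b' * cKw s h b b' ^ k = (w b * w b' * (h b * h b') * cKw s h b b' ^ k) * (sqrt ?a ^ (i + l) * sqrt ?c ^ (i + l))"
      by (simp only: mult_ac)
    also have "\<dots> \<le> (w b * w b' * (h b * h b') * cKw s h b b' ^ k) * ((?a ^ i * ?c ^ l + ?c ^ i * ?a ^ l) / 2)"
      using b h w by (intro mult_left_mono sqrt_power_mult_le dKw_nonneg cKw_nonneg mult_nonneg_nonneg zero_le_power s) auto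
    also have "\<dots> = (?F b b' + ?F b' b) / 2" by (simp add: cKw_sym[of s h b' b] algebra_simps)
    finally show "?f b * ?f b' * cKw s h b b' ^ k \<le> (?F b b' + ?F b' b) / 2" .
  qed
  also have "\<dots> = (E2 ?F + E2 (\<lambda>b b'. ?F b' b)) / 2"
    using E2_add[OF nF nice2_swap[OF nF]] by simp
  also have "\<dots> = pair_moment s h (\<lambda>b b'. w b * w b') i k l"
    using E2_swap[OF nF] by (simp add: pair_moment_def)
  finally show ?thesis by (simp only: mult.assoc)
qed

lemma dKw_K: "b \<in> space M \<Longrightarrow> y \<in> space M \<Longrightarrow> s = 1 \<or> s = -1 \<Longrightarrow> dKw s (\<lambda>z. K s z y) b = cK s b y"
  unfolding dKw_def by (subst integral_K_K[symmetric]) (auto simp: K_sym[of s _ y])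

lemma dKw_one: "b \<in> space M \<Longrightarrow> dKw s (\<lambda>z. 1) b = dK s b"
  by (simp add: dKw_def integral_K)

lemma cKw_one: "b \<in> space M \<Longrightarrow> b' \<in> space M \<Longrightarrow> s = 1 \<or> s = -1 \<Longrightarrow> cKw s (\<lambda>z. 1) b b' = cK s b b'"
  by (simp add: cKw_def integral_K_K)

lemma pair_moment_one:
  assumes s: "s = 1 \<or> s = -1"
  shows "pair_moment s (\<lambda>z. 1) \<Phi> i k l = E2 (\<lambda>b b'. \<Phi> b b' * (dK s b ^ i * dK s b' ^ l) * cK s b b' ^ k)"
  unfolding pair_moment_def using s by (intro Bochner_Integration.integral_cong refl) (simp_all add: dKw_one cKw_one)

lemma pair_moment_one_symmetric:
  assumes s: "s = 1 \<or> s = -1" and n: "nice2 \<Phi>" and sym: "\<And>x y. \<Phi> x y = \<Phi> y x"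
  shows "pair_moment s (\<lambda>z. 1) \<Phi> i k l
    = E2 (\<lambda>x y. \<Phi> x y * ((dK s x ^ i * dK s y ^ l + dK s y ^ i * dK s x ^ l) / 2) * cK s x y ^ k)"
proof -
  let ?F = "\<lambda>b b'. \<Phi> b b' * (dK s b ^ i * dK s b' ^ l) * cK s b b' ^ k"
  have nF: "nice2 ?F" by (intro kernel_nice nice_compose2[OF n]; simp)
  have "pair_moment s (\<lambda>z. 1) \<Phi> i k l = (E2 ?F + E2 (\<lambda>x y. ?F y x)) / 2"
    unfolding pair_moment_one[OF s] using E2_swap[OF nF] by simp
  also have "\<dots> = E2 (\<lambda>x y. (?F x y + ?F y x) / 2)"
    using E2_add[OF nF nice2_swap[OF nF]] by simp
  also have "(\<lambda>x y. (?F x y + ?F y x) / 2)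
      = (\<lambda>x y. \<Phi> x y * ((dK s x ^ i * dK s y ^ l + dK s y ^ i * dK s x ^ l) / 2) * cK s x y ^ k)"
  proof (intro ext)
    fix x y show "(?F x y + ?F y x) / 2
      = \<Phi> x y * ((dK s x ^ i * dK s y ^ l + dK s y ^ i * dK s x ^ l) / 2) * cK s x y ^ k"
      using sym[of y x] cK_sym[of s y x] by (simp add: algebra_simps add_divide_distrib)
  qed
  finally show ?thesis .
qed

text \<open>With \<open>h z = K s z y\<close> each vertex is joined to the apex \<open>y\<close>;
  integrating over \<open>y\<close> gives the density with one apex, weighted by \<Phi>.\<close>

definition hub_moment :: "real \<Rightarrow> ('a \<Rightarrow> 'a \<Rightarrow> real) \<Rightarrow> nat \<Rightarrow> nat \<Rightarrow> nat \<Rightarrow> real" where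
  "hub_moment s \<Phi> i k l = (\<integral>y. pair_moment s (\<lambda>z. K s z y) \<Phi> i k l \<partial>M)"

lemma nice_pair_moment_K:
  assumes "nice2 \<Phi>" shows "nice M (\<lambda>y. pair_moment s (\<lambda>z. K s z y) \<Phi> i k l)"
  unfolding pair_moment_def dKw_def cKw_def by (intro nice_integral kernel_nice nice_compose2[OF assms]; simp)

text \<open>\<open>hub\<close> is used for a fixed apex with a multiplier depending on the apex. The
  weighted degree of a centre becomes its codegree with the apex, the edge between them supplies
  \<open>K\<close>, and the integral of \<open>h\<close> is the degree of the apex. Only the pair of
  apex and one centre is left, and it is symmetrised at the end.\<close>

lemma hub_moment_ge:
  assumes s: "s = 1 \<or> s = -1" and w: "nice M w" "\<And>x. x \<in> space M \<Longrightarrow> 0 \<le> w x" and \<theta>: "nice M \<theta>"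
  shows "E2 (\<lambda>x y. (\<theta> x * w y + \<theta> y * w x) * (K s x y * (sqrt (cK s x y) ^ (i + l) * cK s x y ^ k))
      - (\<theta> x ^ 2 * dK s x ^ k + \<theta> y ^ 2 * dK s y ^ k) / 2) \<le> hub_moment s (\<lambda>b b'. w b * w b') i k l"
proof -
  note nice = kernel_nice nice_compose[OF \<theta>] nice_compose[OF w(1)] measurable_ident
  let ?T = "\<lambda>x y. K s x y * (sqrt (cK s x y) ^ (i + l) * cK s x y ^ k)"
  let ?F = "\<lambda>y b. 2 * \<theta> y * (w b * ?T y b) - \<theta> y ^ 2 * dK s y ^ k"
  have T: "?T x y = ?T y x" for x y by (simp only: K_sym[of s y] cK_sym[of s y])
  have nF: "nice2 ?F" by (intro nice; simp)
  have "E2 (\<lambda>x y. (\<theta> x * w y + \<theta> y * w x) * ?T x y - (\<theta> x ^ 2 * dK s x ^ k + \<theta> y ^ 2 * dK s y ^ k) / 2)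
      = E2 (\<lambda>x y. (?F x y + ?F y x) / 2)"
  proof (intro Bochner_Integration.integral_cong refl)
    fix x y
    show "(\<theta> x * w y + \<theta> y * w x) * ?T x y - (\<theta> x ^ 2 * dK s x ^ k + \<theta> y ^ 2 * dK s y ^ k) / 2 = (?F x y + ?F y x) / 2"
      unfolding T[of y x] by (simp add: field_simps)
  qed
  also have "\<dots> = (E2 ?F + E2 (\<lambda>x y. ?F y x)) / 2" using E2_add[OF nF nice2_swap[OF nF]] by simp
  also have "\<dots> = E2 ?F" using E2_swap[OF nF] by simp
  also have "\<dots> \<le> hub_moment s (\<lambda>b b'. w b * w b') i k l"
    unfolding hub_moment_def
  proof (rule integral_mono)
    show "integrable M (\<lambda>y. \<integral>b. ?F y b \<partial>M)" by (intro integrable_nice nice_integral nF)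
    show "integrable M (\<lambda>y. pair_moment s (\<lambda>z. K s z y) (\<lambda>b b'. w b * w b') i k l)"
      by (intro integrable_nice nice_pair_moment_K) (intro nice; simp)
    fix y assume y: "y \<in> space M"
    have "(\<integral>b. ?F y b \<partial>M) = (\<integral>b. 2 * \<theta> y * (w b * ?T y b) \<partial>M) - (\<integral>b. \<theta> y ^ 2 * dK s y ^ k \<partial>M)"
      by (intro Bochner_Integration.integral_diff integrable_nice nice) (simp_all add: y)
    also have "\<dots> = 2 * \<theta> y * (\<integral>b. w b * ?T y b \<partial>M) - \<theta> y ^ 2 * dK s y ^ k"
      by (simp add: prob_space)
    also have "(\<integral>b. w b * ?T y b \<partial>M)
        = (\<integral>b. w b * K s b y * (sqrt (dKw s (\<lambda>z. K s z y) b) ^ (i + l) * dKw s (\<lambda>z. K s z y) b ^ k) \<partial>M)"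
      using y s by (intro Bochner_Integration.integral_cong refl)
        (simp add: dKw_K K_sym[of s y] cK_sym[of s y])
    finally have eq: "(\<integral>b. ?F y b \<partial>M) = 2 * \<theta> y * (\<integral>b. w b * K s b y * (sqrt (dKw s (\<lambda>z. K s z y) b) ^ (i + l)
        * dKw s (\<lambda>z. K s z y) b ^ k) \<partial>M) - \<theta> y ^ 2 * dK s y ^ k" .
    have "dK s y = (\<integral>z. K s z y \<partial>M)" using integral_K[OF y, of s] by (simp add: K_sym[of s y])
    then show "(\<integral>b. ?F y b \<partial>M) \<le> pair_moment s (\<lambda>z. K s z y) (\<lambda>b b'. w b * w b') i k l"
      unfolding eq using hub[OF s _ _ w, of "\<lambda>z. K s z y" "\<theta> y" i l k] K_nonneg[OF s] y
      by (simp add: nice_K)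
  qed
  finally show ?thesis .
qed

lemma cod_sym: "cod x y = cod y x"
  by (simp add: cod_def mult.commute)

lemma integral_cod:
  assumes x: "x \<in> space M"
  shows "(\<integral>y. cod x y \<partial>M) = (\<integral>z. U x z * deg z \<partial>M)"
proof -
  have "(\<integral>y. cod x y \<partial>M) = (\<integral>z. \<integral>y. U x z * U y z \<partial>M \<partial>M)"
    unfolding cod_def by (rule E2_swap) (intro kernel_nice; simp add: x)
  also have "\<dots> = (\<integral>z. U x z * deg z \<partial>M)"
  proof -
    have "deg z = (\<integral>y. U y z \<partial>M)" for z by (simp only: deg_def U_sym[of z])
    then show ?thesis by simp
  qed
  finally show ?thesis .
qed

lemma E2_cod: "E2 (\<lambda>x y. f x * cod x y) = E2 (\<lambda>x y. f x * (U x y * deg y))"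
  by (rule Bochner_Integration.integral_cong[OF refl]) (simp add: integral_cod)

lemma E2_U_deg: "E2 (\<lambda>x y. U x y * deg x) = P"
  unfolding P_def by (simp add: deg_def power2_eq_square)

lemma E2_U_deg': "E2 (\<lambda>x y. U x y * deg y) = P"
  using E2_swap[of "\<lambda>x y. U x y * deg y"] E2_U_deg by (simp add: U_sym nice_mult nice_U nice_deg)

lemma E2_deg_square: "E2 (\<lambda>x y. (deg x)^2) = P" "E2 (\<lambda>x y. (deg y)^2) = P"
  by (simp_all add: P_def prob_space)

text \<open>Integrating out the second endpoint turns the codegree of \<open>x\<close> into an
  average of \<open>U x z * deg z\<close>, so E cod and E (U deg) both equal the second moment
  \<open>P\<close> of the degree. The third identity is the same exchange with the extra factor
  \<open>(deg x)^2\<close>.\<close>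

lemma E2_defects:
  "E2 (\<lambda>x y. ((deg x)^2 + (deg y)^2) / 2 - cod x y) = 0"
  "E2 (\<lambda>x y. (deg x)^2 + (deg y)^2 - U x y * (deg x + deg y)) = 0"
  "E2 (\<lambda>x y. cod x y * ((deg x)^2 + (deg y)^2) - U x y * deg x * deg y * (deg x + deg y)) = 0"
proof -
  note n = kernel_nice measurable_fst measurable_snd
  have nS: "nice2 (\<lambda>x y. (deg x)^2 + (deg y)^2)" by (intro n)
  have S: "E2 (\<lambda>x y. (deg x)^2 + (deg y)^2) = 2 * P"
    using E2_add[of "\<lambda>x y. (deg x)^2" "\<lambda>x y. (deg y)^2"] E2_deg_square by (simp add: n)
  have cod: "E2 cod = P" using E2_cod[of "\<lambda>x. 1"] E2_U_deg' by simp
  show "E2 (\<lambda>x y. ((deg x)^2 + (deg y)^2) / 2 - cod x y) = 0"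
    using E2_diff[of "\<lambda>x y. ((deg x)^2 + (deg y)^2) / 2" cod] S cod by (simp add: n)
  have UD: "E2 (\<lambda>x y. U x y * (deg x + deg y)) = 2 * P"
    using E2_add[of "\<lambda>x y. U x y * deg x" "\<lambda>x y. U x y * deg y"] E2_U_deg E2_U_deg' by (simp add: n distrib_left)
  show "E2 (\<lambda>x y. (deg x)^2 + (deg y)^2 - U x y * (deg x + deg y)) = 0"
    using E2_diff[OF nS, of "\<lambda>x y. U x y * (deg x + deg y)"] S UD by (simp add: n)
  have c1: "E2 (\<lambda>x y. (deg x)^2 * cod x y) = E2 (\<lambda>x y. (deg x)^2 * (U x y * deg y))" by (rule E2_cod)
  have "E2 (\<lambda>x y. (deg y)^2 * cod x y) = E2 (\<lambda>x y. (deg x)^2 * cod x y)"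
    using E2_swap[of "\<lambda>x y. (deg y)^2 * cod x y"] by (simp add: n cod_sym)
  also have "\<dots> = E2 (\<lambda>x y. (deg y)^2 * (U x y * deg x))"
    unfolding c1 using E2_swap[of "\<lambda>x y. (deg x)^2 * (U x y * deg y)"] by (simp add: n U_sym)
  finally have c2: "E2 (\<lambda>x y. (deg y)^2 * cod x y) = E2 (\<lambda>x y. (deg y)^2 * (U x y * deg x))" .
  have "E2 (\<lambda>x y. cod x y * ((deg x)^2 + (deg y)^2) - U x y * deg x * deg y * (deg x + deg y))
    = E2 (\<lambda>x y. ((deg x)^2 * cod x y + (deg y)^2 * cod x y) - ((deg x)^2 * (U x y * deg y) + (deg y)^2 * (U x y * deg x)))"
    by (intro Bochner_Integration.integral_cong refl) (simp add: power2_eq_square algebra_simps)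
  also have "\<dots> = 0"
  proof -
    have a: "nice2 (\<lambda>x y. (deg x)^2 * cod x y)" "nice2 (\<lambda>x y. (deg y)^2 * cod x y)"
      and b: "nice2 (\<lambda>x y. (deg x)^2 * (U x y * deg y))" "nice2 (\<lambda>x y. (deg y)^2 * (U x y * deg x))" by (intro n)+
    show ?thesis
      by (simp only: E2_diff[OF nice_add[OF a] nice_add[OF b]] E2_add[OF a] E2_add[OF b] c1 c2 diff_self)
  qed
  finally show "E2 (\<lambda>x y. cod x y * ((deg x)^2 + (deg y)^2) - U x y * deg x * deg y * (deg x + deg y)) = 0" .
qed
end

subsection \<open>The two inequalities required of a two-centre graph\<close>

context signed_kernel begin

text \<open>The functions multiplied by c1, c2, c3 have mean zero, so these multipliers can be chosen freely.\<close>
lemma hub_pointwise: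
  fixes \<theta> w :: "real \<Rightarrow> 'a \<Rightarrow> real" and G :: "real \<Rightarrow> 'a \<Rightarrow> 'a \<Rightarrow> real"
  defines "T \<equiv> \<lambda>i k l s x y. (\<theta> s x * w s y + \<theta> s y * w s x) * (K s x y * (sqrt (cK s x y) ^ (i + l) * cK s x y ^ k))
      - (\<theta> s x ^ 2 * dK s x ^ k + \<theta> s y ^ 2 * dK s y ^ k) / 2"
  assumes w: "\<And>s. nice M (w s)" "\<And>s x. x \<in> space M \<Longrightarrow> 0 \<le> w s x" and \<theta>: "\<And>s. nice M (\<theta> s)" and G: "\<And>s. nice2 (G s)"
    and pt: "\<And>x y. x \<in> space M \<Longrightarrow> y \<in> space M \<Longrightarrow>
      0 \<le> ((T i k l 1 x y - G 1 x y) + (T i k l (-1) x y - G (-1) x y)) / 2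
        + c1 * (((deg x)^2 + (deg y)^2) / 2 - cod x y) + c2 * ((deg x)^2 + (deg y)^2 - U x y * (deg x + deg y))
        + c3 * (cod x y * ((deg x)^2 + (deg y)^2) - U x y * deg x * deg y * (deg x + deg y))"
  shows "E2 (G 1) + E2 (G (-1)) \<le> hub_moment 1 (\<lambda>x y. w 1 x * w 1 y) i k l + hub_moment (-1) (\<lambda>x y. w (-1) x * w (-1) y) i k l"
proof -
  note n = kernel_nice measurable_fst measurable_snd nice_compose2[OF G] nice_compose[OF w(1)] nice_compose[OF \<theta>]
  let ?A = "\<lambda>x y. ((T i k l 1 x y - G 1 x y) + (T i k l (-1) x y - G (-1) x y)) / 2"
  let ?B1 = "\<lambda>x y. ((deg x)^2 + (deg y)^2) / 2 - cod x y"
  let ?B2 = "\<lambda>x y. (deg x)^2 + (deg y)^2 - U x y * (deg x + deg y)"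
  let ?B3 = "\<lambda>x y. cod x y * ((deg x)^2 + (deg y)^2) - U x y * deg x * deg y * (deg x + deg y)"
  have nT: "nice2 (T i k l s)" for s unfolding T_def by (intro n)
  have nG: "nice2 (G s)" for s by (rule G)
  have nA: "nice2 ?A" by (intro nice_intros nT nG)
  have nB: "nice2 (\<lambda>x y. c1 * ?B1 x y)" "nice2 (\<lambda>x y. c2 * ?B2 x y)" "nice2 (\<lambda>x y. c3 * ?B3 x y)" by (intro n)+
  have "0 = E2 (\<lambda>x y. 0)" by simp
  also have "\<dots> \<le> E2 (\<lambda>x y. ?A x y + c1 * ?B1 x y + c2 * ?B2 x y + c3 * ?B3 x y)"
    by (rule E2_mono) (intro nice_const, intro nice_add nA nB, rule pt)
  also have "\<dots> = E2 ?A + c1 * E2 ?B1 + c2 * E2 ?B2 + c3 * E2 ?B3"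
    by (simp only: E2_add[OF nice_add[OF nice_add[OF nA nB(1)] nB(2)] nB(3)] E2_add[OF nice_add[OF nA nB(1)] nB(2)] E2_add[OF nA nB(1)] E2_cmult)
  also have "\<dots> = E2 ?A" unfolding E2_defects by simp
  also have "\<dots> = ((E2 (T i k l 1) - E2 (G 1)) + (E2 (T i k l (-1)) - E2 (G (-1)))) / 2"
    by (simp only: E2_add[OF nice_diff[OF nT nG] nice_diff[OF nT nG]] E2_diff[OF nT nG] integral_divide_zero)
  finally have "E2 (G 1) + E2 (G (-1)) \<le> E2 (T i k l 1) + E2 (T i k l (-1))" by simp
  also have "\<dots> \<le> hub_moment 1 (\<lambda>x y. w 1 x * w 1 y) i k l + hub_moment (-1) (\<lambda>x y. w (-1) x * w (-1) y) i k l"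
    unfolding T_def by (intro add_mono hub_moment_ge w \<theta>) auto
  finally show ?thesis .
qed

lemma kernel_bounds:
  assumes "x \<in> space M" "y \<in> space M"
  shows "\<bar>U x y\<bar> \<le> 1" "\<bar>deg x\<bar> \<le> 1" "\<bar>deg y\<bar> \<le> 1" "cod x y \<le> 1"
    "0 \<le> 1 + 1 * (deg x + deg y) + cod x y" "0 \<le> 1 + (-1) * (deg x + deg y) + cod x y"
  using U_bound deg_bound[OF assms(1)] deg_bound[OF assms(2)] cod_bound[OF assms]
    cK_nonneg[OF assms, of 1] cK_nonneg[OF assms, of "-1"] unfolding cK_def by auto

text \<open>The power \<open>q\<close> of the codegree is replaced by its tangent at 1. Summed over
  the colours, only terms even in \<open>s\<close> survive: the constant, the codegree, and the
  product of U with the degree sum.\<close>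

lemma tangent_terms:
  assumes "x \<in> space M" "y \<in> space M" "1 \<le> k" "i + k + l \<le> 3"
  defines "q \<equiv> real k + real (i + l) / 2"
  shows "2 + 2 * q * (cod x y + U x y * (deg x + deg y))
    \<le> K 1 x y * (sqrt (cK 1 x y) ^ (i + l) * cK 1 x y ^ k) + K (-1) x y * (sqrt (cK (-1) x y) ^ (i + l) * cK (-1) x y ^ k)"
proof -
  have *: "K s x y * (1 + q * (cK s x y - 1)) \<le> K s x y * (sqrt (cK s x y) ^ (i + l) * cK s x y ^ k)" if s: "s = 1 \<or> s = -1" for s
  proof (rule mult_left_mono)
    have c: "0 \<le> cK s x y" using cK_nonneg assms s by auto
    have "cK s x y ^ k = sqrt (cK s x y) ^ (2 * k)" using c by (simp add: power_mult)
    then have "sqrt (cK s x y) ^ (i + l) * cK s x y ^ k = sqrt (cK s x y) ^ (i + l + 2 * k)" by (simp add: power_add)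
    moreover have "1 + real (i + l + 2 * k) / 2 * (cK s x y - 1) \<le> sqrt (cK s x y) ^ (i + l + 2 * k)"
      using assms by (intro half_power_ge_tangent c) auto
    moreover have "real (i + l + 2 * k) / 2 = q" by (simp add: q_def)
    ultimately show "1 + q * (cK s x y - 1) \<le> sqrt (cK s x y) ^ (i + l) * cK s x y ^ k" by simp
  qed (use K_nonneg s in auto)
  have "2 + 2 * q * (cod x y + U x y * (deg x + deg y))
    = K 1 x y * (1 + q * (cK 1 x y - 1)) + K (-1) x y * (1 + q * (cK (-1) x y - 1))"
    by (simp add: K_def cK_def algebra_simps)
  then show ?thesis using *[of 1] *[of "-1"] by linarith
qed

text \<open>The case of a single apex, with weight and multiplier 1. The multiples
  \<open>2 * q\<close> cancel the codegree and U terms of the tangent and leave \<open>3 * q\<close>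
  times the squared degrees, more than the degree powers of the apex consume.\<close>

lemma hub_moment_one_ge:
  assumes "1 \<le> k" "i + k + l \<le> 3"
  shows "2 \<le> hub_moment 1 (\<lambda>_ _. 1) i k l + hub_moment (-1) (\<lambda>_ _. 1) i k l"
proof -
  define q where "q = real k + real (i + l) / 2"
  have q: "1 \<le> q" using assms(1) unfolding q_def by linarith
  have "E2 (\<lambda>_ _. 1) + E2 (\<lambda>_ _. 1) \<le> hub_moment 1 (\<lambda>x y. 1 * 1) i k l + hub_moment (-1) (\<lambda>x y. 1 * 1) i k l"
  proof (rule hub_pointwise[where \<theta> = "\<lambda>_ _. 1" and w = "\<lambda>_ _. 1" and G = "\<lambda>_ _ _. 1" and ?c1.0 = "2 * q" and ?c2.0 = "2 * q" and ?c3.0 = 0])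
    fix x y assume xy: "x \<in> space M" "y \<in> space M"
    let ?t = "\<lambda>s. K s x y * (sqrt (cK s x y) ^ (i + l) * cK s x y ^ k)"
    have t: "2 + 2 * q * (cod x y + U x y * (deg x + deg y)) \<le> ?t 1 + ?t (-1)"
      unfolding q_def by (rule tangent_terms) (use xy assms in auto)
    have m: "(dK 1 z ^ k + dK (-1) z ^ k) / 2 \<le> 1 + 3 * (deg z)^2" if "z \<in> space M" for z
    proof -
      have "((1 + deg z)^k + (1 - deg z)^k) / 2
          \<le> 1 + (if k \<le> 1 then 0 else if k = 2 then 1 else if k = 3 then 3 else 7) * (deg z)^2"
        using deg_bound[OF that] assms by (intro even_power_average_le) auto
      also have "\<dots> \<le> 1 + 3 * (deg z)^2" using assms by (intro add_left_mono mult_right_mono) auto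
      finally show ?thesis by (simp add: dK_def)
    qed
    have S: "3/2 * ((deg x)^2 + (deg y)^2) \<le> 3 * q * ((deg x)^2 + (deg y)^2)"
      using q by (intro mult_right_mono) auto
    have e: "((1 * 1 + 1 * 1) * ?t 1 - (1^2 * dK 1 x ^ k + 1^2 * dK 1 y ^ k) / 2 - 1
        + ((1 * 1 + 1 * 1) * ?t (-1) - (1^2 * dK (-1) x ^ k + 1^2 * dK (-1) y ^ k) / 2 - 1)) / 2
        + 2 * q * (((deg x)\<^sup>2 + (deg y)\<^sup>2) / 2 - cod x y) + 2 * q * ((deg x)\<^sup>2 + (deg y)\<^sup>2 - U x y * (deg x + deg y)) +
           0 * (cod x y * ((deg x)\<^sup>2 + (deg y)\<^sup>2) - U x y * deg x * deg y * (deg x + deg y))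
       = (?t 1 + ?t (-1)) - (2 + 2 * q * (cod x y + U x y * (deg x + deg y))) + 1
        - ((dK 1 x ^ k + dK (-1) x ^ k) / 2 + (dK 1 y ^ k + dK (-1) y ^ k) / 2) / 2 + 3 * q * ((deg x)^2 + (deg y)^2)"
      by (simp add: field_simps)
    show "0 \<le> ((1 * 1 + 1 * 1) * ?t 1 - (1^2 * dK 1 x ^ k + 1^2 * dK 1 y ^ k) / 2 - 1
        + ((1 * 1 + 1 * 1) * ?t (-1) - (1^2 * dK (-1) x ^ k + 1^2 * dK (-1) y ^ k) / 2 - 1)) / 2
        + 2 * q * (((deg x)\<^sup>2 + (deg y)\<^sup>2) / 2 - cod x y) + 2 * q * ((deg x)\<^sup>2 + (deg y)\<^sup>2 - U x y * (deg x + deg y)) +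
           0 * (cod x y * ((deg x)\<^sup>2 + (deg y)\<^sup>2) - U x y * deg x * deg y * (deg x + deg y))"
      unfolding e using t m[OF xy(1)] m[OF xy(2)] S by argo
  qed (auto intro: nice_const)
  then show ?thesis by (simp add: prob_space)
qed

text \<open>The gain available when a second apex is added: the linearised form of E (f (D^2 - D)),
  summed over both colours, with weight \<Omega> on the centres.\<close>

definition increment :: "(real \<Rightarrow> 'a \<Rightarrow> 'a \<Rightarrow> real) \<Rightarrow> nat \<Rightarrow> nat \<Rightarrow> nat \<Rightarrow> real" where
  "increment \<Omega> i k l = (hub_moment 1 (\<Omega> 1) i k l + hub_moment (-1) (\<Omega> (-1)) i k l)
     - (pair_moment 1 (\<lambda>_. 1) (\<lambda>x y. ((\<Omega> 1 x y + 1) / 2)^2) i k l + pair_moment (-1) (\<lambda>_. 1) (\<lambda>x y. ((\<Omega> (-1) x y + 1) / 2)^2) i k l)"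

lemma increment_nonneg:
  fixes \<theta> w :: "real \<Rightarrow> 'a \<Rightarrow> real"
  defines "F \<equiv> \<lambda>i k l s x y. (\<theta> s x * w s y + \<theta> s y * w s x) * (K s x y * (sqrt (cK s x y) ^ (i + l) * cK s x y ^ k))
      - (\<theta> s x ^ 2 * dK s x ^ k + \<theta> s y ^ 2 * dK s y ^ k) / 2
      - ((w s x * w s y + 1) / 2)^2 * ((dK s x ^ i * dK s y ^ l + dK s y ^ i * dK s x ^ l) / 2) * cK s x y ^ k"
  assumes w: "\<And>s. nice M (w s)" "\<And>s x. x \<in> space M \<Longrightarrow> 0 \<le> w s x" and \<theta>: "\<And>s. nice M (\<theta> s)"
    and pt: "\<And>x y. x \<in> space M \<Longrightarrow> y \<in> space M \<Longrightarrow>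
      0 \<le> (F i k l 1 x y + F i k l (-1) x y) / 2
        + c1 * (((deg x)^2 + (deg y)^2) / 2 - cod x y) + c2 * ((deg x)^2 + (deg y)^2 - U x y * (deg x + deg y))
        + c3 * (cod x y * ((deg x)^2 + (deg y)^2) - U x y * deg x * deg y * (deg x + deg y))"
  shows "0 \<le> increment (\<lambda>s x y. w s x * w s y) i k l"
proof -
  note n = kernel_nice measurable_fst measurable_snd nice_compose[OF w(1)]
  let ?O = "\<lambda>s x y. ((w s x * w s y + 1) / 2)^2"
  let ?G = "\<lambda>s x y. ?O s x y * ((dK s x ^ i * dK s y ^ l + dK s y ^ i * dK s x ^ l) / 2) * cK s x y ^ k"
  have nO: "nice2 (?O s)" for s by (intro n)
  have z: "pair_moment s (\<lambda>_. 1) (?O s) i k l = E2 (?G s)" if "s = 1 \<or> s = -1" for s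
    by (rule pair_moment_one_symmetric[OF that nO]) (simp only: mult.commute)
  have "E2 (?G 1) + E2 (?G (-1)) \<le> hub_moment 1 (\<lambda>x y. w 1 x * w 1 y) i k l + hub_moment (-1) (\<lambda>x y. w (-1) x * w (-1) y) i k l"
  proof (rule hub_pointwise[where \<theta> = \<theta> and w = w and G = ?G and ?c1.0 = c1 and ?c2.0 = c2 and ?c3.0 = c3])
    show "nice2 (?G s)" for s by (intro n)
  qed (use w \<theta> pt[unfolded F_def] in blast)+
  then show ?thesis unfolding increment_def z[OF disjI1[OF refl]] z[OF disjI2[OF refl]] by (simp only: diff_ge_0_iff_ge)
qed

lemma increment_nonneg_k23: "0 \<le> increment (\<lambda>s x y. exp (- (6/5 * (s * deg x))) * exp (- (6/5 * (s * deg y)))) 0 3 0"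
proof -
  let ?w = "\<lambda>s x. exp (- (6/5 * (s * deg x)))"
  let ?F = "\<lambda>s x y. (?w s x * ?w s y + ?w s y * ?w s x) * (K s x y * (sqrt (cK s x y) ^ (0 + 0) * cK s x y ^ 3))
      - (?w s x ^ 2 * dK s x ^ 3 + ?w s y ^ 2 * dK s y ^ 3) / 2
      - ((?w s x * ?w s y + 1) / 2)^2 * ((dK s x ^ 0 * dK s y ^ 0 + dK s y ^ 0 * dK s x ^ 0) / 2) * cK s x y ^ 3"
  have F: "?F s x y = 2 * (?w s x * ?w s y) * ((1 + s * U x y) * (1 + s * (deg x + deg y) + cod x y)^3)
     - ((?w s x)^2 * (1 + s * deg x)^3 + (?w s y)^2 * (1 + s * deg y)^3) / 2
     - ((?w s x * ?w s y + 1)/2)^2 * (1 + s * (deg x + deg y) + cod x y)^3" for s x y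
    unfolding K_def dK_def cK_def by (simp add: mult_ac)
  show ?thesis
  proof (rule increment_nonneg[where \<theta> = ?w and ?c1.0 = 3 and ?c2.0 = "18/5" and ?c3.0 = "1/2"])
    show "nice M (?w s)" for s by (intro kernel_nice measurable_ident_sets refl)
    then show "nice M (?w s)" for s .
    fix x y assume xy: "x \<in> space M" "y \<in> space M"
    show "0 \<le> (?F 1 x y + ?F (-1) x y) / 2 + 3 * (((deg x)\<^sup>2 + (deg y)\<^sup>2) / 2 - cod x y)
      + 18/5 * ((deg x)\<^sup>2 + (deg y)\<^sup>2 - U x y * (deg x + deg y))
      + 1/2 * (cod x y * ((deg x)\<^sup>2 + (deg y)\<^sup>2) - U x y * deg x * deg y * (deg x + deg y))"
      unfolding F using k23_pointwise[OF kernel_bounds[OF xy]] by simp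
  qed auto
qed

lemma increment_nonneg_pendant:
  assumes "i + l = 1"
  shows "0 \<le> increment (\<lambda>s x y. exp (- (s * deg x / 2)) * exp (- (s * deg y / 2))) i 2 l"
proof -
  let ?w = "\<lambda>s x. exp (- (s * deg x / 2))"
  let ?F = "\<lambda>s x y. (?w s x * ?w s y + ?w s y * ?w s x) * (K s x y * (sqrt (cK s x y) ^ (i + l) * cK s x y ^ 2))
      - (?w s x ^ 2 * dK s x ^ 2 + ?w s y ^ 2 * dK s y ^ 2) / 2
      - ((?w s x * ?w s y + 1) / 2)^2 * ((dK s x ^ i * dK s y ^ l + dK s y ^ i * dK s x ^ l) / 2) * cK s x y ^ 2"
  have il: "(i = 1 \<and> l = 0) \<or> (i = 0 \<and> l = 1)" using assms by arith
  \<comment> \<open>Averaging over the two possible centres of the pendant vertex makes the cost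
    depend on the degree sum alone.\<close>
  have d: "(dK s x ^ i * dK s y ^ l + dK s y ^ i * dK s x ^ l) / 2 = 1 + s * (deg x + deg y) / 2" for s x y
    using il by (elim disjE) (auto simp: dK_def field_simps)
  have F: "?F s x y = 2 * (?w s x * ?w s y) * ((1 + s * U x y) * (sqrt (1 + s * (deg x + deg y) + cod x y) * (1 + s * (deg x + deg y) + cod x y)^2))
     - ((?w s x)^2 * (1 + s * deg x)^2 + (?w s y)^2 * (1 + s * deg y)^2) / 2
     - ((?w s x * ?w s y + 1)/2)^2 * ((1 + s * (deg x + deg y) + cod x y)^2 * (1 + s * (deg x + deg y) / 2))" for s x y
    unfolding d assms power_one_right unfolding K_def dK_def cK_def by (simp add: mult_ac)
  show ?thesis
  proof (rule increment_nonneg[where \<theta> = ?w and ?c1.0 = 3 and ?c2.0 = 4 and ?c3.0 = 0])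
    show "nice M (?w s)" for s by (intro kernel_nice measurable_ident_sets refl)
    then show "nice M (?w s)" for s .
    fix x y assume xy: "x \<in> space M" "y \<in> space M"
    show "0 \<le> (?F 1 x y + ?F (-1) x y) / 2 + 3 * (((deg x)\<^sup>2 + (deg y)\<^sup>2) / 2 - cod x y)
      + 4 * ((deg x)\<^sup>2 + (deg y)\<^sup>2 - U x y * (deg x + deg y))
      + 0 * (cod x y * ((deg x)\<^sup>2 + (deg y)\<^sup>2) - U x y * deg x * deg y * (deg x + deg y))"
      unfolding F using pendant_pointwise[OF kernel_bounds[OF xy]] by simp
  qed auto
qed

text \<open>The only case in which weight and multiplier differ: the weight is 1, the multiplier is
  linear in the degree of the apex.\<close>

lemma increment_nonneg_c4: "0 \<le> increment (\<lambda>s x y. 1 * 1) 0 2 0"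
proof -
  let ?w = "\<lambda>s x. 1 - 2/3 * (s * deg x)"
  let ?F = "\<lambda>s x y. (?w s x * 1 + ?w s y * 1) * (K s x y * (sqrt (cK s x y) ^ (0 + 0) * cK s x y ^ 2))
      - (?w s x ^ 2 * dK s x ^ 2 + ?w s y ^ 2 * dK s y ^ 2) / 2
      - ((1 * 1 + 1) / 2)^2 * ((dK s x ^ 0 * dK s y ^ 0 + dK s y ^ 0 * dK s x ^ 0) / 2) * cK s x y ^ 2"
  have F: "?F s x y = (?w s x + ?w s y) * ((1 + s * U x y) * (1 + s * (deg x + deg y) + cod x y)^2)
     - ((?w s x)^2 * (1 + s * deg x)^2 + (?w s y)^2 * (1 + s * deg y)^2) / 2
     - (1 + s * (deg x + deg y) + cod x y)^2" for s x y
    unfolding K_def dK_def cK_def by simp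
  show ?thesis
  proof (rule increment_nonneg[where \<theta> = ?w and w = "\<lambda>_ _. 1" and ?c1.0 = 2 and ?c2.0 = "10/3" and ?c3.0 = 0])
    show "nice M (?w s)" for s by (intro kernel_nice measurable_ident_sets refl)
    fix x y assume xy: "x \<in> space M" "y \<in> space M"
    show "0 \<le> (?F 1 x y + ?F (-1) x y) / 2 + 2 * (((deg x)\<^sup>2 + (deg y)\<^sup>2) / 2 - cod x y)
      + 10/3 * ((deg x)\<^sup>2 + (deg y)\<^sup>2 - U x y * (deg x + deg y))
      + 0 * (cod x y * ((deg x)\<^sup>2 + (deg y)\<^sup>2) - U x y * deg x * deg y * (deg x + deg y))"
      unfolding F using c4_pointwise[OF kernel_bounds[OF xy]] by simp
  qed (auto intro: nice_const)
qed

lemma increment_nonneg_tree: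
  assumes il: "i + l \<le> 2"
  shows "0 \<le> increment (\<lambda>s x y. 1 * 1) i 1 l"
proof -
  define q where "q = 1 + real (i + l) / 2"
  show ?thesis
  \<comment> \<open>The multiple is \<open>2 * q - 1\<close> because the apex-free cost itself
    contains one codegree, by \<open>tree_term_le\<close>, which is subtracted again.\<close>
  proof (rule increment_nonneg[where \<theta> = "\<lambda>_ _. 1" and w = "\<lambda>_ _. 1" and ?c1.0 = "2 * q - 1" and ?c2.0 = "2 * q" and ?c3.0 = 0])
    fix x y assume xy: "x \<in> space M" "y \<in> space M"
    let ?t = "\<lambda>s. K s x y * (sqrt (cK s x y) ^ (i + l) * cK s x y ^ 1)"
    let ?v = "\<lambda>s x y. dK s x ^ i * dK s y ^ l * cK s x y"
    let ?F = "\<lambda>s. (1 * 1 + 1 * 1) * ?t s - (1^2 * dK s x ^ 1 + 1^2 * dK s y ^ 1) / 2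
      - ((1 * 1 + 1) / 2)^2 * ((dK s x ^ i * dK s y ^ l + dK s y ^ i * dK s x ^ l) / 2) * cK s x y ^ 1"
    have t: "2 + 2 * q * (cod x y + U x y * (deg x + deg y)) \<le> ?t 1 + ?t (-1)"
      using tangent_terms[OF xy, of 1 i l] il by (simp add: q_def)
    have v: "(?v 1 x y + ?v (-1) x y) / 2 \<le> 1 + cod x y + 5/2 * real (i + l) * ((deg x)^2 + (deg y)^2)"
      if "x \<in> space M" "y \<in> space M" for x y
    proof -
      have "dK 1 z = 1 + deg z" "dK (-1) z = 1 - deg z" "cK 1 x y = 1 + (deg x + deg y) + cod x y"
        "cK (-1) x y = 1 - (deg x + deg y) + cod x y" for z by (simp_all add: dK_def cK_def)
      then show ?thesis
        using tree_term_le[OF il deg_bound[OF that(1)] deg_bound[OF that(2)] cod_bound[OF that]] by simp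
    qed
    have F: "?F s = 2 * ?t s - (dK s x + dK s y) / 2 - (?v s x y + ?v s y x) / 2" for s
      using cK_sym[of s y x] by (simp add: algebra_simps add_divide_distrib)
    have d: "dK 1 x + dK (-1) x = 2" "dK 1 y + dK (-1) y = 2" by (simp_all add: dK_def)
    have S: "5/2 * real (i + l) * ((deg x)^2 + (deg y)^2) \<le> (3 * q - 1/2) * ((deg x)^2 + (deg y)^2)"
    proof (rule mult_right_mono)
      have "real (i + l) \<le> 2" using il by linarith
      then show "5/2 * real (i + l) \<le> 3 * q - 1/2" unfolding q_def by argo
    qed simp
    have e: "(2 * q - 1) * (((deg x)\<^sup>2 + (deg y)\<^sup>2) / 2 - cod x y) + 2 * q * ((deg x)\<^sup>2 + (deg y)\<^sup>2 - U x y * (deg x + deg y))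
      = (3 * q - 1/2) * ((deg x)^2 + (deg y)^2) - 2 * q * (cod x y + U x y * (deg x + deg y)) + cod x y"
      by (simp add: field_simps)
    have "0 \<le> (?F 1 + ?F (-1)) / 2 + ((2 * q - 1) * (((deg x)\<^sup>2 + (deg y)\<^sup>2) / 2 - cod x y)
      + 2 * q * ((deg x)\<^sup>2 + (deg y)\<^sup>2 - U x y * (deg x + deg y)))"
      unfolding F e using t v[OF xy] v[OF xy(2,1)] d S cod_sym[of y x] by argo
    then show "0 \<le> (?F 1 + ?F (-1)) / 2 + (2 * q - 1) * (((deg x)\<^sup>2 + (deg y)\<^sup>2) / 2 - cod x y)
      + 2 * q * ((deg x)\<^sup>2 + (deg y)\<^sup>2 - U x y * (deg x + deg y))
      + 0 * (cod x y * ((deg x)\<^sup>2 + (deg y)\<^sup>2) - U x y * deg x * deg y * (deg x + deg y))" by (simp only: mult_zero_left add_0_right add.assoc)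
  qed (auto intro: nice_const)
qed

text \<open>At most three vertices lie outside the centres. One common neighbour gives a tree; two
  give the four-cycle, with or without a pendant edge; three give K(2,3).\<close>

lemma increment_nonneg_exists:
  assumes "1 \<le> k" "i + k + l \<le> 3"
  obtains \<Omega> where "\<And>s. nice2 (\<Omega> s)" "0 \<le> increment \<Omega> i k l"
proof -
  consider "k = 1" "i + l \<le> 2" | "k = 2" "i = 0" "l = 0" | "k = 2" "i + l = 1" | "k = 3" "i = 0" "l = 0"
    using assms by linarith
  then show ?thesis
  proof cases
    case 1
    show ?thesis
      by (rule that[of "\<lambda>s x y. 1 * 1"]) (use 1 increment_nonneg_tree[of i l] in \<open>auto intro: nice_const\<close>)
  next
    case 2
    show ?thesis
      by (rule that[of "\<lambda>s x y. 1 * 1"]) (use 2 increment_nonneg_c4 in \<open>auto intro: nice_const\<close>)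
  next
    case 3
    show ?thesis
    proof (rule that)
      show "0 \<le> increment (\<lambda>s x y. exp (- (s * deg x / 2)) * exp (- (s * deg y / 2))) i k l"
        unfolding 3(1) by (rule increment_nonneg_pendant[OF 3(2)])
    qed (intro kernel_nice measurable_fst measurable_snd)
  next
    case 4
    show ?thesis
    proof (rule that)
      show "0 \<le> increment (\<lambda>s x y. exp (- (6/5 * (s * deg x))) * exp (- (6/5 * (s * deg y)))) i k l"
        unfolding 4 by (rule increment_nonneg_k23)
    qed (intro kernel_nice measurable_fst measurable_snd)
  qed
qed

text \<open>For a star with \<open>k\<close> leaves the weight 1 suffices, and
  \<open>2 + 6 * k * P\<close> separates the two sides: Bernoulli bounds the density with apex from
  below, and the even part of the binomial expansion bounds the density without apex from above. For
  \<open>k = 0\<close> this is the single vertex.\<close>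

lemma star_inequalities:
  assumes "k \<le> 4"
  defines "e \<equiv> \<lambda>s. E2 (\<lambda>y b. K s b y * cK s b y ^ k)" and "f \<equiv> \<lambda>s. \<integral>b. dK s b ^ k \<partial>M"
  shows "2 \<le> e 1 + e (-1)" "f 1 + f (-1) \<le> e 1 + e (-1)"
proof -
  note n = kernel_nice measurable_fst measurable_snd
  have P: "0 \<le> P" unfolding P_def by simp
  have nT: "nice2 (\<lambda>y b. K s b y * cK s b y ^ k)" for s by (intro n)
  let ?B1 = "\<lambda>x y. ((deg x)^2 + (deg y)^2) / 2 - cod x y"
  let ?B2 = "\<lambda>x y. (deg x)^2 + (deg y)^2 - U x y * (deg x + deg y)"
  have S: "E2 (\<lambda>x y. (deg x)^2 + (deg y)^2) = 2 * P"
    using E2_add[of "\<lambda>x y. (deg x)^2" "\<lambda>x y. (deg y)^2"] E2_deg_square by (simp add: n)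
  have nB: "nice2 ?B1" "nice2 ?B2" "nice2 (\<lambda>x y. (deg x)^2 + (deg y)^2)" by (intro n)+
  \<comment> \<open>This is the tangent bound 2 + 2 k (cod + U (deg x + deg y)) rewritten so that
    its mean can be read off: the subtracted functions have mean zero.\<close>
  let ?R = "\<lambda>x y. 2 + (3 * real k * ((deg x)^2 + (deg y)^2) - (2 * real k * ?B1 x y + 2 * real k * ?B2 x y))"
  have "E2 ?R = 2 + (3 * real k * (2 * P) - (2 * real k * 0 + 2 * real k * 0))"
  proof -
    have n1: "nice2 (\<lambda>x y. 2 * real k * ?B1 x y)" "nice2 (\<lambda>x y. 2 * real k * ?B2 x y)"
      and n2: "nice2 (\<lambda>x y. 3 * real k * ((deg x)^2 + (deg y)^2))" and n3: "nice2 (\<lambda>x y. 2)" by (intro n nB)+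
    show ?thesis
      unfolding E2_add[OF n3 nice_diff[OF n2 nice_add[OF n1]]] E2_diff[OF n2 nice_add[OF n1]] E2_add[OF n1] E2_cmult E2_defects S
      by (simp add: prob_space)
  qed
  moreover have "E2 ?R \<le> E2 (\<lambda>y b. K 1 b y * cK 1 b y ^ k + K (-1) b y * cK (-1) b y ^ k)"
  proof (rule E2_mono)
    fix y b assume yb: "y \<in> space M" "b \<in> space M"
    have *: "K s b y * (1 + real k * (cK s b y - 1)) \<le> K s b y * cK s b y ^ k" if "s = 1 \<or> s = -1" for s
      using Bernoulli_inequality[of "cK s b y - 1" k] cK_nonneg[OF yb(2,1) that] K_nonneg[OF that]
      by (intro mult_left_mono) auto
    have "?R y b = K 1 b y * (1 + real k * (cK 1 b y - 1)) + K (-1) b y * (1 + real k * (cK (-1) b y - 1))"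
      unfolding K_def cK_def cod_sym[of b y] U_sym[of b y] by (simp add: field_simps)
    then show "?R y b \<le> K 1 b y * cK 1 b y ^ k + K (-1) b y * cK (-1) b y ^ k" using *[of 1] *[of "-1"] by linarith
  qed (intro n)+
  moreover have "E2 (\<lambda>y b. K 1 b y * cK 1 b y ^ k + K (-1) b y * cK (-1) b y ^ k) = e 1 + e (-1)"
    unfolding e_def by (rule E2_add[OF nT nT])
  ultimately have e: "2 + 6 * real k * P \<le> e 1 + e (-1)" by simp
  have "0 \<le> 6 * real k * P" using P by simp
  with e show "2 \<le> e 1 + e (-1)" by linarith
  have ni: "nice M (\<lambda>b. dK s b ^ k)" "nice M (\<lambda>b. (deg b)^2)" for s by (intro n measurable_ident_sets refl)+
  have "f 1 + f (-1) = (\<integral>b. dK 1 b ^ k + dK (-1) b ^ k \<partial>M)"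
    unfolding f_def by (rule Bochner_Integration.integral_add[symmetric]) (intro integrable_nice ni)+
  also have "\<dots> \<le> (\<integral>b. 2 + 6 * real k * (deg b)^2 \<partial>M)"
  proof (rule integral_mono)
    fix b assume b: "b \<in> space M"
    have "((1 + deg b)^k + (1 - deg b)^k) / 2
          \<le> 1 + (if k \<le> 1 then 0 else if k = 2 then 1 else if k = 3 then 3 else 7) * (deg b)^2"
        using deg_bound[OF b] assms(1) by (intro even_power_average_le) auto
    also have "\<dots> \<le> 1 + 3 * real k * (deg b)^2" using assms(1) by (intro add_left_mono mult_right_mono) auto
    finally show "dK 1 b ^ k + dK (-1) b ^ k \<le> 2 + 6 * real k * (deg b)^2" by (simp add: dK_def)
  qed (intro integrable_nice nice_intros ni)+
  also have "\<dots> = 2 + 6 * real k * P"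
    unfolding P_def by (subst Bochner_Integration.integral_add) (auto simp: prob_space intro!: integrable_nice ni nice_intros)
  finally show "f 1 + f (-1) \<le> e 1 + e (-1)" using e by linarith
qed
end

subsection \<open>Integrals over copies of stars and two-centre graphs\<close>

context signed_kernel begin

abbreviation PM :: "nat set \<Rightarrow> (nat \<Rightarrow> 'a) measure" where "PM I \<equiv> Pi\<^sub>M I (\<lambda>_. M)"

lemma prob_space_PM: "prob_space (PM I)"
  by (intro prob_space_PiM prob_space_axioms)

lemma integrable_nice_PM: "nice (PM I) F \<Longrightarrow> integrable (PM I) F"
  by (rule prob_space.integrable_nice[OF prob_space_PM])

lemma component_PM: "u \<in> I \<Longrightarrow> (\<lambda>x. x u) \<in> measurable (PM I) M"
  by (rule measurable_component_singleton)

lemma component_space: "x \<in> space (PM I) \<Longrightarrow> u \<in> I \<Longrightarrow> x u \<in> space M"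
  by (auto simp: space_PiM PiE_def Pi_def)

text \<open>Given the points placed at \<open>I\<close>, the points at \<open>J\<close> are
  independent, so the inner integral of a product splits into factors.\<close>

lemma integral_PM_fold:
  assumes fin: "finite I" "finite J" "I \<inter> J = {}" and F: "nice (PM (I \<union> J)) F"
    and eq: "\<And>x y. x \<in> space (PM I) \<Longrightarrow> y \<in> space (PM J) \<Longrightarrow> F (merge I J (x, y)) = \<Phi> x * (\<Prod>j\<in>J. g j x (y j))"
    and g: "\<And>j x. j \<in> J \<Longrightarrow> x \<in> space (PM I) \<Longrightarrow> nice M (g j x)"
  shows "(\<integral>x. F x \<partial>PM (I \<union> J)) = (\<integral>x. \<Phi> x * (\<Prod>j\<in>J. \<integral>t. g j x t \<partial>M) \<partial>PM I)"
proof -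
  interpret Q: product_prob_space "\<lambda>_::nat. M" UNIV by (unfold_locales)
  have "(\<integral>x. F x \<partial>PM (I \<union> J)) = (\<integral>x. \<integral>y. F (merge I J (x, y)) \<partial>PM J \<partial>PM I)"
    using fin F by (intro Q.product_integral_fold integrable_nice_PM)
  also have "\<dots> = (\<integral>x. \<Phi> x * (\<Prod>j\<in>J. \<integral>t. g j x t \<partial>M) \<partial>PM I)"
  proof (rule Bochner_Integration.integral_cong[OF refl])
    fix x assume x: "x \<in> space (PM I)"
    have "(\<integral>y. F (merge I J (x, y)) \<partial>PM J) = (\<integral>y. \<Phi> x * (\<Prod>j\<in>J. g j x (y j)) \<partial>PM J)"
      using eq[OF x] by (intro Bochner_Integration.integral_cong refl)
    also have "\<dots> = \<Phi> x * (\<integral>y. (\<Prod>j\<in>J. g j x (y j)) \<partial>PM J)" by simp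
    also have "(\<integral>y. (\<Prod>j\<in>J. g j x (y j)) \<partial>PM J) = (\<Prod>j\<in>J. \<integral>t. g j x t \<partial>M)"
      using fin(2) g[OF _ x] by (intro Q.product_integral_prod integrable_nice)
    finally show "(\<integral>y. F (merge I J (x, y)) \<partial>PM J) = \<Phi> x * (\<Prod>j\<in>J. \<integral>t. g j x t \<partial>M)" .
  qed
  finally show ?thesis .
qed

lemma integral_PM_singleton: "nice M f \<Longrightarrow> (\<integral>x. f (x b) \<partial>PM {b}) = (\<integral>t. f t \<partial>M)"
proof -
  assume "nice M f"
  interpret Q: product_prob_space "\<lambda>_::nat. M" UNIV by (unfold_locales)
  show ?thesis by (rule Q.product_integral_singleton) (rule nice_measurable[OF \<open>nice M f\<close>])
qed

lemma integral_PM_pair: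
  assumes "b \<noteq> b'" "nice2 F"
  shows "(\<integral>x. F (x b) (x b') \<partial>PM {b, b'}) = E2 F"
proof -
  have "(\<integral>x. F (x b) (x b') \<partial>PM ({b} \<union> {b'})) = (\<integral>x. 1 * (\<Prod>j\<in>{b'}. \<integral>t. F (x b) t \<partial>M) \<partial>PM {b})"
    using assms(1)
    by (intro integral_PM_fold)
      (auto simp: component_space intro!: nice_compose2[OF assms(2)] component_PM)
  also have "\<dots> = (\<integral>x. (\<lambda>c. \<integral>t. F c t \<partial>M) (x b) \<partial>PM {b})" by simp
  also have "\<dots> = E2 F" by (rule integral_PM_singleton[OF nice_integral[OF assms(2)]])
  finally show ?thesis by (simp add: insert_commute)
qed

lemma integral_star:
  assumes V: "finite V" "b \<notin> V" and h: "nice M h"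
  shows "(\<integral>x. (\<Prod>z\<in>V. K s (x b) (x z)) * (\<Prod>u\<in>insert b V. h (x u)) \<partial>PM (insert b V)) = (\<integral>c. h c * dKw s h c ^ card V \<partial>M)"
proof -
  have "(\<integral>x. (\<Prod>z\<in>V. K s (x b) (x z)) * (\<Prod>u\<in>insert b V. h (x u)) \<partial>PM ({b} \<union> V))
     = (\<integral>x. h (x b) * (\<Prod>z\<in>V. \<integral>t. K s (x b) t * h t \<partial>M) \<partial>PM {b})"
  proof (rule integral_PM_fold)
    show "nice (PM ({b} \<union> V)) (\<lambda>x. (\<Prod>z\<in>V. K s (x b) (x z)) * (\<Prod>u\<in>insert b V. h (x u)))"
      by (intro nice_mult nice_prod nice_K nice_compose[OF h] component_PM) auto
    fix x y assume "x \<in> space (PM {b})" "y \<in> space (PM V)"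
    have "merge {b} V (x, y) z = y z" if "z \<in> V" for z using that V by (auto simp: merge_def)
    then show "(\<Prod>z\<in>V. K s (merge {b} V (x, y) b) (merge {b} V (x, y) z)) * (\<Prod>u\<in>insert b V. h (merge {b} V (x, y) u))
      = h (x b) * (\<Prod>z\<in>V. K s (x b) (y z) * h (y z))"
      using V by (simp add: merge_def prod.distrib)
  next
    fix j x assume "x \<in> space (PM {b})"
    then show "nice M (\<lambda>t. K s (x b) t * h t)" using h
      by (intro nice_mult nice_K h) (auto simp: component_space)
  qed (use V in auto)
  also have "\<dots> = (\<integral>x. (\<lambda>c. h c * dKw s h c ^ card V) (x b) \<partial>PM {b})" by (simp add: dKw_def)
  also have "\<dots> = (\<integral>c. h c * dKw s h c ^ card V \<partial>M)"
    by (rule integral_PM_singleton) (intro kernel_nice h nice_dKw[OF h]; simp)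
  finally show ?thesis by simp
qed

lemma integral_two_centres:
  fixes N :: "nat \<Rightarrow> nat set"
  assumes V: "finite V" "b \<notin> V" "b' \<notin> V" "b \<noteq> b'" and h: "nice M h" and \<Phi>: "nice2 \<Phi>"
    and N: "\<And>z. z \<in> V \<Longrightarrow> N z = {b} \<or> N z = {b'} \<or> N z = {b, b'}"
  shows "(\<integral>x. \<Phi> (x b) (x b') * (\<Prod>z\<in>V. \<Prod>c\<in>N z. K s (x c) (x z)) * (\<Prod>u\<in>{b, b'} \<union> V. h (x u)) \<partial>PM ({b, b'} \<union> V))
    = pair_moment s h \<Phi> (card {z\<in>V. N z = {b}}) (card {z\<in>V. N z = {b, b'}}) (card {z\<in>V. N z = {b'}})"
proof -
  let ?i = "card {z\<in>V. N z = {b}}" and ?k = "card {z\<in>V. N z = {b, b'}}" and ?l = "card {z\<in>V. N z = {b'}}"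
  have NV: "c \<in> {b, b'}" if "z \<in> V" "c \<in> N z" for z c using N that by blast
  have "(\<integral>x. \<Phi> (x b) (x b') * (\<Prod>z\<in>V. \<Prod>c\<in>N z. K s (x c) (x z)) * (\<Prod>u\<in>{b, b'} \<union> V. h (x u)) \<partial>PM ({b, b'} \<union> V))
    = (\<integral>x. (\<Phi> (x b) (x b') * (h (x b) * h (x b'))) * (\<Prod>z\<in>V. \<integral>t. (\<Prod>c\<in>N z. K s (x c) t) * h t \<partial>M) \<partial>PM {b, b'})"
  proof (rule integral_PM_fold)
    show "nice (PM ({b, b'} \<union> V)) (\<lambda>x. \<Phi> (x b) (x b') * (\<Prod>z\<in>V. \<Prod>c\<in>N z. K s (x c) (x z)) * (\<Prod>u\<in>{b, b'} \<union> V. h (x u)))"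
      by (intro nice_mult nice_prod nice_K nice_compose[OF h] nice_compose2[OF \<Phi>] component_PM) (use NV in auto)
    fix x y assume "x \<in> space (PM {b, b'})" "y \<in> space (PM V)"
    have m: "merge {b, b'} V (x, y) z = y z" if "z \<in> V" for z using that V by (auto simp: merge_def)
    have m': "merge {b, b'} V (x, y) c = x c" if "c \<in> {b, b'}" for c using that V by (auto simp: merge_def)
    have "(\<Prod>z\<in>V. \<Prod>c\<in>N z. K s (merge {b, b'} V (x, y) c) (merge {b, b'} V (x, y) z)) = (\<Prod>z\<in>V. \<Prod>c\<in>N z. K s (x c) (y z))"
      by (intro prod.cong refl) (simp add: m m'[OF NV])
    moreover have "(\<Prod>u\<in>{b, b'} \<union> V. h (merge {b, b'} V (x, y) u)) = (h (x b) * h (x b')) * (\<Prod>z\<in>V. h (y z))"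
      using V m m' by (simp add: mult.assoc)
    ultimately show "\<Phi> (merge {b, b'} V (x, y) b) (merge {b, b'} V (x, y) b')
        * (\<Prod>z\<in>V. \<Prod>c\<in>N z. K s (merge {b, b'} V (x, y) c) (merge {b, b'} V (x, y) z)) * (\<Prod>u\<in>{b, b'} \<union> V. h (merge {b, b'} V (x, y) u))
      = \<Phi> (x b) (x b') * (h (x b) * h (x b')) * (\<Prod>z\<in>V. (\<Prod>c\<in>N z. K s (x c) (y z)) * h (y z))"
      using m' by (simp add: prod.distrib mult_ac)
  next
    fix z x assume "z \<in> V" and x: "x \<in> space (PM {b, b'})"
    then have "x c \<in> space M" if "c \<in> N z" for c using component_space[OF x NV] that by auto
    then show "nice M (\<lambda>t. (\<Prod>c\<in>N z. K s (x c) t) * h t)" using h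
      by (intro nice_mult nice_prod nice_K h) auto
  qed (use V in auto)
  also have "\<dots> = (\<integral>x. (\<lambda>c c'. \<Phi> c c' * (h c * h c') * (dKw s h c ^ ?i * dKw s h c' ^ ?l) * cKw s h c c' ^ ?k) (x b) (x b') \<partial>PM {b, b'})"
  proof (rule Bochner_Integration.integral_cong[OF refl])
    fix x :: "nat \<Rightarrow> 'a"
    let ?q = "\<lambda>z. \<integral>t. (\<Prod>c\<in>N z. K s (x c) t) * h t \<partial>M"
    have parts: "V = {z\<in>V. N z = {b}} \<union> {z\<in>V. N z = {b'}} \<union> {z\<in>V. N z = {b, b'}}" using N by blast
    have "(\<Prod>z\<in>V. ?q z) = (\<Prod>z\<in>{z\<in>V. N z = {b}} \<union> {z\<in>V. N z = {b'}} \<union> {z\<in>V. N z = {b, b'}}. ?q z)" using parts by simp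
    also have "\<dots> = (\<Prod>z\<in>{z\<in>V. N z = {b}}. ?q z) * (\<Prod>z\<in>{z\<in>V. N z = {b'}}. ?q z) * (\<Prod>z\<in>{z\<in>V. N z = {b, b'}}. ?q z)"
      using V by (subst prod.union_disjoint; (subst prod.union_disjoint)?; auto simp: doubleton_eq_iff)
    also have "(\<Prod>z\<in>{z\<in>V. N z = {b}}. ?q z) = (\<Prod>z\<in>{z\<in>V. N z = {b}}. dKw s h (x b))"
      by (intro prod.cong refl) (simp add: dKw_def)
    also have "(\<Prod>z\<in>{z\<in>V. N z = {b'}}. ?q z) = (\<Prod>z\<in>{z\<in>V. N z = {b'}}. dKw s h (x b'))"
      by (intro prod.cong refl) (simp add: dKw_def)
    also have "(\<Prod>z\<in>{z\<in>V. N z = {b, b'}}. ?q z) = (\<Prod>z\<in>{z\<in>V. N z = {b, b'}}. cKw s h (x b) (x b'))"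
      using V by (intro prod.cong refl) (simp add: cKw_def)
    finally show "\<Phi> (x b) (x b') * (h (x b) * h (x b')) * (\<Prod>z\<in>V. ?q z)
      = (\<lambda>c c'. \<Phi> c c' * (h c * h c') * (dKw s h c ^ ?i * dKw s h c' ^ ?l) * cKw s h c c' ^ ?k) (x b) (x b')"
      by (simp add: mult.assoc)
  qed
  also have "\<dots> = pair_moment s h \<Phi> ?i ?k ?l"
    unfolding pair_moment_def by (rule integral_PM_pair[OF V(4)])
      (intro kernel_nice nice_compose2[OF \<Phi>] nice_compose[OF h] nice_dKw[OF h] nice_cKw[OF h]; simp)
  finally show ?thesis .
qed

end

subsection \<open>Small connected bipartite graphs\<close>

definition nbrs :: "(nat \<times> nat) set \<Rightarrow> nat set \<Rightarrow> nat \<Rightarrow> nat set" where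
  "nbrs E V z = {c \<in> V. (c, z) \<in> E \<or> (z, c) \<in> E}"

text \<open>Each edge has exactly one endpoint outside \<open>V\<close>, so edges correspond to
  pairs of such a vertex and a neighbour. Edges are stored with the smaller endpoint first; the
  bijection restores that order and the symmetry of \<open>f\<close> makes it harmless.\<close>

lemma prod_bipartite_edges:
  fixes f :: "nat \<Rightarrow> nat \<Rightarrow> real"
  assumes E: "E \<subseteq> {(u, v). u < v \<and> v < n}" and V: "V \<subseteq> {..<n}"
    and bip: "\<And>u v. (u, v) \<in> E \<Longrightarrow> (u \<in> V) \<noteq> (v \<in> V)" and sym: "\<And>u v. f u v = f v u"
  shows "(\<Prod>(u, v)\<in>E. f u v) = (\<Prod>z\<in>{..<n} - V. \<Prod>c\<in>nbrs E V z. f c z)"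
proof -
  have fin: "finite V" using V finite_subset by auto
  have lt: "u < v" "v < n" if "(u, v) \<in> E" for u v using E that by auto
  have "(\<Prod>z\<in>{..<n} - V. \<Prod>c\<in>nbrs E V z. f c z) = (\<Prod>(z, c)\<in>Sigma ({..<n} - V) (nbrs E V). f c z)"
    by (rule prod.Sigma) (auto simp: nbrs_def fin)
  also have "\<dots> = (\<Prod>(u, v)\<in>E. f u v)"
  proof (rule prod.reindex_bij_witness[where j = "\<lambda>(z, c). if z < c then (z, c) else (c, z)"
        and i = "\<lambda>(u, v). if u \<in> V then (v, u) else (u, v)"])
    fix p assume "p \<in> Sigma ({..<n} - V) (nbrs E V)"
    then obtain z c where p: "p = (z, c)" "z < n" "z \<notin> V" "c \<in> V" "(c, z) \<in> E \<or> (z, c) \<in> E"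
      by (auto simp: nbrs_def)
    then have cz: "(z, c) \<in> E \<and> z < c \<or> (c, z) \<in> E \<and> \<not> z < c" using lt(1) less_asym by blast
    show "(\<lambda>(u, v). if u \<in> V then (v, u) else (u, v)) ((\<lambda>(z, c). if z < c then (z, c) else (c, z)) p) = p"
      using p by simp
    show "(\<lambda>(z, c). if z < c then (z, c) else (c, z)) p \<in> E" using cz p(1) by auto
    show "(\<lambda>(u, v). f u v) ((\<lambda>(z, c). if z < c then (z, c) else (c, z)) p) = (\<lambda>(z, c). f c z) p"
      using p(1) sym[of z c] by simp
  next
    fix p assume "p \<in> E"
    then obtain u v where p: "p = (u, v)" "(u, v) \<in> E" by (cases p) auto
    have "u < v" "v < n" "(u \<in> V) \<noteq> (v \<in> V)" using lt bip p by auto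
    then show "(\<lambda>(z, c). if z < c then (z, c) else (c, z)) ((\<lambda>(u, v). if u \<in> V then (v, u) else (u, v)) p) = p"
      "(\<lambda>(u, v). if u \<in> V then (v, u) else (u, v)) p \<in> Sigma ({..<n} - V) (nbrs E V)"
      using p by (auto simp: nbrs_def)
  qed
  finally show ?thesis by simp
qed

lemma small_colour_class:
  assumes wf: "wf_graph H" and con: "connected_graph H" and bip: "bipartite_graph H" and n: "fst H \<le> 5"
  obtains V where "V \<subseteq> {..<fst H}" "card V = 1 \<or> card V = 2"
    "\<And>u v. (u, v) \<in> snd H \<Longrightarrow> (u \<in> V) \<noteq> (v \<in> V)"
proof -
  obtain c :: "nat \<Rightarrow> bool" where "\<forall>(u, v)\<in>snd H. c u \<noteq> c v"
    using bip unfolding bipartite_graph_def by blast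
  then have c: "c u \<noteq> c v" if "(u, v) \<in> snd H" for u v using that by blast
  have lt: "u < fst H" "v < fst H" if "(u, v) \<in> snd H" for u v using wf that by (auto simp: wf_graph_def)
  define A where "A b = {u. u < fst H \<and> c u = b}" for b
  have A: "A b \<subseteq> {..<fst H}" "finite (A b)" for b by (auto simp: A_def)
  have good: "(u \<in> A b) \<noteq> (v \<in> A b)" if "(u, v) \<in> snd H" for u v b
    using c[OF that] lt[OF that] by (auto simp: A_def)
  have un: "A True \<union> A False = {..<fst H}" "A True \<inter> A False = {}" by (auto simp: A_def)
  have sum: "card (A True) + card (A False) = fst H"
    using card_Un_disjoint[OF A(2) A(2) un(2)] un(1) by simp
  show ?thesis
  proof (cases "\<exists>b. card (A b) = 0")
    case True
    \<comment> \<open>An empty class leaves no edge, and connectedness then leaves one vertex; that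
      vertex is taken as the class instead.\<close>
    then obtain b where "A b = {}" using A by auto
    then have "snd H = {}" using good[of _ _ b] by auto
    moreover have "fst H \<ge> 1" "(0, fst H - 1) \<in> (snd H \<union> (snd H)\<inverse>)\<^sup>*"
      using con by (auto simp: connected_graph_def)
    ultimately have "fst H = 1" by auto
    then show ?thesis using that[of "{..<fst H}"] \<open>snd H = {}\<close> by auto
  next
    case False
    have "card (A True) \<le> 2 \<or> card (A False) \<le> 2" using sum n by linarith
    then obtain b where "card (A b) \<le> 2" by auto
    moreover have "card (A b) \<noteq> 0" using False by metis
    ultimately have "card (A b) = 1 \<or> card (A b) = 2" by linarith
    then show ?thesis by (rule that[OF A(1) _ good])
  qed
qed

lemma connected_nbrs_nonempty:
  assumes con: "connected_graph H" and u: "u < fst H" "v < fst H" "u \<noteq> v"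
  shows "\<exists>w. (u, w) \<in> snd H \<or> (w, u) \<in> snd H"
proof -
  have "(u, v) \<in> (snd H \<union> (snd H)\<inverse>)\<^sup>*" using con u by (auto simp: connected_graph_def)
  then show ?thesis using u(3) by (cases rule: converse_rtranclE) auto
qed

text \<open>Without a common neighbour, everything reachable from \<open>b\<close> is
  \<open>b\<close> or a neighbour of \<open>b\<close>: a step back into the class can only return to
  \<open>b\<close>. Then \<open>b'\<close> is unreachable.\<close>

lemma connected_common_nbr:
  assumes con: "connected_graph H" and b: "b < fst H" "b' < fst H" "b \<noteq> b'"
    and bip: "\<And>u v. (u, v) \<in> snd H \<Longrightarrow> (u \<in> {b, b'}) \<noteq> (v \<in> {b, b'})"
  shows "\<exists>z. nbrs (snd H) {b, b'} z = {b, b'} \<and> z \<notin> {b, b'} \<and> ((b, z) \<in> snd H \<or> (z, b) \<in> snd H)"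
proof (rule ccontr)
  assume no: "\<not> ?thesis"
  have "x = b \<or> (x \<notin> {b, b'} \<and> ((b, x) \<in> snd H \<or> (x, b) \<in> snd H))" if "(b, x) \<in> (snd H \<union> (snd H)\<inverse>)\<^sup>*" for x
    using that
  proof (induction rule: rtrancl_induct)
    case (step x y)
    then have xy: "(x, y) \<in> snd H \<or> (y, x) \<in> snd H" by auto
    from step.IH show ?case
    proof
      assume "x = b"
      then show ?thesis using xy bip by blast
    next
      assume x: "x \<notin> {b, b'} \<and> ((b, x) \<in> snd H \<or> (x, b) \<in> snd H)"
      then have "y \<in> {b, b'}" using xy bip by blast
      moreover have "y \<noteq> b'"
      proof
        assume "y = b'"
        then have "nbrs (snd H) {b, b'} x = {b, b'}" using x xy by (auto simp: nbrs_def)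
        then show False using no x by blast
      qed
      ultimately show ?thesis by blast
    qed
  qed simp
  moreover have "(b, b') \<in> (snd H \<union> (snd H)\<inverse>)\<^sup>*" using con b by (auto simp: connected_graph_def)
  ultimately show False using b(3) by blast
qed

text \<open>Bernoulli gives \<open>t ^ a \<ge> t + (a - 1) * (t^2 - t)\<close>, and the square of
  \<open>t - (w + 1) / 2\<close> is nonnegative.\<close>

lemma power_ge_weighted:
  fixes t w :: real assumes "0 \<le> t" "1 \<le> a"
  shows "t + (real a - 1) * (w * t - ((w + 1) / 2)^2) \<le> t ^ a"
proof -
  have "w * t - ((w + 1) / 2)^2 \<le> t^2 - t"
    using zero_le_power2[of "t - (w + 1)/2"] by (simp add: power2_eq_square field_simps)
  then have "(real a - 1) * (w * t - ((w + 1) / 2)^2) \<le> (real a - 1) * (t^2 - t)"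
    using assms(2) by (intro mult_left_mono) auto
  also have "t + (real a - 1) * (t^2 - t) = t * (1 + real (a - 1) * (t - 1))"
    using assms(2) by (simp add: of_nat_diff power2_eq_square algebra_simps)
  also have "\<dots> \<le> t * (1 + (t - 1)) ^ (a - 1)"
    using assms(1) by (intro mult_left_mono Bernoulli_inequality) auto
  also have "\<dots> = t ^ a" using assms(2) by (cases a) auto
  finally show ?thesis by simp
qed

section \<open>Independent apexes and the reduction to a single one\<close>

context signed_kernel begin

definition edge_prod :: "(nat \<times> nat) set \<Rightarrow> real \<Rightarrow> (nat \<Rightarrow> 'a) \<Rightarrow> real" where
  "edge_prod E s x = (\<Prod>(u, v)\<in>E. K s (x u) (x v))"

definition codeg :: "nat \<Rightarrow> real \<Rightarrow> (nat \<Rightarrow> 'a) \<Rightarrow> real" where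
  "codeg n s x = (\<integral>y. (\<Prod>u<n. K s (x u) y) \<partial>M)"

lemma nice_edge_prod:
  assumes "E \<subseteq> {(u, v). u < v \<and> v < n}" shows "nice (PM {..<n}) (edge_prod E s)"
  unfolding edge_prod_def case_prod_beta using assms
  by (intro nice_prod nice_K component_PM) auto

lemma nice_codeg: "nice (PM {..<n}) (codeg n s)"
  unfolding codeg_def
  by (intro nice_integral nice_prod nice_K measurable_snd measurable_compose[OF measurable_fst component_PM])

lemma edge_prod_nonneg: "s = 1 \<or> s = -1 \<Longrightarrow> 0 \<le> edge_prod E s x"
  unfolding edge_prod_def by (intro prod_nonneg) (auto intro: K_nonneg)

lemma codeg_nonneg: "s = 1 \<or> s = -1 \<Longrightarrow> 0 \<le> codeg n s x"
  unfolding codeg_def by (intro integral_nonneg_AE AE_I2 prod_nonneg) (auto intro: K_nonneg)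

text \<open>New vertices are pairwise non-adjacent, hence independent once the copy of
  \<open>H\<close> is placed, and each contributes one codegree.\<close>

lemma integral_plus_graph:
  assumes wf: "wf_graph H"
  shows "(\<integral>x. edge_prod (snd (plus_graph H a)) s x \<partial>PM {..<fst H + a}) = (\<integral>x. edge_prod (snd H) s x * codeg (fst H) s x ^ a \<partial>PM {..<fst H})"
proof -
  define n where "n = fst H"
  define E where "E = snd H"
  have E: "E \<subseteq> {(u, v). u < v \<and> v < n}" using wf by (simp add: wf_graph_def E_def n_def)
  let ?J = "{n..<n + a}"
  have new: "{(u, n + i) |u i. u < n \<and> i < a} = {..<n} \<times> ?J"
    by (auto simp: le_iff_add)
  have finE: "finite E" by (rule finite_subset[of _ "{..<n} \<times> {..<n}"]) (use E in auto)
  have split: "edge_prod (snd (plus_graph H a)) s x = edge_prod E s x * (\<Prod>j\<in>?J. \<Prod>u<n. K s (x u) (x j))" for x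
  proof -
    have "edge_prod (snd (plus_graph H a)) s x = (\<Prod>(u, v)\<in>E \<union> {..<n} \<times> ?J. K s (x u) (x v))"
      using new by (simp add: edge_prod_def plus_graph_def n_def E_def)
    also have "\<dots> = edge_prod E s x * (\<Prod>(u, v)\<in>{..<n} \<times> ?J. K s (x u) (x v))"
      unfolding edge_prod_def using E finE by (intro prod.union_disjoint) auto
    also have "(\<Prod>(u, v)\<in>{..<n} \<times> ?J. K s (x u) (x v)) = (\<Prod>u<n. \<Prod>j\<in>?J. K s (x u) (x j))"
      by (rule prod.cartesian_product[symmetric])
    also have "\<dots> = (\<Prod>j\<in>?J. \<Prod>u<n. K s (x u) (x j))" by (rule prod.swap)
    finally show ?thesis .
  qed
  have un: "{..<n + a} = {..<n} \<union> ?J" by auto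
  have "(\<integral>x. edge_prod E s x * (\<Prod>j\<in>?J. \<Prod>u<n. K s (x u) (x j)) \<partial>PM ({..<n} \<union> ?J))
      = (\<integral>x. edge_prod E s x * (\<Prod>j\<in>?J. \<integral>t. (\<Prod>u<n. K s (x u) t) \<partial>M) \<partial>PM {..<n})"
  proof (rule integral_PM_fold)
    show "nice (PM ({..<n} \<union> ?J)) (\<lambda>x. edge_prod E s x * (\<Prod>j\<in>?J. \<Prod>u<n. K s (x u) (x j)))"
      unfolding edge_prod_def case_prod_beta using E
      by (intro nice_mult nice_prod nice_K component_PM) auto
    fix x y :: "nat \<Rightarrow> 'a"
    let ?m = "merge {..<n} ?J (x, y)"
    have m: "?m u = x u" if "u < n" for u using that by (simp add: merge_def)
    have m': "?m j = y j" if "j \<in> ?J" for j using that by (simp add: merge_def)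
    have "edge_prod E s ?m = edge_prod E s x" unfolding edge_prod_def using E by (intro prod.cong refl) (auto simp: m)
    moreover have "(\<Prod>j\<in>?J. \<Prod>u<n. K s (?m u) (?m j)) = (\<Prod>j\<in>?J. \<Prod>u<n. K s (x u) (y j))"
      by (intro prod.cong refl) (simp add: m m')
    ultimately show "edge_prod E s ?m * (\<Prod>j\<in>?J. \<Prod>u<n. K s (?m u) (?m j)) = edge_prod E s x * (\<Prod>j\<in>?J. \<Prod>u<n. K s (x u) (y j))" by simp
  next
    fix j x assume "x \<in> space (PM {..<n})"
    then show "nice M (\<lambda>t. \<Prod>u<n. K s (x u) t)"
      by (intro nice_prod nice_K) (auto simp: component_space)
  qed auto
  then show ?thesis unfolding split n_def[symmetric] E_def[symmetric] un by (simp add: codeg_def)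
qed

lemma integral_weighted_codeg:
  assumes F: "nice (PM {..<n}) F"
  shows "(\<integral>x. F x * codeg n s x \<partial>PM {..<n}) = (\<integral>y. \<integral>x. F x * (\<Prod>u<n. K s (x u) y) \<partial>PM {..<n} \<partial>M)"
proof -
  have "(\<integral>x. F x * codeg n s x \<partial>PM {..<n}) = (\<integral>x. \<integral>y. F x * (\<Prod>u<n. K s (x u) y) \<partial>M \<partial>PM {..<n})"
    by (simp add: codeg_def)
  also have "\<dots> = (\<integral>y. \<integral>x. F x * (\<Prod>u<n. K s (x u) y) \<partial>PM {..<n} \<partial>M)"
    by (rule integral_swap_nice[OF prob_space_PM prob_space_axioms])
      (intro nice_mult nice_prod nice_K nice_compose[OF F] measurable_fst measurable_snd measurable_compose[OF measurable_fst component_PM])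
  finally show ?thesis .
qed

text \<open>All numbers of apexes follow from two conditions that do not mention \<open>a\<close>:
  the claim for one apex, and nonnegativity of the linearised increment, which enters with the
  factor \<open>a - 1\<close>.\<close>

lemma codeg_power_sum_ge:
  fixes \<Omega> :: "real \<Rightarrow> (nat \<Rightarrow> 'a) \<Rightarrow> real"
  assumes E: "E \<subseteq> {(u, v). u < v \<and> v < n}" and a: "1 \<le> a"
    and \<Omega>: "\<And>s. nice (PM {..<n}) (\<Omega> s)"
    and one: "2 \<le> (\<integral>x. edge_prod E 1 x * codeg n 1 x \<partial>PM {..<n}) + (\<integral>x. edge_prod E (-1) x * codeg n (-1) x \<partial>PM {..<n})"
    and inc: "(\<integral>x. edge_prod E 1 x * ((\<Omega> 1 x + 1) / 2)^2 \<partial>PM {..<n}) + (\<integral>x. edge_prod E (-1) x * ((\<Omega> (-1) x + 1) / 2)^2 \<partial>PM {..<n})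
      \<le> (\<integral>x. edge_prod E 1 x * \<Omega> 1 x * codeg n 1 x \<partial>PM {..<n}) + (\<integral>x. edge_prod E (-1) x * \<Omega> (-1) x * codeg n (-1) x \<partial>PM {..<n})"
  shows "2 \<le> (\<integral>x. edge_prod E 1 x * codeg n 1 x ^ a \<partial>PM {..<n}) + (\<integral>x. edge_prod E (-1) x * codeg n (-1) x ^ a \<partial>PM {..<n})"
proof -
  note n = nice_intros nice_edge_prod[OF E] nice_codeg \<Omega>
  have lower: "(\<integral>x. edge_prod E s x * codeg n s x \<partial>PM {..<n}) + (real a - 1) * ((\<integral>x. edge_prod E s x * \<Omega> s x * codeg n s x \<partial>PM {..<n})
      - (\<integral>x. edge_prod E s x * ((\<Omega> s x + 1) / 2)^2 \<partial>PM {..<n})) \<le> (\<integral>x. edge_prod E s x * codeg n s x ^ a \<partial>PM {..<n})"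
    if s: "s = 1 \<or> s = -1" for s
  proof -
    let ?A = "\<lambda>x. edge_prod E s x * codeg n s x" and ?B = "\<lambda>x. edge_prod E s x * \<Omega> s x * codeg n s x"
      and ?C = "\<lambda>x. edge_prod E s x * ((\<Omega> s x + 1) / 2)^2"
    have i: "integrable (PM {..<n}) ?A" "integrable (PM {..<n}) ?B" "integrable (PM {..<n}) ?C"
      "integrable (PM {..<n}) (\<lambda>x. edge_prod E s x * codeg n s x ^ a)" by (intro integrable_nice_PM n)+
    have "(\<integral>x. ?A x \<partial>PM {..<n}) + (real a - 1) * ((\<integral>x. ?B x \<partial>PM {..<n}) - (\<integral>x. ?C x \<partial>PM {..<n}))
        = (\<integral>x. ?A x + (real a - 1) * (?B x - ?C x) \<partial>PM {..<n})"
      using i by simp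
    also have "\<dots> \<le> (\<integral>x. edge_prod E s x * codeg n s x ^ a \<partial>PM {..<n})"
    proof (rule integral_mono)
      fix x
      have "edge_prod E s x * (codeg n s x + (real a - 1) * (\<Omega> s x * codeg n s x - ((\<Omega> s x + 1) / 2)^2)) \<le> edge_prod E s x * codeg n s x ^ a"
        by (intro mult_left_mono power_ge_weighted codeg_nonneg edge_prod_nonneg s a)
      then show "?A x + (real a - 1) * (?B x - ?C x) \<le> edge_prod E s x * codeg n s x ^ a"
        by (simp add: algebra_simps)
    qed (use i in auto)
    finally show ?thesis .
  qed
  let ?b = "\<lambda>s. \<integral>x. edge_prod E s x * \<Omega> s x * codeg n s x \<partial>PM {..<n}" and ?c = "\<lambda>s. \<integral>x. edge_prod E s x * ((\<Omega> s x + 1) / 2)^2 \<partial>PM {..<n}"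
  have "0 \<le> (real a - 1) * ((?b 1 + ?b (-1)) - (?c 1 + ?c (-1)))"
    using a inc by (intro mult_nonneg_nonneg) auto
  also have "\<dots> = (real a - 1) * (?b 1 - ?c 1) + (real a - 1) * (?b (-1) - ?c (-1))" by (simp only: algebra_simps)
  finally show ?thesis using lower[of 1] lower[of "-1"] one by linarith
qed

end

section \<open>Stars and graphs with two centres\<close>

context signed_kernel begin

lemma plus_star_sum_ge:
  assumes wf: "wf_graph H" and con: "connected_graph H" and n: "fst H \<le> 5" and a: "1 \<le> a" and b: "b < fst H"
    and bip: "\<And>u v. (u, v) \<in> snd H \<Longrightarrow> (u \<in> {b}) \<noteq> (v \<in> {b})"
  shows "2 \<le> (\<integral>x. edge_prod (snd H) 1 x * codeg (fst H) 1 x ^ a \<partial>PM {..<fst H})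
    + (\<integral>x. edge_prod (snd H) (-1) x * codeg (fst H) (-1) x ^ a \<partial>PM {..<fst H})"
proof -
  define E where "E = snd H"
  define W where "W = {..<fst H} - {b}"
  define k where "k = card W"
  have E: "E \<subseteq> {(u, v). u < v \<and> v < fst H}" using wf by (simp add: wf_graph_def E_def)
  have W: "finite W" "b \<notin> W" "{..<fst H} = insert b W" using b by (auto simp: W_def)
  have "card W = fst H - 1" using b by (simp add: W_def)
  then have k: "k \<le> 4" using n by (simp add: k_def)
  have nb: "nbrs E {b} z = {b}" if "z \<in> W" for z
  proof -
    have "z < fst H" "z \<noteq> b" using that by (auto simp: W_def)
    then obtain w where "(z, w) \<in> E \<or> (w, z) \<in> E"
      using connected_nbrs_nonempty[OF con _ b] unfolding E_def by blast
    then have "(z, b) \<in> E \<or> (b, z) \<in> E" using bip[of z w] bip[of w z] that by (auto simp: W_def E_def)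
    then show ?thesis by (auto simp: nbrs_def)
  qed
  have f: "edge_prod E s x = (\<Prod>z\<in>W. K s (x b) (x z))" for s x
  proof -
    have "edge_prod E s x = (\<Prod>z\<in>{..<fst H} - {b}. \<Prod>c\<in>nbrs E {b} z. K s (x c) (x z))"
      unfolding edge_prod_def by (rule prod_bipartite_edges[OF E]) (use b bip K_sym in \<open>auto simp: E_def\<close>)
    then show ?thesis using nb by (simp add: W_def)
  qed
  have conv: "(\<integral>x. edge_prod E s x * (\<Prod>u<fst H. h (x u)) \<partial>PM {..<fst H}) = (\<integral>c. h c * dKw s h c ^ k \<partial>M)"
    if "nice M h" for s h
    unfolding f W(3) k_def by (rule integral_star[OF W(1,2) that])
  have one: "(\<integral>x. edge_prod E s x * codeg (fst H) s x \<partial>PM {..<fst H}) = E2 (\<lambda>y c. K s c y * cK s c y ^ k)"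
    if s: "s = 1 \<or> s = -1" for s
    unfolding integral_weighted_codeg[OF nice_edge_prod[OF E]]
  proof (rule Bochner_Integration.integral_cong[OF refl])
    fix y assume y: "y \<in> space M"
    have "(\<integral>x. edge_prod E s x * (\<Prod>u<fst H. K s (x u) y) \<partial>PM {..<fst H}) = (\<integral>c. K s c y * dKw s (\<lambda>z. K s z y) c ^ k \<partial>M)"
      by (rule conv) (use y in \<open>simp add: nice_K\<close>)
    also have "\<dots> = (\<integral>c. K s c y * cK s c y ^ k \<partial>M)"
      using y s by (intro Bochner_Integration.integral_cong refl) (simp add: dKw_K)
    finally show "(\<integral>x. edge_prod E s x * (\<Prod>u<fst H. K s (x u) y) \<partial>PM {..<fst H}) = (\<integral>c. K s c y * cK s c y ^ k \<partial>M)" .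
  qed
  have zero: "(\<integral>x. edge_prod E s x \<partial>PM {..<fst H}) = (\<integral>c. dK s c ^ k \<partial>M)" for s
  proof -
    have "(\<integral>x. edge_prod E s x \<partial>PM {..<fst H}) = (\<integral>c. dKw s (\<lambda>_. 1) c ^ k \<partial>M)"
      using conv[OF nice_const, of s 1] by simp
    also have "\<dots> = (\<integral>c. dK s c ^ k \<partial>M)" by (intro Bochner_Integration.integral_cong refl) (simp add: dKw_one)
    finally show ?thesis .
  qed
  have "2 \<le> (\<integral>x. edge_prod E 1 x * codeg (fst H) 1 x ^ a \<partial>PM {..<fst H}) + (\<integral>x. edge_prod E (-1) x * codeg (fst H) (-1) x ^ a \<partial>PM {..<fst H})"
    by (rule codeg_power_sum_ge[OF E a, where \<Omega> = "\<lambda>_ _. 1"])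
      (use star_inequalities[OF k] in \<open>simp_all add: nice_const one zero\<close>)
  then show ?thesis by (simp add: E_def)
qed

lemma plus_two_centres_sum_ge:
  assumes wf: "wf_graph H" and con: "connected_graph H" and n: "fst H \<le> 5" and a: "1 \<le> a"
    and b: "b < fst H" "b' < fst H" "b \<noteq> b'"
    and bip: "\<And>u v. (u, v) \<in> snd H \<Longrightarrow> (u \<in> {b, b'}) \<noteq> (v \<in> {b, b'})"
  shows "2 \<le> (\<integral>x. edge_prod (snd H) 1 x * codeg (fst H) 1 x ^ a \<partial>PM {..<fst H})
    + (\<integral>x. edge_prod (snd H) (-1) x * codeg (fst H) (-1) x ^ a \<partial>PM {..<fst H})"
proof -
  define E where "E = snd H"
  define W where "W = {..<fst H} - {b, b'}"
  define N where "N = nbrs E {b, b'}"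
  define i where "i = card {z\<in>W. N z = {b}}"
  define k where "k = card {z\<in>W. N z = {b, b'}}"
  define l where "l = card {z\<in>W. N z = {b'}}"
  have E: "E \<subseteq> {(u, v). u < v \<and> v < fst H}" using wf by (simp add: wf_graph_def E_def)
  have W: "finite W" "b \<notin> W" "b' \<notin> W" "{..<fst H} = {b, b'} \<union> W" using b by (auto simp: W_def)
  have N: "N z = {b} \<or> N z = {b'} \<or> N z = {b, b'}" if "z \<in> W" for z
  proof -
    have "z < fst H" "z \<noteq> b" using that by (auto simp: W_def)
    then obtain w where w: "(z, w) \<in> E \<or> (w, z) \<in> E"
      using connected_nbrs_nonempty[OF con _ b(1)] unfolding E_def by blast
    then have "w \<in> N z" using bip[of z w] bip[of w z] that by (auto simp: W_def E_def N_def nbrs_def)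
    moreover have "N z \<subseteq> {b, b'}" by (auto simp: N_def nbrs_def)
    ultimately show ?thesis by blast
  qed
  have k1: "1 \<le> k"
  proof -
    obtain z where z: "N z = {b, b'}" "z \<notin> {b, b'}" "(b, z) \<in> E \<or> (z, b) \<in> E"
      using connected_common_nbr[OF con b bip] unfolding N_def E_def by blast
    then have "z \<in> W" using E b by (auto simp: W_def)
    then have "{z\<in>W. N z = {b, b'}} \<noteq> {}" using z by blast
    then show ?thesis using W(1) by (simp add: k_def Suc_le_eq card_gt_0_iff)
  qed
  \<comment> \<open>This is where the bound on the number of vertices enters: five vertices leave at
    most three outside the two centres.\<close>
  have ikl: "i + k + l \<le> 3"
  proof -
    have "card ({z\<in>W. N z = {b}} \<union> {z\<in>W. N z = {b, b'}} \<union> {z\<in>W. N z = {b'}}) = i + k + l"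
      unfolding i_def k_def l_def using W(1) b(3)
      by (subst card_Un_disjoint; (subst card_Un_disjoint)?; auto simp: doubleton_eq_iff)
    moreover have "card ({z\<in>W. N z = {b}} \<union> {z\<in>W. N z = {b, b'}} \<union> {z\<in>W. N z = {b'}}) \<le> card W"
      using W(1) by (intro card_mono) auto
    moreover have "card W = fst H - 2" using b by (simp add: W_def card_Diff_subset)
    ultimately show ?thesis using n by linarith
  qed
  have f: "edge_prod E s x = (\<Prod>z\<in>W. \<Prod>c\<in>N z. K s (x c) (x z))" for s x
    unfolding edge_prod_def W_def N_def
    by (rule prod_bipartite_edges[OF E]) (use b bip K_sym in \<open>auto simp: E_def\<close>)
  \<comment> \<open>Kept general in \<open>h\<close>: the kernel at an apex yields the densities
    with apex, the constant 1 those without.\<close>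
  have conv: "(\<integral>x. edge_prod E s x * \<Phi> (x b) (x b') * (\<Prod>u<fst H. h (x u)) \<partial>PM {..<fst H}) = pair_moment s h \<Phi> i k l"
    if "nice M h" "nice2 \<Phi>" for s h \<Phi>
    using integral_two_centres[where s = s, OF W(1-3) b(3) that N]
    unfolding f W(4) i_def k_def l_def by (simp only: mult.commute[of "\<Phi> _ _"])
  have nf: "nice (PM {..<fst H}) (\<lambda>x. \<Phi> (x b) (x b'))" if "nice2 \<Phi>" for \<Phi>
    by (intro nice_compose2[OF that] component_PM) (use b in auto)
  have one: "(\<integral>x. edge_prod E s x * \<Phi> (x b) (x b') * codeg (fst H) s x \<partial>PM {..<fst H}) = hub_moment s \<Phi> i k l" if "nice2 \<Phi>" for s \<Phi>
    unfolding integral_weighted_codeg[OF nice_mult[OF nice_edge_prod[OF E] nf[OF that]]] hub_moment_def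
    by (intro Bochner_Integration.integral_cong refl conv that) (simp add: nice_K)
  have zero: "(\<integral>x. edge_prod E s x * \<Phi> (x b) (x b') \<partial>PM {..<fst H}) = pair_moment s (\<lambda>_. 1) \<Phi> i k l" if "nice2 \<Phi>" for s \<Phi>
    using conv[OF nice_const that, of s 1] by simp
  obtain \<Omega> where \<Omega>: "\<And>s. nice2 (\<Omega> s)" "0 \<le> increment \<Omega> i k l"
    using increment_nonneg_exists[OF k1 ikl] by blast
  have n\<Omega>: "nice2 (\<lambda>x y. ((\<Omega> s x y + 1) / 2)^2)" for s by (intro nice_intros \<Omega>(1))
  have "2 \<le> (\<integral>x. edge_prod E 1 x * codeg (fst H) 1 x ^ a \<partial>PM {..<fst H}) + (\<integral>x. edge_prod E (-1) x * codeg (fst H) (-1) x ^ a \<partial>PM {..<fst H})"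
  proof (rule codeg_power_sum_ge[OF E a, where \<Omega> = "\<lambda>s x. \<Omega> s (x b) (x b')"])
    show "nice (PM {..<fst H}) (\<lambda>x. \<Omega> s (x b) (x b'))" for s by (rule nf[OF \<Omega>(1)])
    show "2 \<le> (\<integral>x. edge_prod E 1 x * codeg (fst H) 1 x \<partial>PM {..<fst H}) + (\<integral>x. edge_prod E (-1) x * codeg (fst H) (-1) x \<partial>PM {..<fst H})"
      using hub_moment_one_ge[OF k1 ikl] one[OF nice_const, of _ 1] by simp
    show "(\<integral>x. edge_prod E 1 x * ((\<Omega> 1 (x b) (x b') + 1) / 2)^2 \<partial>PM {..<fst H}) + (\<integral>x. edge_prod E (-1) x * ((\<Omega> (-1) (x b) (x b') + 1) / 2)^2 \<partial>PM {..<fst H})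
      \<le> (\<integral>x. edge_prod E 1 x * \<Omega> 1 (x b) (x b') * codeg (fst H) 1 x \<partial>PM {..<fst H}) + (\<integral>x. edge_prod E (-1) x * \<Omega> (-1) (x b) (x b') * codeg (fst H) (-1) x \<partial>PM {..<fst H})"
      unfolding one[OF \<Omega>(1)] zero[OF n\<Omega>] using \<Omega>(2) by (simp add: increment_def)
  qed
  then show ?thesis by (simp add: E_def)
qed

lemma plus_graph_sum_ge:
  assumes H: "wf_graph H" "connected_graph H" "bipartite_graph H" "fst H \<le> 5" and a: "1 \<le> a"
  shows "2 \<le> (\<integral>x. edge_prod (snd (plus_graph H a)) 1 x \<partial>PM {..<fst H + a}) + (\<integral>x. edge_prod (snd (plus_graph H a)) (-1) x \<partial>PM {..<fst H + a})"
proof -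
  obtain V where V: "V \<subseteq> {..<fst H}" "card V = 1 \<or> card V = 2"
    and bip: "\<And>u v. (u, v) \<in> snd H \<Longrightarrow> (u \<in> V) \<noteq> (v \<in> V)"
    using small_colour_class[OF H] by blast
  show ?thesis unfolding integral_plus_graph[OF H(1)]
  proof (cases "card V = 1")
    case True
    then obtain b where "V = {b}" by (auto simp: card_Suc_eq)
    then show "2 \<le> (\<integral>x. edge_prod (snd H) 1 x * codeg (fst H) 1 x ^ a \<partial>PM {..<fst H})
      + (\<integral>x. edge_prod (snd H) (-1) x * codeg (fst H) (-1) x ^ a \<partial>PM {..<fst H})"
      using V bip by (intro plus_star_sum_ge[where b = b] H a) auto
  next
    case False
    then obtain b b' where "V = {b, b'}" "b \<noteq> b'" using V(2) by (auto simp: card_2_iff)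
    then show "2 \<le> (\<integral>x. edge_prod (snd H) 1 x * codeg (fst H) 1 x ^ a \<partial>PM {..<fst H})
      + (\<integral>x. edge_prod (snd H) (-1) x * codeg (fst H) (-1) x ^ a \<partial>PM {..<fst H})"
      using V bip by (intro plus_two_centres_sum_ge[where b = b and b' = b'] H a) auto
  qed
qed

end

section \<open>From graphons to signed kernels\<close>

lemma prob_space_unit_interval: "prob_space unit_interval"
  unfolding unit_interval_def by (rule prob_spaceI) (simp add: emeasure_restrict_space)

lemma space_unit_interval: "space unit_interval = {0..1}"
  by (simp add: unit_interval_def space_restrict_space)

text \<open>The kernel is set to 0 off the unit square because symmetry and the bound are demanded
  at all real points, while a graphon guarantees them only on the square.\<close>

lemma graphon_signed_kernel:
  assumes W: "graphon W"
  shows "signed_kernel unit_interval (\<lambda>x y. if x \<in> {0..1} \<and> y \<in> {0..1} then 2 * W x y - 1 else 0)"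
proof -
  interpret prob_space unit_interval by (rule prob_space_unit_interval)
  have m: "(\<lambda>p. W (fst p) (snd p)) \<in> borel_measurable (unit_interval \<Otimes>\<^sub>M unit_interval)"
    using W by (simp add: graphon_def case_prod_beta')
  show ?thesis
  proof
    show "(\<lambda>p. if fst p \<in> {0..1} \<and> snd p \<in> {0..1} then 2 * W (fst p) (snd p) - 1 else 0)
        \<in> borel_measurable (unit_interval \<Otimes>\<^sub>M unit_interval)"
    proof (subst measurable_cong)
      show "(\<lambda>p. 2 * W (fst p) (snd p) - 1) \<in> borel_measurable (unit_interval \<Otimes>\<^sub>M unit_interval)"
        using m by measurable
    qed (auto simp: space_pair_measure space_unit_interval)
  next
    fix x y :: real
    show "(if x \<in> {0..1} \<and> y \<in> {0..1} then 2 * W x y - 1 else 0) = (if y \<in> {0..1} \<and> x \<in> {0..1} then 2 * W y x - 1 else 0)"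
      using W unfolding graphon_def by auto
    have "\<bar>2 * W x y - 1\<bar> \<le> 1" if "x \<in> {0..1}" "y \<in> {0..1}"
    proof -
      have "0 \<le> W x y" "W x y \<le> 1" using W that unfolding graphon_def by blast+
      then show ?thesis by simp
    qed
    then show "\<bar>if x \<in> {0..1} \<and> y \<in> {0..1} then 2 * W x y - 1 else 0\<bar> \<le> 1" by simp
  qed
qed

text \<open>Each edge absorbs one factor 2, which turns the threshold \<open>2 powr (1 - e)\<close>
  into the bound 2 for the sum over the colours.\<close>

lemma hom_density_eq:
  assumes E: "snd G \<subseteq> {(u, v). u < fst G \<and> v < fst G}"
    and W: "\<And>x y. x \<in> {0..1} \<Longrightarrow> y \<in> {0..1} \<Longrightarrow> 2 * W x y = k x y"
  shows "hom_density G W = (\<integral>x. (\<Prod>(u, v)\<in>snd G. k (x u) (x v)) \<partial>Pi\<^sub>M {..<fst G} (\<lambda>_. unit_interval)) / 2 ^ num_edges G"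
proof -
  have "hom_density G W = (\<integral>x. (\<Prod>(u, v)\<in>snd G. k (x u) (x v)) / 2 ^ num_edges G \<partial>Pi\<^sub>M {..<fst G} (\<lambda>_. unit_interval))"
    unfolding hom_density_def
  proof (rule Bochner_Integration.integral_cong[OF refl])
    fix x assume x: "x \<in> space (Pi\<^sub>M {..<fst G} (\<lambda>_. unit_interval))"
    have xu: "x u \<in> {0..1}" if "u < fst G" for u
      using x that by (auto simp: space_PiM space_unit_interval PiE_def Pi_def)
    have "(\<Prod>(u, v)\<in>snd G. W (x u) (x v)) = (\<Prod>(u, v)\<in>snd G. k (x u) (x v) / 2)"
    proof (rule prod.cong[OF refl])
      fix p assume "p \<in> snd G"
      then show "(case p of (u, v) \<Rightarrow> W (x u) (x v)) = (case p of (u, v) \<Rightarrow> k (x u) (x v) / 2)"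
        using E W[of "x (fst p)" "x (snd p)"] xu by (auto simp: case_prod_beta)
    qed
    also have "\<dots> = (\<Prod>(u, v)\<in>snd G. k (x u) (x v)) / 2 ^ num_edges G"
      by (simp add: case_prod_beta prod_dividef num_edges_def)
    finally show "(\<Prod>(u, v)\<in>snd G. W (x u) (x v)) = (\<Prod>(u, v)\<in>snd G. k (x u) (x v)) / 2 ^ num_edges G" .
  qed
  then show ?thesis by simp
qed

lemma common_plus_graph:
  assumes H: "wf_graph H" "connected_graph H" "bipartite_graph H" "fst H \<le> 5" and a: "1 \<le> a"
  shows "common (plus_graph H a)"
  unfolding common_def
proof (intro allI impI)
  fix W assume W: "graphon W"
  define G where "G = plus_graph H a"
  interpret signed_kernel unit_interval "\<lambda>x y. if x \<in> {0..1} \<and> y \<in> {0..1} then 2 * W x y - 1 else 0"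
    by (rule graphon_signed_kernel[OF W])
  have E: "snd G \<subseteq> {(u, v). u < fst G \<and> v < fst G}"
    using H(1) by (auto simp: G_def plus_graph_def wf_graph_def)
  have K: "K 1 x y = 2 * W x y" "K (-1) x y = 2 * (1 - W x y)" if "x \<in> {0..1}" "y \<in> {0..1}" for x y
    using that by (simp_all only: K_def) simp_all
  have fG: "fst G = fst H + a" by (simp add: G_def plus_graph_def)
  have "m_density G W = (\<integral>x. edge_prod (snd G) 1 x \<partial>PM {..<fst G}) / 2 ^ num_edges G + (\<integral>x. edge_prod (snd G) (-1) x \<partial>PM {..<fst G}) / 2 ^ num_edges G"
    unfolding m_density_def edge_prod_def
    by (intro arg_cong2[where f = "(+)"] hom_density_eq[OF E] K(1)[symmetric] K(2)[symmetric])
  also have "\<dots> \<ge> 2 / 2 ^ num_edges G"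
    unfolding add_divide_distrib[symmetric] using plus_graph_sum_ge[OF H a]
    by (intro divide_right_mono) (simp_all add: fG[symmetric] G_def[symmetric])
  also have "2 / 2 ^ num_edges G = 2 powr (1 - real (num_edges G))"
    by (simp add: powr_diff powr_realpow)
  finally show "2 powr (1 - real (num_edges (plus_graph H a))) \<le> m_density (plus_graph H a) W" by (simp add: G_def)
qed

section \<open>Complete tripartite graphs\<close>

definition K_bipartite :: "nat \<Rightarrow> nat \<Rightarrow> graph" where
  "K_bipartite p q = (p + q, {..<p} \<times> {p..<p + q})"

text \<open>The third part carries exactly the labels of the added vertices, so the two graphs are
  equal and no isomorphism is involved.\<close>

lemma complete_tripartite_eq: "complete_tripartite p q r = plus_graph (K_bipartite p q) r"
proof -
  have "{(u, v). u < v \<and> v < p + q + r \<and> part_of p q u \<noteq> part_of p q v}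
      = {..<p} \<times> {p..<p + q} \<union> {(u, p + q + i) |u i. u < p + q \<and> i < r}" (is "?L = ?R")
  proof (intro set_eqI iffI)
    fix e assume "e \<in> ?L"
    then obtain u v where e: "e = (u, v)" "u < v" "v < p + q + r" "part_of p q u \<noteq> part_of p q v" by auto
    show "e \<in> ?R"
    proof (cases "v < p + q")
      case True
      then show ?thesis using e by (auto simp: part_of_def split: if_splits)
    next
      case False
      then have "v = p + q + (v - (p + q))" "v - (p + q) < r" "u < p + q"
        using e by (auto simp: part_of_def split: if_splits)
      then show ?thesis unfolding e by blast
    qed
  qed (auto simp: part_of_def)
  then show ?thesis by (simp add: complete_tripartite_def plus_graph_def K_bipartite_def)
qed

lemma common_complete_tripartite:
  assumes "1 \<le> p" "1 \<le> q" "p + q \<le> 5" "1 \<le> r"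
  shows "common (complete_tripartite p q r)"
  unfolding complete_tripartite_eq
proof (rule common_plus_graph)
  show "wf_graph (K_bipartite p q)" by (auto simp: wf_graph_def K_bipartite_def)
  show "bipartite_graph (K_bipartite p q)"
    unfolding bipartite_graph_def by (rule exI[of _ "\<lambda>u. u < p"]) (auto simp: K_bipartite_def)
  show "connected_graph (K_bipartite p q)"
    unfolding connected_graph_def
  proof (intro conjI allI impI)
    let ?R = "snd (K_bipartite p q) \<union> (snd (K_bipartite p q))\<inverse>"
    have cross: "(u, v) \<in> ?R" if "u < p + q" "v < p + q" "(u < p) \<noteq> (v < p)" for u v
      using that by (auto simp: K_bipartite_def)
    fix u v assume uv: "u < fst (K_bipartite p q)" "v < fst (K_bipartite p q)"
    then have uv: "u < p + q" "v < p + q" by (simp_all add: K_bipartite_def)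
    show "(u, v) \<in> ?R\<^sup>*"
    proof (cases "(u < p) = (v < p)")
      case False
      then show ?thesis using cross uv by blast
    next
      case True
      \<comment> \<open>A vertex of the opposite class, adjacent to both \<open>u\<close> and
        \<open>v\<close>.\<close>
      define w where "w = (if u < p then p else 0)"
      have "w < p + q" "(u < p) \<noteq> (w < p)" "(w < p) \<noteq> (v < p)" using True assms by (auto simp: w_def)
      then have "(u, w) \<in> ?R" "(w, v) \<in> ?R" using cross uv by blast+
      then show ?thesis by (meson r_into_rtrancl rtrancl.rtrancl_into_rtrancl)
    qed
  qed (use assms in \<open>simp add: K_bipartite_def\<close>)
qed (use assms in \<open>auto simp: K_bipartite_def\<close>)

theorem theorem1p4:
  shows "(\<forall>H a. wf_graph H \<and> connected_graph H \<and> bipartite_graph H \<and> fst H \<le> 5 \<and> a \<ge> 1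
            \<longrightarrow> common (plus_graph H a))
         \<and> (\<forall>a \<ge> 1. common (complete_tripartite 2 2 a) \<and> common (complete_tripartite 2 3 a))"
  using common_plus_graph common_complete_tripartite[of 2 2] common_complete_tripartite[of 2 3] by simp

end
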